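(* Assume $E[y^2]<\infty$ and $\sigma^2_\rho\in L^p_{\rho_X}$ for some $1\le p\le\infty$. Let $D$ be a sample of size $N$ drawn i.i.d. from $\rho$. Then for every $\lambda>0$, $$E\bigl[\|f_{D,\lambda}-f_\rho\|_\rho\bigr]\le(1+59\kappa^4+59\kappa^2)(1+\kappa)\Bigl(1+\frac1{(N\lambda)^2}+\frac{\mathcal N(\lambda)}{N\lambda}\Bigr)\Bigl\{\Bigl(1+\frac1{\sqrt{N\lambda}}\Bigr)\|f_\lambda-f_\rho\|_\rho+\sqrt{\|\sigma^2_\rho\|_p}\Bigl(\frac{\mathcal N(\lambda)}{N}\Bigr)^{\frac12(1-\frac1p)}\Bigl(\frac1{N\lambda}\Bigr)^{\frac1{2p}}\Bigr\}.$$
   Context: Let $\mathcal X$ be a compact metric space, $\mathcal Y=\mathbb R$, $\mathcal Z=\mathcal X\times\mathcal Y$, and $\rho$ a Borel probability measure on $\mathcal Z$ with marginal $\rho_X$ on $\mathcal X$ and conditional distributions $\rho(\cdot|x)$. $K:\mathcal X\times\mathcal X\to\mathbb R$ is a Mercer kernel (continuous, symmetric, positive semidefinite), $(\mathcal H_K,\|\cdot\|_K)$ its reproducing kernel Hilbert space, $K_x=K(\cdot,x)$, and $\kappa=\sup_{x\in\mathcal X}\sqrt{K(x,x)}$. $\|\cdot\|_\rho$ is the norm of $L^2_{\rho_X}$ and $\|\cdot\|_p$ the norm of $L^p_{\rho_X}$. The regression function is $f_\rho(x)=\int_{\mathcal Y}y\,d\rho(y|x)$ and the conditional variance is $\sigma^2_\rho(x)=\int_{\mathcal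 Y}(y-f_\rho(x))^2d\rho(y|x)$. The integral operator $L_K:\mathcal H_K\to\mathcal H_K$ is $L_K f=\int_{\mathcal X}K_x f(x)\,d\rho_X(x)$. The effective dimension is $\mathcal N(\lambda)=\mathrm{Tr}\bigl((L_K+\lambda I)^{-1}L_K\bigr)$ for $\lambda>0$. For $\lambda>0$, $f_\lambda=\arg\min_{f\in\mathcal H_K}\{\int_{\mathcal Z}(f(x)-y)^2d\rho+\lambda\|f\|_K^2\}$, and for a finite sample $S\subset\mathcal Z$, $f_{S,\lambda}=\arg\min_{f\in\mathcal H_K}\{\frac1{|S|}\sum_{(x,y)\in S}(f(x)-y)^2+\lambda\|f\|_K^2\}$. $E$ denotes expectation over the random sample $D$. *)

theory Defs
  imports "HOL-Probability.Probability"
begin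

definition mercer_kernel :: "('a::topological_space \<Rightarrow> 'a \<Rightarrow> real) \<Rightarrow> bool" where
  "mercer_kernel K \<longleftrightarrow>
     continuous_on UNIV (\<lambda>z. K (fst z) (snd z)) \<and>
     (\<forall>x y. K x y = K y x) \<and>
     (\<forall>(n::nat) (xs::nat \<Rightarrow> 'a) (c::nat \<Rightarrow> real).
        0 \<le> (\<Sum>i<n. \<Sum>j<n. c i * c j * K (xs i) (xs j)))"

text \<open>RKHS of K (Aronszajn): f belongs to H_K iff for some C,
  (sum_i c_i f(x_i))^2 <= C * || sum_i c_i K_{x_i} ||_K^2 for all finite data;
  the squared RKHS norm is the least such C.\<close>

definition rkhs_bound :: "('a \<Rightarrow> 'a \<Rightarrow> real) \<Rightarrow> ('a \<Rightarrow> real) \<Rightarrow> real \<Rightarrow> bool" where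
  "rkhs_bound K f C \<longleftrightarrow>
     (\<forall>(n::nat) (xs::nat \<Rightarrow> 'a) (c::nat \<Rightarrow> real).
        (\<Sum>i<n. c i * f (xs i))\<^sup>2 \<le> C * (\<Sum>i<n. \<Sum>j<n. c i * c j * K (xs i) (xs j)))"

definition rkhs :: "('a \<Rightarrow> 'a \<Rightarrow> real) \<Rightarrow> ('a \<Rightarrow> real) set" where
  "rkhs K = {f. \<exists>C. rkhs_bound K f C}"

definition rkhs_norm :: "('a \<Rightarrow> 'a \<Rightarrow> real) \<Rightarrow> ('a \<Rightarrow> real) \<Rightarrow> real" where
  "rkhs_norm K f = sqrt (Inf {C. 0 \<le> C \<and> rkhs_bound K f C})"

definition rkhs_inner :: "('a \<Rightarrow> 'a \<Rightarrow> real) \<Rightarrow> ('a \<Rightarrow> real) \<Rightarrow> ('a \<Rightarrow> real) \<Rightarrow> real" where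
  "rkhs_inner K f g =
     ((rkhs_norm K (\<lambda>x. f x + g x))\<^sup>2 - (rkhs_norm K (\<lambda>x. f x - g x))\<^sup>2) / 4"

definition rkhs_onb :: "('a \<Rightarrow> 'a \<Rightarrow> real) \<Rightarrow> ('a \<Rightarrow> real) set \<Rightarrow> bool" where
  "rkhs_onb K B \<longleftrightarrow>
     B \<subseteq> rkhs K \<and>
     (\<forall>e\<in>B. \<forall>e'\<in>B. rkhs_inner K e e' = (if e = e' then 1 else 0)) \<and>
     (\<forall>f\<in>rkhs K. \<forall>\<epsilon>>0. \<exists>F c. finite F \<and> F \<subseteq> B \<and>
        rkhs_norm K (\<lambda>x. f x - (\<Sum>e\<in>F. c e * e x)) < \<epsilon>)"

definition rkhs_trace :: "('a \<Rightarrow> 'a \<Rightarrow> real) \<Rightarrow> (('a \<Rightarrow> real) \<Rightarrow> ('a \<Rightarrow> real)) \<Rightarrow> real" where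
  "rkhs_trace K A = (\<Sum>\<^sub>\<infinity>e\<in>(SOME B. rkhs_onb K B). rkhs_inner K (A e) e)"

definition int_op :: "'a measure \<Rightarrow> ('a \<Rightarrow> 'a \<Rightarrow> real) \<Rightarrow> ('a \<Rightarrow> real) \<Rightarrow> ('a \<Rightarrow> real)" where
  "int_op \<rho>X K f = (\<lambda>t. \<integral>x. K t x * f x \<partial>\<rho>X)"

text \<open>(L_K + lambda I)^{-1} L_K as an operator on H_K.\<close>
definition reg_op :: "'a measure \<Rightarrow> ('a \<Rightarrow> 'a \<Rightarrow> real) \<Rightarrow> real \<Rightarrow> ('a \<Rightarrow> real) \<Rightarrow> ('a \<Rightarrow> real)" where
  "reg_op \<rho>X K lam g =
     (THE h. h \<in> rkhs K \<and> (\<forall>t. int_op \<rho>X K h t + lam * h t = int_op \<rho>X K g t))"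

definition eff_dim :: "'a measure \<Rightarrow> ('a \<Rightarrow> 'a \<Rightarrow> real) \<Rightarrow> real \<Rightarrow> real" where
  "eff_dim \<rho>X K lam = rkhs_trace K (reg_op \<rho>X K lam)"

definition f_lambda :: "('a \<times> real) measure \<Rightarrow> ('a \<Rightarrow> 'a \<Rightarrow> real) \<Rightarrow> real \<Rightarrow> ('a \<Rightarrow> real)" where
  "f_lambda \<rho> K lam =
     (SOME f. f \<in> rkhs K \<and>
        (\<forall>g\<in>rkhs K.
           (\<integral>z. (f (fst z) - snd z)\<^sup>2 \<partial>\<rho>) + lam * (rkhs_norm K f)\<^sup>2
           \<le> (\<integral>z. (g (fst z) - snd z)\<^sup>2 \<partial>\<rho>) + lam * (rkhs_norm K g)\<^sup>2))"

text \<open>Sample S given as (x_i, y_i) = S i for i < m (repetitions allowed).\<close>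
definition f_sample :: "('a \<Rightarrow> 'a \<Rightarrow> real) \<Rightarrow> real \<Rightarrow> nat \<Rightarrow> (nat \<Rightarrow> 'a \<times> real) \<Rightarrow> ('a \<Rightarrow> real)" where
  "f_sample K lam m S =
     (SOME f. f \<in> rkhs K \<and>
        (\<forall>g\<in>rkhs K.
           (\<Sum>i<m. (f (fst (S i)) - snd (S i))\<^sup>2) / real m + lam * (rkhs_norm K f)\<^sup>2
           \<le> (\<Sum>i<m. (g (fst (S i)) - snd (S i))\<^sup>2) / real m + lam * (rkhs_norm K g)\<^sup>2))"

definition regr_fun :: "('a \<Rightarrow> real measure) \<Rightarrow> 'a \<Rightarrow> real" where
  "regr_fun cond x = (\<integral>y. y \<partial>cond x)"

definition cond_var :: "('a \<Rightarrow> real measure) \<Rightarrow> 'a \<Rightarrow> real" where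
  "cond_var cond x = (\<integral>y. (y - regr_fun cond x)\<^sup>2 \<partial>cond x)"

definition in_Lp :: "'a measure \<Rightarrow> ereal \<Rightarrow> ('a \<Rightarrow> real) \<Rightarrow> bool" where
  "in_Lp M p g \<longleftrightarrow> g \<in> borel_measurable M \<and>
     (if p = \<infinity> then esssup M (\<lambda>x. ereal \<bar>g x\<bar>) < \<infinity>
      else (\<integral>\<^sup>+x. ennreal (\<bar>g x\<bar> powr real_of_ereal p) \<partial>M) < \<infinity>)"

definition Lp_norm :: "'a measure \<Rightarrow> ereal \<Rightarrow> ('a \<Rightarrow> real) \<Rightarrow> real" where
  "Lp_norm M p g =
     (if p = \<infinity> then real_of_ereal (esssup M (\<lambda>x. ereal \<bar>g x\<bar>))
      else (enn2real (\<integral>\<^sup>+x. ennreal (\<bar>g x\<bar> powr real_of_ereal p) \<partial>M))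
             powr (1 / real_of_ereal p))"

end

theory Submission
  imports Defs "HOL-Library.Function_Algebras"
begin

text \<open>
  Write \<open>g = f_D - f_lam\<close>, \<open>L\<close> for the integral operator, \<open>L_D\<close> for its empirical version, and
  \<open>\<langle>f, g\<rangle>\<^sub>l = \<integral> f g + lam \<langle>f, g\<rangle>\<close> for the inner product belonging to \<open>L + lam\<close>. The normal equations
  give \<open>(L_D + lam) g = \<Delta>\<close> with \<open>\<Delta>\<close> an average of independent centred terms, so the square of
  \<open>a = \<parallel>g\<parallel>\<^sub>l\<close> is \<open>\<langle>\<Delta>, g\<rangle> + \<langle>(L - L_D) g, g\<rangle>\<close>. Let \<open>r x\<close> represent evaluation at \<open>x\<close> for
  \<open>\<langle>_, _\<rangle>\<^sub>l\<close>. By Schur's product theorem \<open>g\<^sup>2\<close> lies in the space of the kernel \<open>K r\<close> with norm at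
  most \<open>\<parallel>g\<parallel> \<parallel>g\<parallel>\<^sub>l\<close>, so the second term is at most \<open>Q \<parallel>g\<parallel> \<parallel>g\<parallel>\<^sub>l\<close>, where \<open>Q\<close> is the distance
  between the mean embeddings of the marginal and of the sample in that space. Since
  \<open>lam \<parallel>g\<parallel>\<^sup>2 \<le> \<langle>\<Delta>, g\<rangle>\<close>, this gives \<open>a \<le> (1 + q + q\<^sup>2) d\<close> for \<open>q = Q / sqrt lam\<close> and \<open>d\<close> the dual norm
  of \<open>\<Delta>\<close>. Cauchy-Schwarz, the fourth moment of \<open>Q\<close> and the second moment of \<open>d\<close> bound the
  expectation; the latter is \<open>\<integral> (\<sigma>\<^sup>2 + (f_\<rho> - f_lam)\<^sup>2) \<phi> / N\<close> with \<open>\<phi> x = r x x \<le> \<kappa>\<^sup>2 / lam\<close>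
  and \<open>\<integral> \<phi>\<close> at most the effective dimension, and Hoelder's inequality finishes the proof.
\<close>

section \<open>Inner products on a carrier set\<close>

text \<open>The statement allows every \<open>N\<close> and \<open>lam\<close>, so no smallness of
  the sampling error may be used. Because \<open>g\<close> depends on the sample, the form of
  \<open>L - L_D\<close> has to be controlled for all functions at once. On a fixed Hilbert space
  containing all the squares it is a linear functional, so scalar moments replace concentration of
  operators. The kernel \<open>r r\<close> would serve this purpose too, but it only leads to
  \<open>a \<le> d + Q' a\<close>, which is void once \<open>Q'\<close> reaches 1. With the mixed
  kernel \<open>K r\<close> the second term in the inequality for \<open>a\<^sup>2\<close> grows
  only like \<open>a\<close> to the power 3/2; the estimate can then be solved for \<open>a\<close>
  on every sample and no exceptional event is split off. The function spaces are sets and not types,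
  and their inner product is given only by polarization of a norm. Hilbert space theory is therefore
  developed on carrier sets, and inverses such as \<open>(L + lam)^{-1}\<close> appear only through
  Riesz representers, without spectral calculus.\<close>

instantiation "fun" :: (type, real_vector) real_vector
begin
definition scaleR_fun_def: "scaleR c f = (\<lambda>x. c *\<^sub>R f x)"
instance by standard (auto simp: scaleR_fun_def fun_eq_iff algebra_simps)
end

lemma scaleR_fun_apply [simp]: "(c *\<^sub>R f) x = c *\<^sub>R f x"
  by (simp add: scaleR_fun_def)

lemma sum_fun_apply: "(\<Sum>i\<in>A. f i) x = (\<Sum>i\<in>A. f i x)"
  by (induction A rule: infinite_finite_induct) auto

text \<open>The discriminant criterion, \<open>c = 0\<close> included. Besides Cauchy-Schwarz it
  yields variational equations: with \<open>a = 0\<close> it forces \<open>b = 0\<close>.\<close>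

lemma real_quadratic_nonneg:
  fixes a b c :: real
  assumes "\<And>t. 0 \<le> a + 2 * t * b + t\<^sup>2 * c" and "0 \<le> c"
  shows "b\<^sup>2 \<le> a * c"
proof (cases "c = 0")
  case True
  have "b = 0"
  proof (rule ccontr)
    assume b: "b \<noteq> 0"
    \<comment> \<open>This \<open>t\<close> makes the affine expression equal to -1.\<close>
    have "0 \<le> a + 2 * (-(a + 1) / (2 * b)) * b" using assms(1)[of "-(a + 1) / (2 * b)"] True by simp
    then show False using b by (simp add: field_simps)
  qed
  then show ?thesis using True by simp
next
  case False
  then have "c > 0" using assms by simp
  have "0 \<le> a + 2 * (-b / c) * b + (-b / c)\<^sup>2 * c" by (rule assms(1))
  also have "\<dots> = a - b\<^sup>2 / c" using False by (simp add: field_simps power2_eq_square)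
  finally show ?thesis using \<open>c > 0\<close> by (simp add: field_simps)
qed

text \<open>A carrier set instead of a type, because the same functions carry several inner products
  (\<open>rkhs_inner K\<close>, \<open>ipl\<close>, the empirical form). Only semidefiniteness is
  demanded, so that square-integrable functions fit without passing to classes modulo null
  sets.\<close>

locale ip_space =
  fixes V :: "'b::real_vector set" and ip :: "'b \<Rightarrow> 'b \<Rightarrow> real"
  assumes sub: "subspace V"
    and ip_sym: "x \<in> V \<Longrightarrow> y \<in> V \<Longrightarrow> ip x y = ip y x"
    and ip_add: "x \<in> V \<Longrightarrow> y \<in> V \<Longrightarrow> z \<in> V \<Longrightarrow> ip (x + y) z = ip x z + ip y z"
    and ip_scale: "x \<in> V \<Longrightarrow> y \<in> V \<Longrightarrow> ip (c *\<^sub>R x) y = c * ip x y"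
    and ip_nonneg: "x \<in> V \<Longrightarrow> 0 \<le> ip x x"
begin

lemma V_mem [simp, intro]:
  "0 \<in> V" "x \<in> V \<Longrightarrow> y \<in> V \<Longrightarrow> x + y \<in> V" "x \<in> V \<Longrightarrow> y \<in> V \<Longrightarrow> x - y \<in> V"
  "x \<in> V \<Longrightarrow> c *\<^sub>R x \<in> V" "x \<in> V \<Longrightarrow> - x \<in> V"
  using sub by (auto simp: subspace_0 subspace_add subspace_diff subspace_scale subspace_neg)

lemma V_sum: "(\<And>i. i \<in> A \<Longrightarrow> f i \<in> V) \<Longrightarrow> (\<Sum>i\<in>A. f i) \<in> V"
  using sub by (auto intro: subspace_sum)

lemma ip_add_right: "x \<in> V \<Longrightarrow> y \<in> V \<Longrightarrow> z \<in> V \<Longrightarrow> ip z (x + y) = ip z x + ip z y"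
  by (simp add: ip_sym[of z] ip_add)

lemma ip_scale_right: "x \<in> V \<Longrightarrow> y \<in> V \<Longrightarrow> ip y (c *\<^sub>R x) = c * ip y x"
  by (simp add: ip_sym[of y] ip_scale)

lemma ip_minus: "x \<in> V \<Longrightarrow> y \<in> V \<Longrightarrow> ip (- x) y = - ip x y"
  using ip_scale[of x y "-1"] by simp

lemma ip_diff: "x \<in> V \<Longrightarrow> y \<in> V \<Longrightarrow> z \<in> V \<Longrightarrow> ip (x - y) z = ip x z - ip y z"
  using ip_add[of x "-y" z] by (simp add: ip_minus)

lemma ip_diff_right: "x \<in> V \<Longrightarrow> y \<in> V \<Longrightarrow> z \<in> V \<Longrightarrow> ip z (x - y) = ip z x - ip z y"
  by (simp add: ip_sym[of z] ip_diff)

lemma ip_zero [simp]: "y \<in> V \<Longrightarrow> ip 0 y = 0" "y \<in> V \<Longrightarrow> ip y 0 = 0"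
  using ip_scale[of y y 0] ip_scale_right[of y y 0] by auto

lemma ip_sum: "(\<And>i. i \<in> A \<Longrightarrow> f i \<in> V) \<Longrightarrow> y \<in> V \<Longrightarrow> ip (\<Sum>i\<in>A. f i) y = (\<Sum>i\<in>A. ip (f i) y)"
  by (induction A rule: infinite_finite_induct) (auto simp: ip_add V_sum)

lemma ip_sum_right: "(\<And>i. i \<in> A \<Longrightarrow> f i \<in> V) \<Longrightarrow> y \<in> V \<Longrightarrow> ip y (\<Sum>i\<in>A. f i) = (\<Sum>i\<in>A. ip y (f i))"
  by (simp add: ip_sym[of y] V_sum ip_sum)

abbreviation nsq where "nsq x \<equiv> ip x x"

lemmas ip_simps = ip_add ip_add_right ip_diff ip_diff_right ip_scale ip_scale_right

lemma ip_square_add: "x \<in> V \<Longrightarrow> y \<in> V \<Longrightarrow> ip (x + y) (x + y) = ip x x + 2 * ip x y + ip y y"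
  by (simp add: ip_simps ip_sym[of y x])

lemma ip_square_diff: "x \<in> V \<Longrightarrow> y \<in> V \<Longrightarrow> ip (x - y) (x - y) = ip x x - 2 * ip x y + ip y y"
  by (simp add: ip_simps ip_sym[of y x])

lemma Cauchy_Schwarz: "x \<in> V \<Longrightarrow> y \<in> V \<Longrightarrow> (ip x y)\<^sup>2 \<le> ip x x * ip y y"
proof (rule real_quadratic_nonneg)
  fix t assume "x \<in> V" "y \<in> V"
  then have "0 \<le> ip (x + t *\<^sub>R y) (x + t *\<^sub>R y)" by (intro ip_nonneg) auto
  also have "\<dots> = ip x x + 2 * t * ip x y + t\<^sup>2 * ip y y"
    using \<open>x \<in> V\<close> \<open>y \<in> V\<close> by (simp add: ip_square_add ip_scale ip_scale_right power2_eq_square)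
  finally show "0 \<le> ip x x + 2 * t * ip x y + t\<^sup>2 * ip y y" .
qed (auto intro: ip_nonneg)

lemma abs_ip_le: "x \<in> V \<Longrightarrow> y \<in> V \<Longrightarrow> \<bar>ip x y\<bar> \<le> sqrt (ip x x) * sqrt (ip y y)"
  using Cauchy_Schwarz[of x y] by (metis real_sqrt_abs real_sqrt_le_iff real_sqrt_mult)

lemma ip_le: "x \<in> V \<Longrightarrow> y \<in> V \<Longrightarrow> ip x y \<le> sqrt (ip x x) * sqrt (ip y y)"
  using abs_ip_le[of x y] by simp

lemma ip_square_diff_le: "x \<in> V \<Longrightarrow> y \<in> V \<Longrightarrow> ip (x - y) (x - y) \<le> 2 * ip x x + 2 * ip y y"
  using ip_nonneg[of "x + y"] by (auto simp: ip_square_add ip_square_diff)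

end

locale hilb = ip_space +
  assumes complete: "(\<And>n. X n \<in> V) \<Longrightarrow>
    (\<And>e. e > 0 \<Longrightarrow> \<exists>M. \<forall>m\<ge>M. \<forall>n\<ge>M. ip (X m - X n) (X m - X n) < e) \<Longrightarrow>
    \<exists>x\<in>V. (\<lambda>n. ip (X n - x) (X n - x)) \<longlonglongrightarrow> 0"
begin

lemma tendsto_ip:
  assumes X: "\<And>n. X n \<in> V" and x: "x \<in> V" and v: "v \<in> V"
    and lim: "(\<lambda>n. nsq (X n - x)) \<longlonglongrightarrow> 0"
  shows "(\<lambda>n. ip (X n) v) \<longlonglongrightarrow> ip x v"
proof -
  have "(\<lambda>n. ip (X n - x) v) \<longlonglongrightarrow> 0"
  proof (rule Lim_null_comparison)
    show "\<forall>\<^sub>F n in sequentially. norm (ip (X n - x) v) \<le> sqrt (nsq (X n - x)) * sqrt (ip v v)"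
      using X x v by (auto intro!: always_eventually abs_ip_le)
    show "(\<lambda>n. sqrt (nsq (X n - x)) * sqrt (ip v v)) \<longlonglongrightarrow> 0"
      using tendsto_mult_right[OF tendsto_real_sqrt[OF lim], of "sqrt (ip v v)"] by simp
  qed
  then have "(\<lambda>n. ip (X n - x) v + ip x v) \<longlonglongrightarrow> 0 + ip x v" by (intro tendsto_intros)
  then show ?thesis using X x v by (simp add: ip_diff)
qed

text \<open>The representer is the limit of a minimizing sequence of \<^term>\<open>\<lambda>v. ip v v - 2 * l v\<close>.\<close>
lemma Riesz:
  assumes add: "\<And>x y. x \<in> V \<Longrightarrow> y \<in> V \<Longrightarrow> l (x + y) = l x + l y"
    and scale: "\<And>c x. x \<in> V \<Longrightarrow> l (c *\<^sub>R x) = c * l x"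
    and M: "0 \<le> M" and bdd: "\<And>x. x \<in> V \<Longrightarrow> (l x)\<^sup>2 \<le> M * ip x x"
  shows "\<exists>u\<in>V. \<forall>v\<in>V. ip u v = l v"
proof -
  define J where "J v = ip v v - 2 * l v" for v
  have lower: "- M \<le> J v" if v: "v \<in> V" for v
  proof -
    have n: "0 \<le> ip v v" using v by (rule ip_nonneg)
    have "(2 * l v)\<^sup>2 \<le> 4 * (M * ip v v)" using bdd[OF v] by (simp add: power2_eq_square)
    also have "\<dots> \<le> (M + ip v v)\<^sup>2"
      using zero_le_power2[of "M - ip v v"] by (simp add: power2_eq_square algebra_simps)
    finally have "\<bar>2 * l v\<bar> \<le> \<bar>M + ip v v\<bar>" by (simp only: abs_le_square_iff)
    then show ?thesis using n M by (simp add: J_def)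
  qed
  define j where "j = Inf (J ` V)"
  have bb: "bdd_below (J ` V)" using lower by (auto intro!: bdd_belowI)
  have j_le: "j \<le> J v" if "v \<in> V" for v
    unfolding j_def using bb that by (intro cInf_lower) auto
  have "\<exists>v. v \<in> V \<and> J v < j + 1 / real (Suc n)" for n
  proof -
    have "\<exists>y\<in>J ` V. y < j + 1 / real (Suc n)"
      unfolding j_def by (rule cInf_lessD) (use V_mem(1) in \<open>auto\<close>)
    then show ?thesis by auto
  qed
  then obtain X where X: "\<And>n. X n \<in> V" and XJ: "\<And>n. J (X n) < j + 1 / real (Suc n)"
    by metis
  \<comment> \<open>The linear part of \<open>J\<close> cancels in the parallelogram law, so
    near-minimality of both points and the lower bound \<open>j\<close> at their midpoint make the
    sequence Cauchy.\<close>
  have par: "nsq (x - y) = 2 * J x + 2 * J y - 4 * J ((1/2) *\<^sub>R (x + y))" if "x \<in> V" "y \<in> V" for x y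
  proof -
    have "J ((1/2) *\<^sub>R (x + y)) = (ip x x + 2 * ip x y + ip y y) / 4 - (l x + l y)"
      using that by (simp add: J_def ip_scale ip_scale_right ip_square_add add scale field_simps)
    then show ?thesis using that by (simp add: J_def ip_square_diff diff_divide_distrib add_divide_distrib)
  qed
  have close: "nsq (X m - X n) \<le> 2 / real (Suc m) + 2 / real (Suc n)" for m n
  proof -
    have "j \<le> J ((1/2) *\<^sub>R (X m + X n))" using X by (intro j_le) auto
    then show ?thesis using par[OF X X, of m n] XJ[of m] XJ[of n] by simp
  qed
  have "\<exists>u\<in>V. (\<lambda>n. nsq (X n - u)) \<longlonglongrightarrow> 0"
  proof (rule complete[OF X])
    fix e :: real assume "e > 0"
    then obtain N where N: "N > 0" "1 / real N < e / 4"
      by (metis divide_pos_pos nat_approx_posE zero_less_Suc zero_less_numeral)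
    show "\<exists>M. \<forall>m\<ge>M. \<forall>n\<ge>M. nsq (X m - X n) < e"
    proof (intro exI allI impI)
      fix m n assume "N \<le> m" "N \<le> n"
      then have "1 / real (Suc m) \<le> 1 / real N" "1 / real (Suc n) \<le> 1 / real N"
        using N by (auto intro!: divide_left_mono)
      then show "nsq (X m - X n) < e" using close[of m n] N by simp
    qed
  qed
  then obtain u where u: "u \<in> V" and lim: "(\<lambda>n. nsq (X n - u)) \<longlonglongrightarrow> 0" by blast
  have "ip u v = l v" if v: "v \<in> V" for v
  proof -
    have "(ip u v - l v)\<^sup>2 \<le> 0 * ip v v"
    proof (rule real_quadratic_nonneg)
      fix t :: real
      \<comment> \<open>Moving \<open>X n\<close> along \<open>v\<close> can gain at most its defect
        \<open>1 / real (Suc n)\<close>; in the limit the quadratic in \<open>t\<close> has no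
        constant term.\<close>
      have "- (1 / real (Suc n)) \<le> t\<^sup>2 * ip v v + 2 * t * (ip (X n) v - l v)" for n
      proof -
        have "j \<le> J (X n + t *\<^sub>R v)" using X v by (intro j_le) auto
        also have "\<dots> = J (X n) + t\<^sup>2 * ip v v + 2 * t * (ip (X n) v - l v)"
          using X v by (simp add: J_def ip_square_add ip_scale ip_scale_right add scale
              power2_eq_square algebra_simps)
        finally show ?thesis using XJ[of n] by simp
      qed
      moreover have "(\<lambda>n. t\<^sup>2 * ip v v + 2 * t * (ip (X n) v - l v)) \<longlonglongrightarrow> t\<^sup>2 * ip v v + 2 * t * (ip u v - l v)"
        by (intro tendsto_intros tendsto_ip X u v lim)
      moreover have "(\<lambda>n. - (1 / real (Suc n))) \<longlonglongrightarrow> - 0"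
        by (intro tendsto_minus LIMSEQ_Suc[OF lim_1_over_n])
      ultimately have "- 0 \<le> t\<^sup>2 * ip v v + 2 * t * (ip u v - l v)"
        by (intro LIMSEQ_le[of "\<lambda>n. - (1 / real (Suc n))"]) auto
      then show "0 \<le> 0 + 2 * t * (ip u v - l v) + t\<^sup>2 * ip v v" by simp
    qed (use v in \<open>simp add: ip_nonneg\<close>)
    then show ?thesis by simp
  qed
  then show ?thesis using u by blast
qed

text \<open>The new norm is equivalent to the old one, with constants \<open>lam\<close> and
  \<open>M + lam\<close>, so completeness transfers. Applied to the population form and, for each
  fixed sample, to the empirical form.\<close>

lemma hilb_perturb:
  assumes b_add: "\<And>x y z. x \<in> V \<Longrightarrow> y \<in> V \<Longrightarrow> z \<in> V \<Longrightarrow> b (x + y) z = b x z + b y z"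
    and b_scale: "\<And>c x y. x \<in> V \<Longrightarrow> y \<in> V \<Longrightarrow> b (c *\<^sub>R x) y = c * b x y"
    and b_sym: "\<And>x y. x \<in> V \<Longrightarrow> y \<in> V \<Longrightarrow> b x y = b y x"
    and b_nonneg: "\<And>x. x \<in> V \<Longrightarrow> 0 \<le> b x x"
    and b_le: "\<And>x. x \<in> V \<Longrightarrow> b x x \<le> M * ip x x"
    and lam: "0 < lam"
  shows "hilb V (\<lambda>x y. b x y + lam * ip x y)"
proof
  show "subspace V" by (rule sub)
  show "b (x + y) z + lam * ip (x + y) z = b x z + lam * ip x z + (b y z + lam * ip y z)"
    if "x \<in> V" "y \<in> V" "z \<in> V" for x y z using that by (simp add: b_add ip_add algebra_simps)
  show "b (c *\<^sub>R x) y + lam * ip (c *\<^sub>R x) y = c * (b x y + lam * ip x y)"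
    if "x \<in> V" "y \<in> V" for x y c using that by (simp add: b_scale ip_scale algebra_simps)
  show "b x y + lam * ip x y = b y x + lam * ip y x"
    if "x \<in> V" "y \<in> V" for x y using that b_sym ip_sym by simp
  show "0 \<le> b x x + lam * ip x x" if "x \<in> V" for x
    using that b_nonneg ip_nonneg lam by simp
  fix X :: "nat \<Rightarrow> _"
  assume X: "\<And>n. X n \<in> V"
    and C: "\<And>e. 0 < e \<Longrightarrow> \<exists>M. \<forall>m\<ge>M. \<forall>n\<ge>M.
      b (X m - X n) (X m - X n) + lam * nsq (X m - X n) < e"
  have "\<exists>x\<in>V. (\<lambda>n. nsq (X n - x)) \<longlonglongrightarrow> 0"
  proof (rule complete[OF X])
    fix e :: real assume "e > 0"
    then obtain M where M: "\<And>m n. m \<ge> M \<Longrightarrow> n \<ge> M \<Longrightarrow>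
      b (X m - X n) (X m - X n) + lam * nsq (X m - X n) < lam * e"
      using C[of "lam * e"] lam by auto
    show "\<exists>M. \<forall>m\<ge>M. \<forall>n\<ge>M. nsq (X m - X n) < e"
    proof (intro exI allI impI)
      fix m n assume "m \<ge> M" "n \<ge> M"
      then have "lam * nsq (X m - X n) < lam * e"
        using M[of m n] b_nonneg[of "X m - X n"] X by auto
      then show "nsq (X m - X n) < e" using lam by simp
    qed
  qed
  then obtain x where x: "x \<in> V" and lim: "(\<lambda>n. nsq (X n - x)) \<longlonglongrightarrow> 0" by blast
  have "(\<lambda>n. b (X n - x) (X n - x) + lam * nsq (X n - x)) \<longlonglongrightarrow> 0"
  proof (rule real_tendsto_sandwich[OF _ _ tendsto_const])
    show "\<forall>\<^sub>F n in sequentially. 0 \<le> b (X n - x) (X n - x) + lam * nsq (X n - x)"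
      using X x lam b_nonneg ip_nonneg by (intro always_eventually allI) simp
    show "\<forall>\<^sub>F n in sequentially. b (X n - x) (X n - x) + lam * nsq (X n - x)
        \<le> (M + lam) * nsq (X n - x)"
      using X x b_le by (intro always_eventually allI) (simp add: algebra_simps)
    show "(\<lambda>n. (M + lam) * nsq (X n - x)) \<longlonglongrightarrow> 0"
      using tendsto_mult_left[OF lim, of "M + lam"] by simp
  qed
  then show "\<exists>x\<in>V. (\<lambda>n. b (X n - x) (X n - x) + lam * nsq (X n - x)) \<longlonglongrightarrow> 0"
    using x by blast
qed

end

section \<open>Reproducing kernel Hilbert spaces\<close>

text \<open>Zero at 1 gives zero at all integers, so the function has period 1 and is bounded on the
  whole line. A nonzero value is then impossible, because its multiples are values too.\<close>

lemma additive_bounded_imp_zero: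
  fixes \<phi> :: "real \<Rightarrow> real"
  assumes add: "\<And>s t. \<phi> (s + t) = \<phi> s + \<phi> t" and one: "\<phi> 1 = 0"
    and bdd: "\<And>t. 0 \<le> t \<Longrightarrow> t \<le> 1 \<Longrightarrow> \<bar>\<phi> t\<bar> \<le> C"
  shows "\<phi> t = 0"
proof -
  have zero: "\<phi> 0 = 0" using add[of 0 0] by simp
  have minus: "\<phi> (- s) = - \<phi> s" for s using add[of s "- s"] zero by simp
  have nat_mult: "\<phi> (real m * s) = real m * \<phi> s" for m s
    by (induction m) (auto simp: zero add algebra_simps)
  have int_zero: "\<phi> (of_int j) = 0" for j
  proof (cases j)
    case (nonneg n) then show ?thesis using nat_mult[of n 1] one by simp
  next
    case (neg n) then show ?thesis using nat_mult[of "Suc n" 1] one minus[of "real (Suc n)"] by simp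
  qed
  have all_bdd: "\<bar>\<phi> s\<bar> \<le> C" for s
  proof -
    have "\<phi> s = \<phi> (of_int \<lfloor>s\<rfloor> + frac s)" by (simp add: frac_def)
    also have "\<dots> = \<phi> (frac s)" by (simp only: add int_zero)
    finally show ?thesis using bdd[of "frac s"] frac_ge_0[of s] frac_lt_1[of s] by simp
  qed
  show ?thesis
  proof (rule ccontr)
    assume "\<phi> t \<noteq> 0"
    then obtain m :: nat where "C < real m * \<bar>\<phi> t\<bar>"
      using reals_Archimedean3[of "\<bar>\<phi> t\<bar>"] by auto
    then show False using all_bdd[of "real m * t"] by (simp add: nat_mult abs_mult)
  qed
qed

text \<open>Called for because \<open>rkhs_inner\<close> is defined by polarization. Homogeneity
  comes from boundedness on the unit interval rather than from rational scalars and
  continuity.\<close>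

lemma Jordan_von_Neumann:
  fixes V :: "'b::real_vector set" and n :: "'b \<Rightarrow> real"
  assumes sub: "subspace V"
    and nonneg: "\<And>x. x \<in> V \<Longrightarrow> 0 \<le> n x"
    and scale: "\<And>c x. x \<in> V \<Longrightarrow> n (c *\<^sub>R x) = c\<^sup>2 * n x"
    and par: "\<And>x y. x \<in> V \<Longrightarrow> y \<in> V \<Longrightarrow> n (x + y) + n (x - y) = 2 * n x + 2 * n y"
  shows "ip_space V (\<lambda>x y. (n (x + y) - n (x - y)) / 4)"
proof -
  define ip where "ip x y = (n (x + y) - n (x - y)) / 4" for x y
  have mem: "x + y \<in> V" "x - y \<in> V" "c *\<^sub>R x \<in> V" "- x \<in> V" if "x \<in> V" "y \<in> V" for x y c
    using that sub by (auto simp: subspace_add subspace_diff subspace_scale subspace_neg)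
  have neg: "n (- x) = n x" if "x \<in> V" for x using scale[OF that, of "-1"] by simp
  have sym: "ip x y = ip y x" if "x \<in> V" "y \<in> V" for x y
    using neg[of "x - y"] that mem by (simp add: ip_def add.commute)
  have add: "ip (x + y) z = ip x z + ip y z" if V: "x \<in> V" "y \<in> V" "z \<in> V" for x y z
  proof -
    \<comment> \<open>The average of two instances of the parallelogram law. In the difference of
      the cases \<open>z\<close> and \<open>- z\<close> the last bracket cancels, because
      \<open>n\<close> is even.\<close>
    have *: "n (x + y + w) = n (x + w) + n (y + w) + n x + n y - (n (x - y + w) + n (y - x + w)) / 2"
      if w: "w \<in> V" for w
    proof -
      have "n ((x + w) + y) + n ((x + w) - y) = 2 * n (x + w) + 2 * n y" using V w mem by (intro par) auto
      moreover have "n ((y + w) + x) + n ((y + w) - x) = 2 * n (y + w) + 2 * n x" using V w mem by (intro par) auto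
      moreover have "(x + w) + y = x + y + w" "(y + w) + x = x + y + w" "(x + w) - y = x - y + w" "(y + w) - x = y - x + w"
        by auto
      ultimately show ?thesis by (simp add: field_simps)
    qed
    have "n (x - y - z) = n (y - x + z)" "n (y - x - z) = n (x - y + z)"
      using neg[of "y - x + z"] neg[of "x - y + z"] V mem by (auto simp: algebra_simps)
    then show ?thesis using *[OF V(3)] *[of "- z"] V mem by (simp add: ip_def field_simps)
  qed
  have bound: "\<bar>ip x y\<bar> \<le> (n x + n y) / 2" if "x \<in> V" "y \<in> V" for x y
    using par[OF that] nonneg[of "x + y"] nonneg[of "x - y"] that mem by (simp add: ip_def abs_le_iff)
  have scl: "ip (c *\<^sub>R x) y = c * ip x y" if V: "x \<in> V" "y \<in> V" for x y c
  proof -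
    have "ip (c *\<^sub>R x) y - c * ip x y = 0"
    proof (rule additive_bounded_imp_zero[where \<phi> = "\<lambda>c. ip (c *\<^sub>R x) y - c * ip x y" and t = c
          and C = "(n x + n y) / 2 + \<bar>ip x y\<bar>"])
      fix s t :: real
      show "ip ((s + t) *\<^sub>R x) y - (s + t) * ip x y = ip (s *\<^sub>R x) y - s * ip x y + (ip (t *\<^sub>R x) y - t * ip x y)"
        using V mem by (simp add: scaleR_left_distrib add algebra_simps)
    next
      fix t :: real assume t: "0 \<le> t" "t \<le> 1"
      have "\<bar>ip (t *\<^sub>R x) y\<bar> \<le> (t\<^sup>2 * n x + n y) / 2"
        using bound[of "t *\<^sub>R x" y] V mem scale by simp
      also have "\<dots> \<le> (n x + n y) / 2" using t nonneg[OF V(1)] by (simp add: mult_left_le_one_le power_le_one)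
      finally have "\<bar>ip (t *\<^sub>R x) y\<bar> \<le> (n x + n y) / 2" .
      moreover have "\<bar>t * ip x y\<bar> \<le> \<bar>ip x y\<bar>" using t by (simp add: abs_mult mult_left_le_one_le)
      ultimately show "\<bar>ip (t *\<^sub>R x) y - t * ip x y\<bar> \<le> (n x + n y) / 2 + \<bar>ip x y\<bar>" by linarith
    qed simp
    then show ?thesis by simp
  qed
  have "n (x + x) = 4 * n x" if "x \<in> V" for x using scale[OF that, of 2] by (simp add: scaleR_2)
  moreover have "n 0 = 0" using scale[of 0 0] sub by (simp add: subspace_0)
  ultimately have "ip x x = n x" if "x \<in> V" for x using that by (simp add: ip_def)
  then have "ip_space V ip"
    using sub sym add scl nonneg by unfold_locales auto
  then show ?thesis by (simp add: ip_def [abs_def])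
qed

section \<open>Finite combinations of point evaluations, encoded as lists\<close>

definition pair_list :: "('a \<Rightarrow> real) \<Rightarrow> (real \<times> 'a) list \<Rightarrow> real" where
  "pair_list f l = (\<Sum>(a, x)\<leftarrow>l. a * f x)"

text \<open>With lists as formal combinations, concatenation is addition and
  \<open>scale_list\<close> is scalar multiplication, so no sums over index ranges have to be
  merged; \<open>gram\<close> is the form that the kernel induces on them.\<close>

definition gram :: "('a \<Rightarrow> 'a \<Rightarrow> real) \<Rightarrow> (real \<times> 'a) list \<Rightarrow> (real \<times> 'a) list \<Rightarrow> real" where
  "gram k l l' = pair_list (\<lambda>x. pair_list (k x) l') l"

definition scale_list :: "real \<Rightarrow> (real \<times> 'a) list \<Rightarrow> (real \<times> 'a) list" where
  "scale_list t l = map (\<lambda>(a, x). (t * a, x)) l"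

lemma pair_list_simps [simp]:
  "pair_list f [] = 0" "pair_list f ((a, x) # l) = a * f x + pair_list f l"
  "pair_list f (l @ l') = pair_list f l + pair_list f l'"
  by (auto simp: pair_list_def)

lemma pair_list_scale [simp]: "pair_list f (scale_list t l) = t * pair_list f l"
  by (induction l) (auto simp: scale_list_def algebra_simps)

lemma pair_list_fun [simp]:
  "pair_list (f + g) l = pair_list f l + pair_list g l"
  "pair_list (\<lambda>x. f x + g x) l = pair_list f l + pair_list g l"
  "pair_list (f - g) l = pair_list f l - pair_list g l"
  "pair_list (c *\<^sub>R f) l = c * pair_list f l"
  "pair_list (\<lambda>x. c * f x) l = c * pair_list f l"
  "pair_list (\<lambda>x. 0) l = 0"
  "pair_list (0) l = 0"
  by (induction l; force simp: algebra_simps)+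

lemma gram_simps [simp]:
  "gram k [] l = 0" "gram k l [] = 0"
  "gram k (l @ m) l' = gram k l l' + gram k m l'"
  "gram k l' (l @ m) = gram k l' l + gram k l' m"
  "gram k (scale_list t l) l' = t * gram k l l'"
  "gram k l' (scale_list t l) = t * gram k l' l"
  by (auto simp: gram_def)

lemma pair_list_map: "pair_list f (map (\<lambda>i. (c i, xs i)) [0..<n]) = (\<Sum>i<n. c i * f (xs i))"
  by (simp add: pair_list_def interv_sum_list_conv_sum_set_nat comp_def atLeast0LessThan)

lemma gram_map: "gram k (map (\<lambda>i. (c i, xs i)) [0..<n]) (map (\<lambda>i. (c i, xs i)) [0..<n]) =
    (\<Sum>i<n. \<Sum>j<n. c i * c j * k (xs i) (xs j))"
  by (simp add: gram_def pair_list_map sum_distrib_left algebra_simps)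

lemma ex_list_map: "\<exists>n c xs. l = map (\<lambda>i. (c i, xs i)) [0..<n]"
  by (rule exI[of _ "length l"], rule exI[of _ "\<lambda>i. fst (l ! i)"], rule exI[of _ "\<lambda>i. snd (l ! i)"])
     (simp add: map_nth)

lemma rkhs_bound_list:
  fixes f :: "'a \<Rightarrow> real"
  shows "rkhs_bound k f C \<longleftrightarrow> (\<forall>l. (pair_list f l)\<^sup>2 \<le> C * gram k l l)"
  unfolding rkhs_bound_def
proof safe
  fix l :: "(real \<times> 'a) list"
  assume *: "\<forall>(n::nat) xs c. (\<Sum>i<n. c i * f (xs i))\<^sup>2 \<le> C * (\<Sum>i<n. \<Sum>j<n. c i * c j * k (xs i) (xs j))"
  obtain n c xs where l: "l = map (\<lambda>i. (c i, xs i)) [0..<n]" using ex_list_map by blast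
  show "(pair_list f l)\<^sup>2 \<le> C * gram k l l" using * unfolding l pair_list_map gram_map by blast
next
  fix n :: nat and xs c
  assume "\<forall>l. (pair_list f l)\<^sup>2 \<le> C * gram k l l"
  then show "(\<Sum>i<n. c i * f (xs i))\<^sup>2 \<le> C * (\<Sum>i<n. \<Sum>j<n. c i * c j * k (xs i) (xs j))"
    unfolding pair_list_map[symmetric] gram_map[symmetric] by blast
qed

text \<open>Free of topology, since it is instantiated with three kernels: \<open>K\<close>, the
  kernel \<open>r\<close> of the regularized inner product, and their product
  \<open>h\<close>.\<close>

locale psd_kernel =
  fixes k :: "'a \<Rightarrow> 'a \<Rightarrow> real"
  assumes k_sym: "k x y = k y x"
    and gram_nonneg: "0 \<le> gram k l l"
begin

lemma gram_sym: "gram k l l' = gram k l' l"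
proof (induction l)
  case (Cons p l)
  obtain a x where p: "p = (a, x)" by (cases p)
  have "gram k l' (p # l) = a * pair_list (k x) l' + gram k l' l"
  proof -
    have "pair_list (\<lambda>y. k y x) l' = pair_list (k x) l'"
      by (rule arg_cong[of _ _ "\<lambda>h. pair_list h l'"]) (use k_sym in blast)
    then show ?thesis by (simp add: gram_def p)
  qed
  moreover have "gram k (p # l) l' = a * pair_list (k x) l' + gram k l l'"
    by (simp add: p gram_def)
  ultimately show ?case using Cons by simp
qed simp

lemma gram_Cons: "gram k ((a, x) # l) ((a, x) # l) = a\<^sup>2 * k x x + 2 * a * pair_list (k x) l + gram k l l"
proof -
  have "gram k ((a, x) # l) ((a, x) # l) = gram k ([(a, x)] @ l) ([(a, x)] @ l)" by simp
  also have "\<dots> = gram k [(a, x)] [(a, x)] + 2 * gram k [(a, x)] l + gram k l l"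
    by (simp only: gram_simps gram_sym[of l "[(a, x)]"])
  also have "\<dots> = a\<^sup>2 * k x x + 2 * a * pair_list (k x) l + gram k l l"
    by (simp add: gram_def power2_eq_square)
  finally show ?thesis .
qed

lemma k_diag_nonneg: "0 \<le> k x x"
  using gram_nonneg[of "[(1, x)]"] by (simp add: gram_def)

text \<open>The inequality \<open>(pair_list f l)\<^sup>2 \<le> C * gram k l l\<close> for all multiples of \<open>l\<close>, written without
  a square, so that the squared norm becomes a supremum of affine functions of \<open>f\<close>.\<close>
definition dominated :: "('a \<Rightarrow> real) \<Rightarrow> real \<Rightarrow> bool" where
  "dominated f C \<longleftrightarrow> (\<forall>l. 2 * pair_list f l \<le> C + gram k l l)"

lemma dominated_nonneg: "dominated f C \<Longrightarrow> 0 \<le> C"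
  unfolding dominated_def by (drule spec[of _ "[]"]) simp

lemma dominated_iff: "dominated f C \<longleftrightarrow> 0 \<le> C \<and> rkhs_bound k f C"
proof safe
  assume d: "dominated f C"
  then show "0 \<le> C" by (rule dominated_nonneg)
  show "rkhs_bound k f C" unfolding rkhs_bound_list
  proof (intro allI real_quadratic_nonneg gram_nonneg)
    fix l t
    have "2 * pair_list f (scale_list (- t) l) \<le> C + gram k (scale_list (- t) l) (scale_list (- t) l)"
      using d unfolding dominated_def by blast
    then show "0 \<le> C + 2 * t * pair_list f l + t\<^sup>2 * gram k l l" by (simp add: power2_eq_square)
  qed
next
  assume C: "0 \<le> C" and b: "rkhs_bound k f C"
  show "dominated f C" unfolding dominated_def
  proof
    fix l
    have "(2 * pair_list f l)\<^sup>2 \<le> 4 * (C * gram k l l)" using b by (simp add: rkhs_bound_list power2_eq_square)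
    also have "\<dots> \<le> (C + gram k l l)\<^sup>2"
      using zero_le_power2[of "C - gram k l l"] by (simp add: power2_eq_square algebra_simps)
    finally have "\<bar>2 * pair_list f l\<bar> \<le> \<bar>C + gram k l l\<bar>" by (simp only: abs_le_square_iff)
    then show "2 * pair_list f l \<le> C + gram k l l" using C gram_nonneg[of l] by simp
  qed
qed

definition sqn :: "('a \<Rightarrow> real) \<Rightarrow> real" where "sqn f = Inf {C. dominated f C}"

lemma rkhs_iff: "f \<in> rkhs k \<longleftrightarrow> (\<exists>C. dominated f C)"
proof
  assume "f \<in> rkhs k"
  then obtain C where "rkhs_bound k f C" by (auto simp: rkhs_def)
  then have "rkhs_bound k f (max 0 C)" unfolding rkhs_bound_list
    using gram_nonneg by (meson max.cobounded2 mult_right_mono order_trans)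
  then show "\<exists>C. dominated f C" by (intro exI[of _ "max 0 C"]) (simp add: dominated_iff)
qed (auto simp: dominated_iff rkhs_def)

lemma bdd_dominated: "bdd_below {C. dominated f C}"
  using dominated_nonneg by (auto intro!: bdd_belowI[of _ 0])

lemma sqn_le: "dominated f C \<Longrightarrow> sqn f \<le> C"
  unfolding sqn_def using bdd_dominated by (auto intro: cInf_lower)

lemma dominated_sqn: "f \<in> rkhs k \<Longrightarrow> dominated f (sqn f)"
  unfolding dominated_def
proof
  fix l assume "f \<in> rkhs k"
  then have "{C. dominated f C} \<noteq> {}" by (auto simp: rkhs_iff)
  then have "2 * pair_list f l - gram k l l \<le> Inf {C. dominated f C}"
    by (intro cInf_greatest) (auto simp: dominated_def algebra_simps)
  then show "2 * pair_list f l \<le> sqn f + gram k l l" by (simp add: sqn_def)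
qed

lemma sqn_nonneg: "f \<in> rkhs k \<Longrightarrow> 0 \<le> sqn f"
  using dominated_sqn dominated_nonneg by blast

lemma rkhs_norm_square: "f \<in> rkhs k \<Longrightarrow> (rkhs_norm k f)\<^sup>2 = sqn f"
  using sqn_nonneg by (simp add: rkhs_norm_def sqn_def dominated_iff)

lemma rkhs_bound_sqn: "f \<in> rkhs k \<Longrightarrow> rkhs_bound k f (sqn f)"
  using dominated_sqn by (simp add: dominated_iff)

lemma dominated_scale: "dominated f C \<Longrightarrow> dominated (t *\<^sub>R f) (t\<^sup>2 * C)"
  by (auto simp: dominated_iff rkhs_bound_list power_mult_distrib mult.assoc intro: mult_left_mono)

text \<open>The inequality at half the list, doubled: the constant grows and the Gram term shrinks
  by the same factor, so that the inequalities of two functions can be added.\<close>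

lemma dominated_half: "dominated f C \<Longrightarrow> 2 * pair_list f l \<le> 2 * C + gram k l l / 2"
  unfolding dominated_def by (drule spec[of _ "scale_list (1/2) l"]) simp

lemma subspace_rkhs: "subspace (rkhs k)"
  unfolding subspace_def
proof safe
  show "0 \<in> rkhs k" using gram_nonneg by (auto simp: rkhs_iff dominated_def intro: exI[of _ 0])
next
  fix f g assume "f \<in> rkhs k" "g \<in> rkhs k"
  then have f: "dominated f (sqn f)" and g: "dominated g (sqn g)" by (auto intro: dominated_sqn)
  have "dominated (f + g) (2 * sqn f + 2 * sqn g)" unfolding dominated_def
  proof
    fix l
    show "2 * pair_list (f + g) l \<le> 2 * sqn f + 2 * sqn g + gram k l l"
      using dominated_half[OF f, of l] dominated_half[OF g, of l] by simp
  qed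
  then show "f + g \<in> rkhs k" by (auto simp: rkhs_iff)
next
  fix c f assume "f \<in> rkhs k"
  then show "c *\<^sub>R f \<in> rkhs k" using dominated_scale by (auto simp: rkhs_iff)
qed

lemma rkhs_add: "f \<in> rkhs k \<Longrightarrow> g \<in> rkhs k \<Longrightarrow> f + g \<in> rkhs k"
  and rkhs_diff: "f \<in> rkhs k \<Longrightarrow> g \<in> rkhs k \<Longrightarrow> f - g \<in> rkhs k"
  and rkhs_scale: "f \<in> rkhs k \<Longrightarrow> c *\<^sub>R f \<in> rkhs k"
  using subspace_rkhs by (auto simp: subspace_add subspace_diff subspace_scale)

lemma sqn_scale: "f \<in> rkhs k \<Longrightarrow> sqn (c *\<^sub>R f) = c\<^sup>2 * sqn f"
proof -
  have le: "sqn (c *\<^sub>R f) \<le> c\<^sup>2 * sqn f" if "f \<in> rkhs k" for c f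
    using that by (intro sqn_le dominated_scale dominated_sqn)
  assume f: "f \<in> rkhs k"
  show ?thesis
  proof (cases "c = 0")
    case True
    have "0 \<le> sqn (c *\<^sub>R f)" using f by (intro sqn_nonneg rkhs_scale)
    then show ?thesis using le[OF f, of c] True by simp
  next
    case False
    \<comment> \<open>The reverse inequality is the same bound for the inverse scalar.\<close>
    have "sqn f = sqn ((1 / c) *\<^sub>R (c *\<^sub>R f))" using False by simp
    also have "\<dots> \<le> (1 / c)\<^sup>2 * sqn (c *\<^sub>R f)" using f by (intro le rkhs_scale)
    finally have "c\<^sup>2 * sqn f \<le> sqn (c *\<^sub>R f)" using False by (simp add: field_simps)
    then show ?thesis using le[OF f, of c] by simp
  qed
qed

text \<open>Test \<open>f\<close> with \<open>l\<close> plus \<open>l'\<close> and \<open>g\<close>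
  with \<open>l\<close> minus \<open>l'\<close>: the cross terms of the two Gram forms cancel, and
  afterwards \<open>l\<close> and \<open>l'\<close> can be optimized separately.\<close>

lemma sqn_parallelogram_le:
  assumes f: "f \<in> rkhs k" and g: "g \<in> rkhs k"
  shows "sqn (f + g) + sqn (f - g) \<le> 2 * sqn f + 2 * sqn g"
proof -
  have *: "2 * pair_list (f + g) l - gram k l l + (2 * pair_list (f - g) l' - gram k l' l')
      \<le> 2 * sqn f + 2 * sqn g" for l l'
  proof -
    have "2 * pair_list f (l @ l') \<le> 2 * sqn f + gram k (l @ l') (l @ l') / 2"
      "2 * pair_list g (l @ scale_list (-1) l') \<le>
         2 * sqn g + gram k (l @ scale_list (-1) l') (l @ scale_list (-1) l') / 2"
      by (rule dominated_half[OF dominated_sqn[OF f]], rule dominated_half[OF dominated_sqn[OF g]])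
    then show ?thesis using gram_sym[of l l'] by (simp add: field_simps)
  qed
  have "sqn (f + g) \<le> 2 * sqn f + 2 * sqn g - (2 * pair_list (f - g) l' - gram k l' l')" for l'
    using *[of _ l'] by (intro sqn_le) (simp add: dominated_def algebra_simps)
  then have "sqn (f - g) \<le> 2 * sqn f + 2 * sqn g - sqn (f + g)"
    by (intro sqn_le) (simp add: dominated_def algebra_simps)
  then show ?thesis by simp
qed

text \<open>The reverse inequality is \<open>sqn_parallelogram_le\<close> for \<open>f + g\<close>
  and \<open>f - g\<close>, whose sum and difference are twice \<open>f\<close> and twice
  \<open>g\<close>.\<close>

lemma sqn_parallelogram:
  assumes f: "f \<in> rkhs k" and g: "g \<in> rkhs k"
  shows "sqn (f + g) + sqn (f - g) = 2 * sqn f + 2 * sqn g"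
proof -
  have "sqn ((f + g) + (f - g)) + sqn ((f + g) - (f - g)) \<le> 2 * sqn (f + g) + 2 * sqn (f - g)"
    using f g by (intro sqn_parallelogram_le rkhs_add rkhs_diff)
  moreover have "(f + g) + (f - g) = 2 *\<^sub>R f" "(f + g) - (f - g) = 2 *\<^sub>R g"
    by (auto simp: scaleR_2)
  ultimately show ?thesis using sqn_parallelogram_le[OF f g] f g by (simp add: sqn_scale)
qed

lemma ip_space_rkhs: "ip_space (rkhs k) (\<lambda>f g. (sqn (f + g) - sqn (f - g)) / 4)"
  by (intro Jordan_von_Neumann subspace_rkhs sqn_nonneg sqn_scale sqn_parallelogram)

lemma rkhs_inner_eq:
  assumes "f \<in> rkhs k" "g \<in> rkhs k"
  shows "rkhs_inner k f g = (sqn (f + g) - sqn (f - g)) / 4"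
proof -
  have "(\<lambda>x. f x + g x) = f + g" "(\<lambda>x. f x - g x) = f - g" by auto
  then show ?thesis using assms
    by (simp add: rkhs_inner_def rkhs_norm_square rkhs_add rkhs_diff del: plus_fun_apply minus_apply)
qed

lemma rkhs_inner_self: "f \<in> rkhs k \<Longrightarrow> rkhs_inner k f f = sqn f"
  using sqn_scale[of f 2] sqn_scale[of f 0] by (simp add: rkhs_inner_eq scaleR_2)

sublocale H: ip_space "rkhs k" "rkhs_inner k"
proof -
  interpret I: ip_space "rkhs k" "\<lambda>f g. (sqn (f + g) - sqn (f - g)) / 4" by (rule ip_space_rkhs)
  show "ip_space (rkhs k) (rkhs_inner k)"
  proof
    fix x y z c assume x: "x \<in> rkhs k" and y: "y \<in> rkhs k"
    show "rkhs_inner k x y = rkhs_inner k y x" using I.ip_sym[OF x y] x y by (simp add: rkhs_inner_eq)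
    show "rkhs_inner k (c *\<^sub>R x) y = c * rkhs_inner k x y"
      using I.ip_scale[OF x y] x y by (simp add: rkhs_inner_eq)
    show "rkhs_inner k (x + y) z = rkhs_inner k x z + rkhs_inner k y z" if "z \<in> rkhs k"
      using I.ip_add[OF x y that] x y that by (simp add: rkhs_inner_eq)
  qed (auto simp: subspace_rkhs rkhs_inner_self sqn_nonneg)
qed

lemma rkhs_norm_eq: "f \<in> rkhs k \<Longrightarrow> (rkhs_norm k f)\<^sup>2 = rkhs_inner k f f"
  by (simp add: rkhs_norm_square rkhs_inner_self)

lemma rkhs_bound_inner: "f \<in> rkhs k \<Longrightarrow> rkhs_bound k f (rkhs_inner k f f)"
  using rkhs_bound_sqn by (simp add: rkhs_inner_self)

lemma inner_le_of_bound: "rkhs_bound k f C \<Longrightarrow> 0 \<le> C \<Longrightarrow> rkhs_inner k f f \<le> C"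
  by (metis dominated_iff rkhs_iff rkhs_inner_self sqn_le)

lemma rkhsI: "rkhs_bound k f C \<Longrightarrow> f \<in> rkhs k"
  by (auto simp: rkhs_def)

text \<open>Extending the list by \<open>(- t, x)\<close> absorbs the added kernel section by
  completing the square.\<close>

lemma dominated_add_kernel:
  assumes f: "dominated f C"
  shows "dominated (f + t *\<^sub>R k x) (C + 2 * t * f x + t\<^sup>2 * k x x)"
  unfolding dominated_def
proof
  fix l
  have "2 * pair_list f ((- t, x) # l) \<le> C + gram k ((- t, x) # l) ((- t, x) # l)"
    using f unfolding dominated_def by blast
  then show "2 * pair_list (f + t *\<^sub>R k x) l \<le> C + 2 * t * f x + t\<^sup>2 * k x x + gram k l l"
    by (simp add: gram_Cons)
qed

lemma kernel_in_rkhs: "k x \<in> rkhs k"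
proof -
  have "dominated 0 0" using gram_nonneg by (simp add: dominated_def)
  from dominated_add_kernel[OF this, of 1 x] show ?thesis by (auto simp: rkhs_iff)
qed

text \<open>Equality, because the step can be undone with \<open>- t\<close>. The reproducing
  property follows from this by polarization.\<close>

lemma sqn_add_kernel:
  assumes f: "f \<in> rkhs k"
  shows "sqn (f + t *\<^sub>R k x) = sqn f + 2 * t * f x + t\<^sup>2 * k x x"
proof (rule antisym)
  show "sqn (f + t *\<^sub>R k x) \<le> sqn f + 2 * t * f x + t\<^sup>2 * k x x"
    using f by (intro sqn_le dominated_add_kernel dominated_sqn)
  have "f + t *\<^sub>R k x \<in> rkhs k" by (intro rkhs_add rkhs_scale kernel_in_rkhs f)
  then have "sqn (f + t *\<^sub>R k x + (- t) *\<^sub>R k x)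
      \<le> sqn (f + t *\<^sub>R k x) + 2 * (- t) * (f + t *\<^sub>R k x) x + (- t)\<^sup>2 * k x x"
    by (intro sqn_le dominated_add_kernel dominated_sqn)
  then show "sqn f + 2 * t * f x + t\<^sup>2 * k x x \<le> sqn (f + t *\<^sub>R k x)"
    by (simp add: power2_eq_square algebra_simps)
qed

lemma reproducing: "f \<in> rkhs k \<Longrightarrow> rkhs_inner k f (k x) = f x"
  using sqn_add_kernel[of f 1 x] sqn_add_kernel[of f "-1" x]
  by (simp add: rkhs_inner_eq kernel_in_rkhs)

lemma reproducing': "f \<in> rkhs k \<Longrightarrow> rkhs_inner k (k x) f = f x"
  using reproducing by (simp add: H.ip_sym kernel_in_rkhs)

lemma rkhs_eval_le: "f \<in> rkhs k \<Longrightarrow> (f x)\<^sup>2 \<le> rkhs_inner k f f * k x x"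
  using H.Cauchy_Schwarz[of f "k x"] reproducing[of f x] reproducing[of "k x" x]
  by (simp add: kernel_in_rkhs)

text \<open>The limit is first taken pointwise. For each fixed list the inequality of
  \<open>rkhs_bound\<close> survives the limit, which gives both the membership of
  \<open>X m - f\<close> and the smallness of its norm.\<close>

sublocale H: hilb "rkhs k" "rkhs_inner k"
proof
  fix X :: "nat \<Rightarrow> 'a \<Rightarrow> real"
  assume X: "\<And>n. X n \<in> rkhs k"
    and C: "\<And>e. 0 < e \<Longrightarrow> \<exists>M. \<forall>m\<ge>M. \<forall>n\<ge>M. H.nsq (X m - X n) < e"
  have "Cauchy (\<lambda>n. X n x)" for x
  proof (rule metric_CauchyI)
    fix e :: real assume e: "e > 0"
    \<comment> \<open>Adding 1 covers points with \<open>k x x = 0\<close>.\<close>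
    have "e\<^sup>2 / (k x x + 1) > 0" using e k_diag_nonneg[of x] by (simp add: add_nonneg_pos)
    then obtain M where M: "\<forall>m\<ge>M. \<forall>n\<ge>M. H.nsq (X m - X n) < e\<^sup>2 / (k x x + 1)"
      using C by blast
    show "\<exists>M. \<forall>m\<ge>M. \<forall>n\<ge>M. dist (X m x) (X n x) < e"
    proof (intro exI allI impI)
      fix m n assume "m \<ge> M" "n \<ge> M"
      then have r: "H.nsq (X m - X n) < e\<^sup>2 / (k x x + 1)" using M by blast
      have mem: "X m - X n \<in> rkhs k" using X by (intro rkhs_diff)
      have "((X m - X n) x)\<^sup>2 \<le> H.nsq (X m - X n) * k x x"
        by (rule rkhs_eval_le[OF mem])
      also have "\<dots> \<le> H.nsq (X m - X n) * (k x x + 1)"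
        using H.ip_nonneg[OF mem] by (intro mult_left_mono) auto
      also have "\<dots> < e\<^sup>2" using r k_diag_nonneg[of x] by (simp add: pos_less_divide_eq add_nonneg_pos)
      finally show "dist (X m x) (X n x) < e"
        using e abs_le_square_iff[of e "(X m - X n) x"] by (simp add: dist_real_def not_less[symmetric])
    qed
  qed
  then have "\<exists>l. (\<lambda>n. X n x) \<longlonglongrightarrow> l" for x using Cauchy_convergent_iff convergent_def by blast
  then obtain f where f: "\<And>x. (\<lambda>n. X n x) \<longlonglongrightarrow> f x" by metis
  have pl: "(\<lambda>n. pair_list (X m - X n) l) \<longlonglongrightarrow> pair_list (X m - f) l" for l m
  proof (induction l)
    case (Cons p l)
    then show ?case by (cases p) (auto intro!: tendsto_intros f simp del: pair_list_fun)
  qed simp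
  have close: "\<exists>M. \<forall>m\<ge>M. X m - f \<in> rkhs k \<and> H.nsq (X m - f) \<le> e" if e: "e > 0" for e
  proof -
    obtain M where M: "\<And>m n. m \<ge> M \<Longrightarrow> n \<ge> M \<Longrightarrow> H.nsq (X m - X n) < e"
      using C[OF e] by blast
    have "rkhs_bound k (X m - f) e" if m: "m \<ge> M" for m
      unfolding rkhs_bound_list
    proof
      fix l
      have "(\<lambda>n. (pair_list (X m - X n) l)\<^sup>2) \<longlonglongrightarrow> (pair_list (X m - f) l)\<^sup>2"
        by (intro tendsto_intros pl)
      moreover have "(pair_list (X m - X n) l)\<^sup>2 \<le> e * gram k l l" if n: "n \<ge> M" for n
      proof -
        have "(pair_list (X m - X n) l)\<^sup>2 \<le> H.nsq (X m - X n) * gram k l l"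
          using rkhs_bound_inner[OF rkhs_diff[OF X X]] unfolding rkhs_bound_list by blast
        also have "\<dots> \<le> e * gram k l l"
          using M[OF m n] gram_nonneg by (intro mult_right_mono) auto
        finally show ?thesis .
      qed
      ultimately show "(pair_list (X m - f) l)\<^sup>2 \<le> e * gram k l l"
        by (intro LIMSEQ_le_const2) auto
    qed
    then show ?thesis using e by (meson rkhsI inner_le_of_bound less_imp_le)
  qed
  obtain m where "X m - f \<in> rkhs k" using close[of 1] by auto
  from rkhs_diff[OF X[of m] this] have fV: "f \<in> rkhs k" by simp
  show "\<exists>x\<in>rkhs k. (\<lambda>n. H.nsq (X n - x)) \<longlonglongrightarrow> 0"
  proof (intro bexI[OF _ fV] LIMSEQ_I)
    fix r :: real assume "r > 0"
    then obtain M where "\<And>m. m \<ge> M \<Longrightarrow> H.nsq (X m - f) \<le> r / 2"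
      using close[of "r / 2"] by auto
    then show "\<exists>no. \<forall>n\<ge>no. norm (H.nsq (X n - f) - 0) < r"
      using \<open>r > 0\<close> H.ip_nonneg[OF rkhs_diff[OF X fV]] by (intro exI[of _ M]) fastforce
  qed
qed

lemma rkhs_inner_zero_imp: "f \<in> rkhs k \<Longrightarrow> rkhs_inner k f f = 0 \<Longrightarrow> f = 0"
proof
  fix x assume "f \<in> rkhs k" "rkhs_inner k f f = 0"
  then show "f x = 0 x" using rkhs_eval_le[of f x] by simp
qed

end

lemma psd_kernel_mercer: "mercer_kernel K \<Longrightarrow> psd_kernel K"
proof
  assume m: "mercer_kernel K"
  show "K x y = K y x" for x y using m by (auto simp: mercer_kernel_def)
  show "0 \<le> gram K l l" for l
  proof -
    obtain n c xs where l: "l = map (\<lambda>i. (c i, xs i)) [0..<n]" using ex_list_map by blast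
    show ?thesis using m unfolding l gram_map mercer_kernel_def by blast
  qed
qed

section \<open>Orthonormal bases\<close>

context ip_space
begin

definition orthonormal :: "'b set \<Rightarrow> bool" where
  "orthonormal B \<longleftrightarrow> B \<subseteq> V \<and> (\<forall>e\<in>B. \<forall>e'\<in>B. ip e e' = (if e = e' then 1 else 0))"

definition proj :: "'b set \<Rightarrow> 'b \<Rightarrow> 'b" where
  "proj F f = (\<Sum>e\<in>F. ip f e *\<^sub>R e)"

lemma proj_in: "F \<subseteq> V \<Longrightarrow> proj F f \<in> V"
  unfolding proj_def by (intro V_sum) auto

lemma ip_proj: "F \<subseteq> V \<Longrightarrow> g \<in> V \<Longrightarrow> ip (proj F f) g = (\<Sum>e\<in>F. ip f e * ip e g)"
  unfolding proj_def by (subst ip_sum) (auto simp: ip_scale subset_iff intro!: sum.cong)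

lemma ip_proj_basis:
  assumes "orthonormal B" "finite F" "F \<subseteq> B" "e \<in> B"
  shows "ip (proj F f) e = (if e \<in> F then ip f e else 0)"
proof -
  have "ip (proj F f) e = (\<Sum>e'\<in>F. ip f e' * ip e' e)"
    using assms by (intro ip_proj) (auto simp: orthonormal_def)
  also have "\<dots> = (\<Sum>e'\<in>F. if e' = e then ip f e' else 0)"
    using assms by (intro sum.cong) (auto simp: orthonormal_def)
  finally show ?thesis using assms by simp
qed

lemma ip_residual_span:
  assumes B: "orthonormal B" "finite F" "F \<subseteq> B" and f: "f \<in> V" and F0: "F0 \<subseteq> F"
  shows "ip (f - proj F f) (\<Sum>e\<in>F0. c e *\<^sub>R e) = 0"
proof -
  have V: "F \<subseteq> V" using B by (auto simp: orthonormal_def)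
  have "ip (f - proj F f) e = 0" if "e \<in> F" for e
    using ip_proj_basis[OF B, of e f] that B V f proj_in[OF V, of f] by (auto simp: ip_diff subset_iff)
  then show ?thesis using V F0 f proj_in[OF V, of f]
    by (subst ip_sum_right) (auto simp: ip_scale_right subset_iff intro!: sum.neutral)
qed

text \<open>Pythagoras. The competitor may live on a smaller set \<open>F0\<close>, so finite parts
  of a basis chosen at different points can be united without loss.\<close>

lemma proj_best:
  fixes c :: "'b \<Rightarrow> real"
  assumes B: "orthonormal B" "finite F" "F \<subseteq> B" and f: "f \<in> V" and F0: "F0 \<subseteq> F"
  defines "w \<equiv> (\<Sum>e\<in>F0. c e *\<^sub>R e)"
  shows "nsq (f - proj F f) \<le> nsq (f - w)"
proof -
  have V: "F \<subseteq> V" using B by (auto simp: orthonormal_def)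
  have w: "w \<in> V" using V F0 unfolding w_def by (intro V_sum) auto
  have p: "proj F f \<in> V" using V by (rule proj_in)
  have "ip (f - proj F f) w = 0" unfolding w_def by (rule ip_residual_span[OF B f F0])
  moreover have "ip (f - proj F f) (proj F f) = 0"
    using ip_residual_span[OF B f subset_refl] unfolding proj_def by blast
  ultimately have "ip (f - proj F f) (proj F f - w) = 0" using f p w by (simp add: ip_diff_right)
  moreover have "f - w = (f - proj F f) + (proj F f - w)" by simp
  ultimately have "nsq (f - w) = nsq (f - proj F f) + nsq (proj F f - w)"
    using f p w by (simp only: ip_square_add V_mem)
  then show ?thesis using ip_nonneg[of "proj F f - w"] p w by simp
qed

lemma residual_square:
  assumes B: "orthonormal B" "finite F" "F \<subseteq> B" and f: "f \<in> V"
  shows "nsq (f - proj F f) = ip f f - (\<Sum>e\<in>F. (ip f e)\<^sup>2)"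
proof -
  have V: "F \<subseteq> V" using B by (auto simp: orthonormal_def)
  have p: "proj F f \<in> V" using V by (rule proj_in)
  have "ip (f - proj F f) (proj F f) = 0"
    using ip_residual_span[OF B f subset_refl] unfolding proj_def by blast
  then have "nsq (f - proj F f) = ip (f - proj F f) f"
    using f p by (simp add: ip_diff_right)
  also have "\<dots> = ip f f - ip (proj F f) f" using f p by (simp add: ip_diff)
  also have "ip (proj F f) f = (\<Sum>e\<in>F. (ip f e)\<^sup>2)"
    using V f by (subst ip_proj) (auto simp: power2_eq_square ip_sym subset_iff intro!: sum.cong)
  finally show ?thesis .
qed

lemma Bessel:
  assumes B: "orthonormal B" "finite F" "F \<subseteq> B" and f: "f \<in> V"
  shows "(\<Sum>e\<in>F. (ip f e)\<^sup>2) \<le> ip f f"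
proof -
  have "proj F f \<in> V" using B by (intro proj_in) (auto simp: orthonormal_def)
  then show ?thesis using residual_square[OF B f] ip_nonneg[of "f - proj F f"] f by simp
qed

end

context hilb
begin

text \<open>Since \<open>B\<close> may be uncountable, the Bessel sums are maximized along a
  sequence of finite subsets instead of an enumeration of \<open>B\<close>. The projections
  converge, their limit leaves a remainder orthogonal to all of \<open>B\<close>, and maximality
  makes the norm of that remainder zero.\<close>

lemma maximal_orthonormal_dense:
  assumes B: "orthonormal B" and max: "\<And>B'. orthonormal B' \<Longrightarrow> B \<subseteq> B' \<Longrightarrow> B' = B"
    and f: "f \<in> V" and e: "0 < \<epsilon>"
  shows "\<exists>F. finite F \<and> F \<subseteq> B \<and> nsq (f - proj F f) < \<epsilon>"
proof -
  have BV: "B \<subseteq> V" using B by (auto simp: orthonormal_def)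
  define s where "s F = (\<Sum>e\<in>F. (ip f e)\<^sup>2)" for F
  define S where "S = (SUP F\<in>{F. finite F \<and> F \<subseteq> B}. s F)"
  have bdd: "bdd_above (s ` {F. finite F \<and> F \<subseteq> B})"
    using Bessel[OF B _ _ f] by (auto simp: s_def intro!: bdd_aboveI[of _ "ip f f"])
  have sS: "s F \<le> S" if "finite F" "F \<subseteq> B" for F
    unfolding S_def using that bdd by (intro cSUP_upper) auto
  have "\<exists>F. finite F \<and> F \<subseteq> B \<and> S - 1 / real (Suc n) < s F" for n
  proof -
    have "\<exists>y\<in>s ` {F. finite F \<and> F \<subseteq> B}. S - 1 / real (Suc n) < y"
      unfolding S_def by (rule less_cSupD) auto
    then show ?thesis by auto
  qed
  then obtain F where F: "\<And>n. finite (F n)" "\<And>n. F n \<subseteq> B" "\<And>n. S - 1 / real (Suc n) < s (F n)"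
    by metis
  \<comment> \<open>Unions make the finite sets increasing, so successive projections differ by
    vectors orthogonal to the later residual.\<close>
  define G where "G n = (\<Union>i\<le>n. F i)" for n
  have G: "finite (G n)" "G n \<subseteq> B" for n using F by (auto simp: G_def)
  have Gmono: "G m \<subseteq> G n" if "m \<le> n" for m n using that by (fastforce simp: G_def)
  have sG: "S - 1 / real (Suc n) < s (G n)" for n
  proof -
    have "s (F n) \<le> s (G n)" unfolding s_def using G by (intro sum_mono2) (auto simp: G_def)
    then show ?thesis using F(3)[of n] by simp
  qed
  define X where "X n = proj (G n) f" for n
  have X: "X n \<in> V" for n unfolding X_def using G BV by (intro proj_in) auto
  have res: "nsq (f - X n) = ip f f - s (G n)" for n
    unfolding X_def s_def by (rule residual_square[OF B G f])
  have diff: "nsq (X n - X m) \<le> 1 / real (Suc m)" if mn: "m \<le> n" for m n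
  proof -
    have "ip (f - X n) (X n - X m) = 0"
    proof -
      have "ip (f - X n) (X n) = 0" "ip (f - X n) (X m) = 0"
        using ip_residual_span[OF B G f, of "G n" n "\<lambda>e. ip f e"]
          ip_residual_span[OF B G f Gmono[OF mn], of "\<lambda>e. ip f e"]
        by (auto simp: X_def proj_def)
      then show ?thesis using X f by (simp add: ip_diff_right)
    qed
    moreover have "f - X m = (f - X n) + (X n - X m)" by simp
    ultimately have "nsq (f - X m) = nsq (f - X n) + nsq (X n - X m)"
      using X f by (simp only: ip_square_add V_mem)
    then show ?thesis using res sG[of m] sS[OF G, of n] by simp
  qed
  have "\<exists>u\<in>V. (\<lambda>n. nsq (X n - u)) \<longlonglongrightarrow> 0"
  proof (rule complete[OF X])
    fix d :: real assume "d > 0"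
    then obtain M where M: "1 / real (Suc M) < d" using nat_approx_posE by blast
    show "\<exists>M. \<forall>m\<ge>M. \<forall>n\<ge>M. nsq (X m - X n) < d"
    proof (intro exI allI impI)
      fix m n assume mn: "m \<ge> M" "n \<ge> M"
      have le: "1 / real (Suc j) \<le> 1 / real (Suc M)" if "j \<ge> M" for j
        using that by (simp add: divide_le_cancel frac_le)
      show "nsq (X m - X n) < d"
      proof (cases "m \<le> n")
        case True
        have "nsq (X m - X n) = nsq (X n - X m)"
          using X by (simp add: ip_square_diff ip_sym[of "X m" "X n"])
        then show ?thesis using diff[OF True] le[OF mn(1)] M by linarith
      next
        case False
        then show ?thesis using diff[of n m] le[OF mn(2)] M by linarith
      qed
    qed
  qed
  then obtain u where u: "u \<in> V" and lim: "(\<lambda>n. nsq (X n - u)) \<longlonglongrightarrow> 0" by blast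
  have lim0: "(\<lambda>n. 1 / real (Suc n)) \<longlonglongrightarrow> 0" by (rule LIMSEQ_Suc[OF lim_1_over_n])
  have orth: "ip (f - u) e = 0" if eB: "e \<in> B" for e
  proof -
    have eV: "e \<in> V" using eB BV by auto
    \<comment> \<open>Either \<open>e\<close> is already projected out, or adding it to
      \<open>G n\<close> raises the Bessel sum by at most the remaining gap to
      \<open>S\<close>.\<close>
    have sq: "(ip (f - X n) e)\<^sup>2 \<le> 1 / real (Suc n)" for n
    proof (cases "e \<in> G n")
      case True
      then have "ip (f - X n) e = 0"
        using ip_proj_basis[OF B G eB, of n f] f X[of n] eV by (simp add: ip_diff X_def)
      then show ?thesis by simp
    next
      case False
      have "s (insert e (G n)) \<le> S" using G eB by (intro sS) auto
      moreover have "s (insert e (G n)) = (ip f e)\<^sup>2 + s (G n)" using False G by (simp add: s_def)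
      moreover have "ip (f - X n) e = ip f e"
        using False ip_proj_basis[OF B G eB, of n f] f X[of n] eV by (simp add: ip_diff X_def)
      ultimately show ?thesis using sG[of n] by simp
    qed
    have "(\<lambda>n. (ip (f - X n) e)\<^sup>2) \<longlonglongrightarrow> 0"
      by (rule real_tendsto_sandwich[OF _ _ tendsto_const lim0]) (auto intro!: always_eventually sq simp del: of_nat_Suc)
    moreover have "(\<lambda>n. (ip (f - X n) e)\<^sup>2) \<longlonglongrightarrow> (ip (f - u) e)\<^sup>2"
    proof -
      have "(\<lambda>n. (ip f e - ip (X n) e)\<^sup>2) \<longlonglongrightarrow> (ip f e - ip u e)\<^sup>2"
        by (intro tendsto_intros tendsto_ip X u lim eV)
      then show ?thesis using f X u eV by (simp add: ip_diff)
    qed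
    ultimately have "(ip (f - u) e)\<^sup>2 = 0" using LIMSEQ_unique by blast
    then show ?thesis by simp
  qed
  have zero: "nsq (f - u) = 0"
  proof (rule ccontr)
    define \<delta> where "\<delta> = nsq (f - u)"
    assume "nsq (f - u) \<noteq> 0"
    then have \<delta>: "\<delta> > 0" using ip_nonneg[OF V_mem(3)[OF f u]] by (simp add: \<delta>_def)
    define e where "e = (1 / sqrt \<delta>) *\<^sub>R (f - u)"
    have e: "e \<in> V" using f u by (simp add: e_def)
    have ee: "ip e e = 1" using f u \<delta> by (simp add: e_def ip_scale ip_scale_right \<delta>_def[symmetric])
    have eb: "ip e b = 0" if "b \<in> B" for b
      using that orth BV f u by (auto simp: e_def ip_scale)
    have "orthonormal (insert e B)" unfolding orthonormal_def
    proof (intro conjI ballI)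
      show "insert e B \<subseteq> V" using e BV by auto
      fix a b assume a: "a \<in> insert e B" and b: "b \<in> insert e B"
      have sym: "ip a b = ip b a" using a b e BV by (intro ip_sym) auto
      show "ip a b = (if a = b then 1 else 0)"
        using a b B ee eb sym by (cases "a = e"; cases "b = e") (auto simp: orthonormal_def)
    qed
    then have "insert e B = B" by (intro max) auto
    then have "e \<in> B" by blast
    then show False using eb[of e] ee by simp
  qed
  have "eventually (\<lambda>n. nsq (X n - u) < \<epsilon> / 2) sequentially"
    by (rule order_tendstoD(2)[OF lim]) (use e in simp)
  then obtain n where "nsq (X n - u) < \<epsilon> / 2"
    by (auto simp: eventually_sequentially)
  moreover have "nsq (f - X n) \<le> 2 * nsq (f - u) + 2 * nsq (X n - u)"
    using ip_square_diff_le[of "f - u" "X n - u"] f u X by simp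
  ultimately show ?thesis using zero G[of n] by (intro exI[of _ "G n"]) (simp add: X_def)
qed

text \<open>Existence matters because \<open>rkhs_trace\<close> sums over a basis picked by
  \<open>SOME\<close>.\<close>

lemma ex_orthonormal_basis:
  "\<exists>B. orthonormal B \<and> (\<forall>f\<in>V. \<forall>\<epsilon>>0. \<exists>F. finite F \<and> F \<subseteq> B \<and> nsq (f - proj F f) < \<epsilon>)"
proof -
  have "\<exists>M\<in>{B. orthonormal B}. \<forall>X\<in>{B. orthonormal B}. M \<subseteq> X \<longrightarrow> X = M"
  proof (rule subset_Zorn')
    fix C assume C: "subset.chain {B. orthonormal B} C"
    show "\<Union>C \<in> {B. orthonormal B}" unfolding orthonormal_def mem_Collect_eq
    proof (intro conjI ballI)
      show "\<Union>C \<subseteq> V" using C by (auto simp: subset.chain_def orthonormal_def)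
      fix a b assume "a \<in> \<Union>C" "b \<in> \<Union>C"
      then obtain A B where "a \<in> A" "A \<in> C" "b \<in> B" "B \<in> C" by auto
      moreover then have "A \<subseteq> B \<or> B \<subseteq> A" using C by (auto simp: subset.chain_def)
      ultimately obtain D where "a \<in> D" "b \<in> D" "D \<in> C" by blast
      then show "ip a b = (if a = b then 1 else 0)" using C by (auto simp: subset.chain_def orthonormal_def)
    qed
  qed
  then obtain B where B: "orthonormal B" "\<And>X. orthonormal X \<Longrightarrow> B \<subseteq> X \<Longrightarrow> X = B" by auto
  show ?thesis
  proof (rule exI[of _ B], rule conjI[OF B(1)], intro ballI allI impI)
    fix f :: 'a and \<epsilon> :: real
    assume "f \<in> V" "0 < \<epsilon>"
    with B show "\<exists>F. finite F \<and> F \<subseteq> B \<and> nsq (f - proj F f) < \<epsilon>"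
      by (intro maximal_orthonormal_dense)
  qed
qed

end

section \<open>Schur products of kernels\<close>

definition psd_on :: "'i set \<Rightarrow> ('i \<Rightarrow> 'i \<Rightarrow> real) \<Rightarrow> bool" where
  "psd_on S A \<longleftrightarrow> (\<forall>c. 0 \<le> (\<Sum>i\<in>S. \<Sum>j\<in>S. c i * c j * A i j))"

text \<open>One index is eliminated at a time, as in the Cholesky decomposition.\<close>
lemma Schur_product:
  assumes "finite S" "psd_on S A" "psd_on S B" "\<And>i j. A i j = A j i"
  shows "0 \<le> (\<Sum>i\<in>S. \<Sum>j\<in>S. A i j * B i j)"
  using assms
proof (induction S arbitrary: A rule: finite_induct)
  case (insert x S)
  have expand: "(\<Sum>i\<in>insert x S. \<Sum>j\<in>insert x S. f i j) =
      f x x + (\<Sum>i\<in>S. f x i) + (\<Sum>i\<in>S. f i x) + (\<Sum>i\<in>S. \<Sum>j\<in>S. f i j)" for f :: "_ \<Rightarrow> _ \<Rightarrow> real"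
    using insert.hyps by (simp add: sum.distrib)
  have neq: "i \<noteq> x" if "i \<in> S" for i using that insert.hyps by auto
  \<comment> \<open>Only the coefficient at \<open>x\<close> varies; the discriminant of the
    resulting quadratic is the claim.\<close>
  have quad: "(\<Sum>i\<in>S. c i * A x i)\<^sup>2 \<le> (\<Sum>i\<in>S. \<Sum>j\<in>S. c i * c j * A i j) * A x x" for c
  proof (rule real_quadratic_nonneg)
    fix t
    have "0 \<le> (\<Sum>i\<in>insert x S. \<Sum>j\<in>insert x S. (c(x := t)) i * (c(x := t)) j * A i j)"
      using insert.prems(1) unfolding psd_on_def by blast
    also have "\<dots> = t * t * A x x + (\<Sum>i\<in>S. t * c i * A x i) + (\<Sum>i\<in>S. c i * t * A i x)
        + (\<Sum>i\<in>S. \<Sum>j\<in>S. c i * c j * A i j)"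
      unfolding expand by (simp add: neq cong: sum.cong)
    also have "(\<Sum>i\<in>S. c i * t * A i x) = t * (\<Sum>i\<in>S. c i * A x i)"
      using insert.prems(3) by (auto simp: sum_distrib_left intro!: sum.cong)
    also have "(\<Sum>i\<in>S. t * c i * A x i) = t * (\<Sum>i\<in>S. c i * A x i)"
      by (auto simp: sum_distrib_left intro!: sum.cong)
    finally show "0 \<le> (\<Sum>i\<in>S. \<Sum>j\<in>S. c i * c j * A i j) + 2 * t * (\<Sum>i\<in>S. c i * A x i) + t\<^sup>2 * A x x"
      by (simp add: power2_eq_square algebra_simps)
  next
    have "0 \<le> (\<Sum>i\<in>insert x S. \<Sum>j\<in>insert x S. (if i = x then 1 else 0) * (if j = x then 1 else 0) * A i j)"
      using insert.prems(1) unfolding psd_on_def by (rule spec)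
    also have "\<dots> = A x x" unfolding expand by (simp add: neq cong: sum.cong)
    finally show "0 \<le> A x x" .
  qed
  have BS: "psd_on S B" unfolding psd_on_def
  proof
    fix c
    have "0 \<le> (\<Sum>i\<in>insert x S. \<Sum>j\<in>insert x S. (c(x := 0)) i * (c(x := 0)) j * B i j)"
      using insert.prems(2) unfolding psd_on_def by blast
    also have "\<dots> = (\<Sum>i\<in>S. \<Sum>j\<in>S. c i * c j * B i j)"
      unfolding expand by (simp add: neq cong: sum.cong)
    finally show "0 \<le> (\<Sum>i\<in>S. \<Sum>j\<in>S. c i * c j * B i j)" .
  qed
  show ?case
  proof (cases "A x x = 0")
    case True
    have row: "A x j = 0" if j: "j \<in> S" for j
    proof -
      have "(\<Sum>i\<in>S. (if i = j then 1 else 0) * A x i) = A x j"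
        using j insert.hyps by (simp add: if_distrib[of "\<lambda>u. u * _"] cong: if_cong)
      then show ?thesis using quad[of "\<lambda>i. if i = j then 1 else 0"] True by simp
    qed
    have AS: "psd_on S A" unfolding psd_on_def
    proof
      fix c
      have "0 \<le> (\<Sum>i\<in>insert x S. \<Sum>j\<in>insert x S. (c(x := 0)) i * (c(x := 0)) j * A i j)"
        using insert.prems(1) unfolding psd_on_def by blast
      also have "\<dots> = (\<Sum>i\<in>S. \<Sum>j\<in>S. c i * c j * A i j)"
        unfolding expand by (simp add: neq cong: sum.cong)
      finally show "0 \<le> (\<Sum>i\<in>S. \<Sum>j\<in>S. c i * c j * A i j)" .
    qed
    have "A j x = 0" if "j \<in> S" for j using row[OF that] insert.prems(3) by metis
    then have "(\<Sum>i\<in>insert x S. \<Sum>j\<in>insert x S. A i j * B i j) = (\<Sum>i\<in>S. \<Sum>j\<in>S. A i j * B i j)"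
      using True row by (simp add: expand)
    then show ?thesis using insert.IH[OF AS BS insert.prems(3)] by simp
  next
    case False
    have pos: "A x x > 0"
    proof -
      have "0 \<le> (\<Sum>i\<in>insert x S. \<Sum>j\<in>insert x S. (if i = x then 1 else 0) * (if j = x then 1 else 0) * A i j)"
        using insert.prems(1) unfolding psd_on_def by (rule spec)
      also have "\<dots> = A x x" unfolding expand by (simp add: neq cong: sum.cong)
      finally show ?thesis using False by simp
    qed
    \<comment> \<open>The Schur complement of the pivot: its row and column at \<open>x\<close> are
      zero, and \<open>quad\<close> says that it is positive semidefinite on
      \<open>S\<close>.\<close>
    define A' where "A' i j = A i j - A x i * A x j / A x x" for i j
    have psd': "psd_on S A'" unfolding psd_on_def
    proof
      fix c
      have "(\<Sum>i\<in>S. \<Sum>j\<in>S. c i * c j * A' i j)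
          = (\<Sum>i\<in>S. \<Sum>j\<in>S. c i * c j * A i j) - (\<Sum>i\<in>S. c i * A x i) * (\<Sum>j\<in>S. c j * A x j) / A x x"
        unfolding A'_def sum_product by (simp add: sum_subtractf sum_divide_distrib algebra_simps)
      then show "0 \<le> (\<Sum>i\<in>S. \<Sum>j\<in>S. c i * c j * A' i j)"
        using quad[of c] pos by (simp add: pos_divide_le_eq power2_eq_square)
    qed
    have "0 \<le> (\<Sum>i\<in>S. \<Sum>j\<in>S. A' i j * B i j)"
    proof (rule insert.IH[OF psd' BS])
      fix i j
      show "A' i j = A' j i" unfolding A'_def by (simp only: insert.prems(3)[of i j] mult.commute)
    qed
    also have "\<dots> = (\<Sum>i\<in>insert x S. \<Sum>j\<in>insert x S. A' i j * B i j)"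
    proof -
      have "A' x i = 0" "A' i x = 0" for i
        using pos insert.prems(3)[of i x] by (simp_all add: A'_def)
      then show ?thesis unfolding expand by simp
    qed
    finally have 1: "0 \<le> (\<Sum>i\<in>insert x S. \<Sum>j\<in>insert x S. A' i j * B i j)" .
    \<comment> \<open>The rank-one part that was split off contributes the form of \<open>B\<close>
      at the coefficients \<open>A x i\<close>.\<close>
    have "0 \<le> (\<Sum>i\<in>insert x S. \<Sum>j\<in>insert x S. A x i * A x j * B i j) / A x x"
      using insert.prems(2) pos unfolding psd_on_def by simp
    also have "\<dots> = (\<Sum>i\<in>insert x S. \<Sum>j\<in>insert x S. A i j * B i j) - (\<Sum>i\<in>insert x S. \<Sum>j\<in>insert x S. A' i j * B i j)"
      unfolding A'_def by (simp add: sum_divide_distrib algebra_simps flip: sum_subtractf del: sum.insert)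
    finally show ?thesis using 1 by linarith
  qed
qed simp

lemma (in psd_kernel) psd_on_kernel: "psd_on {..<n::nat} (\<lambda>i j. c i * c j * k (xs i) (xs j))"
  unfolding psd_on_def
proof
  fix d
  show "0 \<le> (\<Sum>i<n. \<Sum>j<n. d i * d j * (c i * c j * k (xs i) (xs j)))"
    using gram_nonneg[of "map (\<lambda>i. (d i * c i, xs i)) [0..<n]"] unfolding gram_map
    by (simp add: mult_ac)
qed

lemma psd_kernel_product:
  fixes k r :: "'a \<Rightarrow> 'a \<Rightarrow> real"
  assumes "psd_kernel k" "psd_kernel r"
  shows "psd_kernel (\<lambda>x y. k x y * r x y)"
proof
  interpret k: psd_kernel k by fact
  interpret r: psd_kernel r by fact
  show "k x y * r x y = k y x * r y x" for x y using k.k_sym r.k_sym by metis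
  fix l :: "(real \<times> 'a) list"
  obtain n c xs where l: "l = map (\<lambda>i. (c i, xs i)) [0..<n]" using ex_list_map by blast
  have "0 \<le> (\<Sum>i<n. \<Sum>j<n. r (xs i) (xs j) * (c i * c j * k (xs i) (xs j)))"
  proof (rule Schur_product)
    show "psd_on {..<n} (\<lambda>i j. r (xs i) (xs j))" using r.psd_on_kernel[of n "\<lambda>_. 1" xs] by simp
  qed (auto intro: r.k_sym k.psd_on_kernel)
  then show "0 \<le> gram (\<lambda>x y. k x y * r x y) l l" unfolding l gram_map by (simp add: mult_ac)
qed

text \<open>The bound on \<open>g\<close> says that \<open>D\<close> times \<open>r\<close> minus
  the rank-one kernel of \<open>g\<close> is positive semidefinite; its Schur product with
  \<open>k\<close> compares the two Gram forms. The bound on \<open>f\<close> is then used with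
  weights \<open>c i * g (xs i)\<close>.\<close>

lemma rkhs_bound_product:
  fixes k r :: "'a \<Rightarrow> 'a \<Rightarrow> real"
  assumes "psd_kernel k" "psd_kernel r" and f: "rkhs_bound k f C" and g: "rkhs_bound r g D" and C: "0 \<le> C"
  shows "rkhs_bound (\<lambda>x y. k x y * r x y) (\<lambda>x. f x * g x) (C * D)"
  unfolding rkhs_bound_def
proof (intro allI)
  interpret k: psd_kernel k by fact
  interpret r: psd_kernel r by fact
  fix n :: nat and xs :: "nat \<Rightarrow> 'a" and c :: "nat \<Rightarrow> real"
  define A where "A i j = D * r (xs i) (xs j) - g (xs i) * g (xs j)" for i j
  have "psd_on {..<n} A" unfolding psd_on_def
  proof
    fix d
    have "(\<Sum>i<n. d i * g (xs i))\<^sup>2 \<le> D * (\<Sum>i<n. \<Sum>j<n. d i * d j * r (xs i) (xs j))"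
      using g unfolding rkhs_bound_def by blast
    then show "0 \<le> (\<Sum>i<n. \<Sum>j<n. d i * d j * A i j)"
      by (simp add: A_def power2_eq_square sum_product sum_distrib_left algebra_simps sum_subtractf)
  qed
  then have "0 \<le> (\<Sum>i<n. \<Sum>j<n. A i j * (c i * c j * k (xs i) (xs j)))"
  proof (rule Schur_product[rotated])
    show "A i j = A j i" for i j using r.k_sym[of "xs i" "xs j"] by (simp add: A_def)
    show "psd_on {..<n} (\<lambda>i j. c i * c j * k (xs i) (xs j))" by (rule k.psd_on_kernel)
  qed simp
  then have *: "(\<Sum>i<n. \<Sum>j<n. (c i * g (xs i)) * (c j * g (xs j)) * k (xs i) (xs j))
      \<le> D * (\<Sum>i<n. \<Sum>j<n. c i * c j * (k (xs i) (xs j) * r (xs i) (xs j)))"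
    by (simp add: A_def sum_distrib_left algebra_simps sum_subtractf)
  have "(\<Sum>i<n. (c i * g (xs i)) * f (xs i))\<^sup>2
      \<le> C * (\<Sum>i<n. \<Sum>j<n. (c i * g (xs i)) * (c j * g (xs j)) * k (xs i) (xs j))"
    using f unfolding rkhs_bound_def by (elim allE[of _ n] allE[of _ xs] allE[of _ "\<lambda>i. c i * g (xs i)"])
  also have "\<dots> \<le> C * (D * (\<Sum>i<n. \<Sum>j<n. c i * c j * (k (xs i) (xs j) * r (xs i) (xs j))))"
    using * C by (rule mult_left_mono)
  finally show "(\<Sum>i<n. c i * (f (xs i) * g (xs i)))\<^sup>2
      \<le> C * D * (\<Sum>i<n. \<Sum>j<n. c i * c j * (k (xs i) (xs j) * r (xs i) (xs j)))"
    by (simp add: mult_ac)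
qed

section \<open>Moments of sums of centred features\<close>

text \<open>A random vector known only through its inner products: its mean is zero in the weak
  sense and measurability concerns the Gram function, so no vector-valued integral is
  formed.\<close>

locale centered_features = ip_space V ip + prob_space M
  for V :: "'b::real_vector set" and ip and M :: "'z measure" +
  fixes X :: "'z \<Rightarrow> 'b"
  assumes X_in: "X z \<in> V"
    and X_meas: "(\<lambda>(z, z'). ip (X z) (X z')) \<in> borel_measurable (M \<Otimes>\<^sub>M M)"
    and X_integrable: "v \<in> V \<Longrightarrow> integrable M (\<lambda>z. ip v (X z))"
    and X_mean: "v \<in> V \<Longrightarrow> (\<integral>z. ip v (X z) \<partial>M) = 0"
    and X_square_integrable: "integrable M (\<lambda>z. nsq (X z))"
begin

definition partial_sum :: "nat \<Rightarrow> (nat \<Rightarrow> 'z) \<Rightarrow> 'b" where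
  "partial_sum n w = (\<Sum>i<n. X (w i))"

lemma partial_sum_in: "partial_sum n w \<in> V"
  unfolding partial_sum_def by (intro V_sum X_in)

lemma partial_sum_Suc: "partial_sum (Suc n) (w(n := z)) = partial_sum n w + X z"
  by (simp add: partial_sum_def)

lemma partial_sum_measurable [measurable]:
  "{..<n} \<subseteq> I \<Longrightarrow> (\<lambda>w. nsq (partial_sum n w)) \<in> borel_measurable (PiM I (\<lambda>_. M))"
proof -
  assume I: "{..<n} \<subseteq> I"
  have *: "(\<lambda>w. ip (X (w i)) (X (w j))) \<in> borel_measurable (PiM I (\<lambda>_. M))" if "i < n" "j < n" for i j
  proof -
    have [measurable]: "i \<in> I" "j \<in> I" using I that by auto
    have "(\<lambda>w. (w i, w j)) \<in> PiM I (\<lambda>_. M) \<rightarrow>\<^sub>M M \<Otimes>\<^sub>M M" by measurable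
    from measurable_compose[OF this X_meas] show ?thesis by simp
  qed
  have "(\<lambda>w. nsq (partial_sum n w)) = (\<lambda>w. \<Sum>i<n. \<Sum>j<n. ip (X (w i)) (X (w j)))"
    unfolding partial_sum_def by (rule ext, subst ip_sum) (auto simp: ip_sum_right X_in V_sum)
  then show ?thesis using * by simp
qed

text \<open>The last observation is integrated out; its cross term with the earlier sum vanishes by
  \<open>X_mean\<close>. Nonnegative integrals avoid integrability questions on the product
  space.\<close>

lemma second_moment:
  "(\<integral>\<^sup>+w. ennreal (nsq (partial_sum n w)) \<partial>PiM {..<n} (\<lambda>_. M))
    = ennreal (real n * (\<integral>z. nsq (X z) \<partial>M))"
proof (induction n)
  case 0
  interpret P: prob_space "PiM {} (\<lambda>_::nat. M)" by (intro prob_space_PiM prob_space_axioms)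
  show ?case by (simp add: partial_sum_def)
next
  case (Suc n)
  interpret P: prob_space "PiM {..<n} (\<lambda>_::nat. M)" by (intro prob_space_PiM prob_space_axioms)
  interpret F: product_sigma_finite "\<lambda>_::nat. M" by standard
  define \<tau> where "\<tau> = (\<integral>z. nsq (X z) \<partial>M)"
  have \<tau>: "0 \<le> \<tau>" unfolding \<tau>_def by (intro integral_nonneg_AE always_eventually allI ip_nonneg X_in)
  have "(\<integral>\<^sup>+w. ennreal (nsq (partial_sum (Suc n) w)) \<partial>PiM {..<Suc n} (\<lambda>_. M)) =
    (\<integral>\<^sup>+w. (\<integral>\<^sup>+z. ennreal (nsq (partial_sum (Suc n) (w(n := z)))) \<partial>M)
      \<partial>PiM {..<n} (\<lambda>_. M))"
    unfolding lessThan_Suc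
    by (rule F.product_nn_integral_insert) (auto simp flip: lessThan_Suc)
  also have "\<dots> = (\<integral>\<^sup>+w. ennreal (nsq (partial_sum n w)) + ennreal \<tau> \<partial>PiM {..<n} (\<lambda>_. M))"
  proof (rule nn_integral_cong)
    fix w
    let ?S = "partial_sum n w"
    have S: "?S \<in> V" by (rule partial_sum_in)
    have "(\<integral>\<^sup>+z. ennreal (nsq (partial_sum (Suc n) (w(n := z)))) \<partial>M)
      = (\<integral>\<^sup>+z. ennreal (ip ?S ?S + 2 * ip ?S (X z) + nsq (X z)) \<partial>M)"
      by (simp add: partial_sum_Suc ip_square_add S X_in)
    also have "\<dots> = ennreal (\<integral>z. ip ?S ?S + 2 * ip ?S (X z) + nsq (X z) \<partial>M)"
      using ip_nonneg[of "?S + X _"] S X_in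
      by (intro nn_integral_eq_integral Bochner_Integration.integrable_add integrable_mult_right
           integrable_const X_integrable X_square_integrable) (auto simp: ip_square_add)
    also have "(\<integral>z. ip ?S ?S + 2 * ip ?S (X z) + nsq (X z) \<partial>M) = ip ?S ?S + \<tau>"
      using S by (simp add: X_integrable X_square_integrable X_mean \<tau>_def prob_space)
    also have "ennreal (ip ?S ?S + \<tau>) = ennreal (ip ?S ?S) + ennreal \<tau>"
      using \<tau> S by (intro ennreal_plus ip_nonneg)
    finally show "(\<integral>\<^sup>+z. ennreal (nsq (partial_sum (Suc n) (w(n := z)))) \<partial>M)
      = ennreal (ip ?S ?S) + ennreal \<tau>" .
  qed
  also have "\<dots> = ennreal (real n * \<tau>) + ennreal \<tau>"
    using Suc by (subst nn_integral_add) (auto simp: \<tau>_def P.emeasure_space_1)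
  also have "\<dots> = ennreal (real (Suc n) * \<tau>)"
    using \<tau> by (simp add: algebra_simps flip: ennreal_plus)
  finally show ?case by (simp add: \<tau>_def)
qed

text \<open>The same induction. The term linear in the new vector integrates to zero and the others
  are reduced to products of squared norms, which leaves the increment
  \<open>8 * real n * \<tau>\<^sup>2 + 3 * W\<close>.\<close>

lemma fourth_moment:
  assumes sq: "integrable M (\<lambda>z. (nsq (X z))\<^sup>2)"
  shows "(\<integral>\<^sup>+w. ennreal ((nsq (partial_sum n w))\<^sup>2) \<partial>PiM {..<n} (\<lambda>_. M))
    \<le> ennreal (4 * (real n)\<^sup>2 * (\<integral>z. nsq (X z) \<partial>M)\<^sup>2 + 3 * real n * (\<integral>z. (nsq (X z))\<^sup>2 \<partial>M))"
proof (induction n)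
  case 0
  show ?case by (simp add: partial_sum_def)
next
  case (Suc n)
  interpret P: prob_space "PiM {..<n} (\<lambda>_::nat. M)" by (intro prob_space_PiM prob_space_axioms)
  interpret F: product_sigma_finite "\<lambda>_::nat. M" by standard
  define \<tau> where "\<tau> = (\<integral>z. nsq (X z) \<partial>M)"
  define W where "W = (\<integral>z. (nsq (X z))\<^sup>2 \<partial>M)"
  have \<tau>: "0 \<le> \<tau>" unfolding \<tau>_def by (intro integral_nonneg_AE always_eventually allI ip_nonneg X_in)
  have W: "0 \<le> W" unfolding W_def by (intro integral_nonneg_AE always_eventually allI) simp
  let ?P = "PiM {..<n} (\<lambda>_. M)"
  have "(\<integral>\<^sup>+w. ennreal ((nsq (partial_sum (Suc n) w))\<^sup>2) \<partial>PiM {..<Suc n} (\<lambda>_. M)) =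
    (\<integral>\<^sup>+w. (\<integral>\<^sup>+z. ennreal ((nsq (partial_sum (Suc n) (w(n := z))))\<^sup>2) \<partial>M) \<partial>?P)"
    unfolding lessThan_Suc
    by (rule F.product_nn_integral_insert) (auto simp flip: lessThan_Suc)
  also have "\<dots> \<le> (\<integral>\<^sup>+w. ennreal ((nsq (partial_sum n w))\<^sup>2)
      + (ennreal (8 * \<tau>) * ennreal (nsq (partial_sum n w)) + ennreal (3 * W)) \<partial>?P)"
  proof (rule nn_integral_mono)
    fix w
    let ?S = "partial_sum n w"
    have S: "?S \<in> V" by (rule partial_sum_in)
    define v where "v = ip ?S ?S"
    have v: "0 \<le> v" unfolding v_def using S by (rule ip_nonneg)
    define g where "g z = v\<^sup>2 + 4 * v * ip ?S (X z) + 8 * v * nsq (X z) + 3 * (nsq (X z))\<^sup>2" for z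
    \<comment> \<open>The mixed term \<open>4 * s * c\<close> is split by Young's inequality and
      \<open>s\<^sup>2\<close> is bounded by Cauchy-Schwarz, so that \<open>s\<close> survives only
      in the term of mean zero.\<close>
    have g: "(v + 2 * ip ?S (X z) + nsq (X z))\<^sup>2 \<le> g z" for z
    proof -
      define s c where "s = ip ?S (X z)" and "c = nsq (X z)"
      have "s\<^sup>2 \<le> v * c" unfolding s_def c_def v_def by (rule Cauchy_Schwarz[OF S X_in])
      moreover have "4 * s * c \<le> 2 * s\<^sup>2 + 2 * c\<^sup>2"
        using zero_le_power2[of "s - c"] by (simp add: power2_eq_square algebra_simps)
      ultimately have "v\<^sup>2 + 4 * s\<^sup>2 + c\<^sup>2 + 4 * v * s + 2 * v * c + 4 * s * c \<le> v\<^sup>2 + 4 * v * s + 8 * v * c + 3 * c\<^sup>2"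
        by (simp add: algebra_simps)
      then have "(v + 2 * s + c)\<^sup>2 \<le> v\<^sup>2 + 4 * v * s + 8 * v * c + 3 * c\<^sup>2"
        by (simp add: power2_eq_square algebra_simps)
      then show ?thesis by (simp add: g_def s_def c_def)
    qed
    have g0: "0 \<le> g z" for z using g[of z] zero_le_power2 order_trans by blast
    have "(\<integral>\<^sup>+z. ennreal ((nsq (partial_sum (Suc n) (w(n := z))))\<^sup>2) \<partial>M)
      = (\<integral>\<^sup>+z. ennreal ((v + 2 * ip ?S (X z) + nsq (X z))\<^sup>2) \<partial>M)"
      by (simp add: partial_sum_Suc ip_square_add S X_in v_def)
    also have "\<dots> \<le> (\<integral>\<^sup>+z. ennreal (g z) \<partial>M)"
      by (intro nn_integral_mono ennreal_leI g)
    also have "\<dots> = ennreal (\<integral>z. g z \<partial>M)"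
      using S g0 unfolding g_def
      by (intro nn_integral_eq_integral Bochner_Integration.integrable_add integrable_mult_right
           integrable_const X_integrable X_square_integrable sq) auto
    also have "(\<integral>z. g z \<partial>M) = v\<^sup>2 + (8 * \<tau> * v + 3 * W)"
      using S unfolding g_def
      by (simp add: X_integrable X_square_integrable X_mean \<tau>_def prob_space sq W_def)
    also have "ennreal (v\<^sup>2 + (8 * \<tau> * v + 3 * W)) = ennreal (v\<^sup>2) + (ennreal (8 * \<tau>) * ennreal v + ennreal (3 * W))"
      using \<tau> v W by (simp add: ennreal_plus ennreal_mult)
    finally show "(\<integral>\<^sup>+z. ennreal ((nsq (partial_sum (Suc n) (w(n := z))))\<^sup>2) \<partial>M)
      \<le> ennreal ((ip ?S ?S)\<^sup>2) + (ennreal (8 * \<tau>) * ennreal (ip ?S ?S) + ennreal (3 * W))"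
      by (simp only: v_def)
  qed
  also have "\<dots> = (\<integral>\<^sup>+w. ennreal ((nsq (partial_sum n w))\<^sup>2) \<partial>?P)
      + (ennreal (8 * \<tau>) * ennreal (real n * \<tau>) + ennreal (3 * W))"
    by (simp add: nn_integral_add nn_integral_cmult second_moment \<tau>_def P.emeasure_space_1)
  also have "\<dots> \<le> ennreal (4 * (real n)\<^sup>2 * \<tau>\<^sup>2 + 3 * real n * W) + (ennreal (8 * \<tau>) * ennreal (real n * \<tau>) + ennreal (3 * W))"
    using Suc by (intro add_right_mono) (simp add: \<tau>_def W_def)
  also have "\<dots> = ennreal (4 * (real n)\<^sup>2 * \<tau>\<^sup>2 + 3 * real n * W + (8 * \<tau> * (real n * \<tau>) + 3 * W))"
    using \<tau> W by (simp add: ennreal_plus ennreal_mult)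
  \<comment> \<open>The increment \<open>8 n\<close> is below
    \<open>4 (n + 1)^2 - 4 n^2\<close>.\<close>
  also have "\<dots> \<le> ennreal (4 * (real (Suc n))\<^sup>2 * \<tau>\<^sup>2 + 3 * real (Suc n) * W)"
    by (intro ennreal_leI) (simp add: power2_eq_square algebra_simps)
  finally show ?case by (simp add: \<tau>_def W_def)
qed

end

section \<open>The regularized inner product\<close>

text \<open>Completing the square shows that the Riesz representer of \<open>l\<close> minimizes
  \<open>J\<close>, so \<open>SOME\<close> picks a genuine minimizer; perturbing it gives the
  variational equation. One lemma serves both \<open>f_lambda\<close> and \<open>f_sample\<close>,
  each with its own inner product, \<open>l\<close> and constant.\<close>

lemma (in hilb) minimizer_eq:
  assumes add: "\<And>x y. x \<in> V \<Longrightarrow> y \<in> V \<Longrightarrow> l (x + y) = l x + l y"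
    and scale: "\<And>c x. x \<in> V \<Longrightarrow> l (c *\<^sub>R x) = c * l x"
    and M: "0 \<le> M" and bdd: "\<And>x. x \<in> V \<Longrightarrow> (l x)\<^sup>2 \<le> M * ip x x"
    and J: "\<And>g. g \<in> V \<Longrightarrow> J g = ip g g - 2 * l g + c"
  defines "f \<equiv> (SOME f. f \<in> V \<and> (\<forall>g\<in>V. J f \<le> J g))"
  shows "f \<in> V" "v \<in> V \<Longrightarrow> ip f v = l v"
proof -
  obtain u where u: "u \<in> V" "\<And>v. v \<in> V \<Longrightarrow> ip u v = l v"
    using Riesz[OF add scale M bdd] by blast
  have "J u \<le> J g" if g: "g \<in> V" for g
    using ip_nonneg[of "g - u"] g u J ip_sym[OF g u(1)] by (simp add: ip_square_diff)
  then have "f \<in> V \<and> (\<forall>g\<in>V. J f \<le> J g)"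
    unfolding f_def using u by (intro someI_ex[of "\<lambda>f. f \<in> V \<and> (\<forall>g\<in>V. J f \<le> J g)"]) blast
  then have f: "f \<in> V" and min: "\<And>g. g \<in> V \<Longrightarrow> J f \<le> J g" by auto
  show "f \<in> V" by fact
  show "ip f v = l v" if v: "v \<in> V"
  proof -
    have "(ip f v - l v)\<^sup>2 \<le> 0 * ip v v"
    proof (rule real_quadratic_nonneg)
      fix t
      have "J f \<le> J (f + t *\<^sub>R v)" using f v by (intro min) auto
      then show "0 \<le> 0 + 2 * t * (ip f v - l v) + t\<^sup>2 * ip v v"
        using f v by (simp add: J ip_square_add ip_scale ip_scale_right add scale power2_eq_square algebra_simps)
    qed (use v in \<open>simp add: ip_nonneg\<close>)
    then show ?thesis by simp
  qed
qed

section \<open>Second countability and the Borel sets of products\<close>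

lemma compact_metric_countable_basis:
  assumes "compact (UNIV :: 'a::metric_space set)"
  shows "\<exists>B :: 'a set set. countable B \<and> topological_basis B"
proof -
  have "\<exists>F. finite F \<and> (\<Union>x\<in>F. ball x (1 / real (Suc n))) = (UNIV :: 'a set)" for n
  proof -
    have "UNIV \<subseteq> (\<Union>x\<in>UNIV. ball (x::'a) (1 / real (Suc n)))" by auto
    then obtain F :: "'a set" where "finite F" "UNIV \<subseteq> (\<Union>x\<in>F. ball x (1 / real (Suc n)))"
      using compactE_image[OF assms, of UNIV "\<lambda>x. ball x (1 / real (Suc n))"] by auto
    then show ?thesis by blast
  qed
  then obtain F :: "nat \<Rightarrow> 'a set" where F: "\<And>n. finite (F n)"
    "\<And>n. (\<Union>x\<in>F n. ball x (1 / real (Suc n))) = UNIV" by metis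
  define B where "B = (\<Union>n. (\<lambda>x. ball x (1 / real (Suc n))) ` F n)"
  have "countable B" unfolding B_def using F by (intro countable_UN countable_image) (auto intro: countable_finite)
  moreover have "topological_basis B"
  proof (rule topological_basisI)
    show "open b" if "b \<in> B" for b using that by (auto simp: B_def)
    fix S :: "'a set" and x assume "open S" "x \<in> S"
    then obtain e where e: "e > 0" "ball x e \<subseteq> S" by (auto simp: open_contains_ball)
    then obtain n where n: "1 / real (Suc n) < e / 2" using nat_approx_posE[of "e / 2"] by auto
    obtain y where y: "y \<in> F n" "x \<in> ball y (1 / real (Suc n))" using F(2)[of n] by blast
    have "ball y (1 / real (Suc n)) \<subseteq> ball x e"
    proof
      fix z assume "z \<in> ball y (1 / real (Suc n))"
      then show "z \<in> ball x e" using y(2) n dist_triangle[of x z y] by (auto simp: dist_commute)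
    qed
    then show "\<exists>b\<in>B. x \<in> b \<and> b \<subseteq> S"
      using y e by (intro bexI[of _ "ball y (1 / real (Suc n))"]) (auto simp: B_def)
  qed
  ultimately show ?thesis by blast
qed

text \<open>Continuity gives measurability for the Borel sets of the product topology, while product
  measures carry the product sigma-algebra. Countable bases identify the two; for the input space
  such a basis comes from compactness.\<close>

lemma borel_prod_countable_basis:
  fixes A :: "'a::topological_space set set" and B :: "'b::topological_space set set"
  assumes A: "countable A" "topological_basis A" and B: "countable B" "topological_basis B"
  shows "sets (borel \<Otimes>\<^sub>M borel) = sets (borel :: ('a \<times> 'b) measure)"
proof
  show "sets (borel \<Otimes>\<^sub>M borel) \<subseteq> sets (borel :: ('a \<times> 'b) measure)"
  proof (rule sets_pair_in_sets)
    fix a :: "'a set" and b :: "'b set" assume a: "a \<in> sets borel" and b: "b \<in> sets borel"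
    have "fst \<in> borel_measurable (borel :: ('a \<times> 'b) measure)" "snd \<in> borel_measurable (borel :: ('a \<times> 'b) measure)"
      by (intro borel_measurable_continuous_onI continuous_intros)+
    from measurable_sets[OF this(1) a] measurable_sets[OF this(2) b]
    have "fst -` a \<inter> space borel \<in> sets (borel :: ('a \<times> 'b) measure)"
      "snd -` b \<inter> space borel \<in> sets (borel :: ('a \<times> 'b) measure)"
      by auto
    then have "(fst -` a \<inter> space borel) \<inter> (snd -` b \<inter> space borel) \<in> sets (borel :: ('a \<times> 'b) measure)" by blast
    moreover have "(fst -` a \<inter> space borel) \<inter> (snd -` b \<inter> space borel) = a \<times> b" by auto
    ultimately show "a \<times> b \<in> sets (borel :: ('a \<times> 'b) measure)" by simp
  qed
  let ?P = "(\<lambda>(a, b). a \<times> b) ` (A \<times> B)"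
  have P: "topological_basis ?P" "countable ?P"
    using topological_basis_prod[OF A(2) B(2)] A B by auto
  have "?P \<subseteq> sets (borel \<Otimes>\<^sub>M borel)"
    using A B by (auto intro!: pair_measureI dest: topological_basis_open)
  then have "sigma_sets UNIV ?P \<subseteq> sets (borel \<Otimes>\<^sub>M borel)"
    using sets.sigma_sets_subset[of ?P "borel \<Otimes>\<^sub>M borel"] by (simp add: space_pair_measure)
  then show "sets (borel :: ('a \<times> 'b) measure) \<subseteq> sets (borel \<Otimes>\<^sub>M borel)"
    by (simp add: borel_eq_countable_basis[OF P(2,1)])
qed

context psd_kernel
begin

lemma kernel_diff_square: "rkhs_inner k (k x - k y) (k x - k y) = k x x - 2 * k x y + k y y"
  using kernel_in_rkhs reproducing by (simp add: H.ip_square_diff) 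

lemma rkhs_diff_le:
  assumes "f \<in> rkhs k"
  shows "(f x - f y)\<^sup>2 \<le> rkhs_inner k f f * (k x x - 2 * k x y + k y y)"
proof -
  have "f x - f y = rkhs_inner k f (k x - k y)"
    using assms by (simp add: H.ip_diff_right kernel_in_rkhs reproducing)
  then show ?thesis
    using H.Cauchy_Schwarz[of f "k x - k y"] assms kernel_in_rkhs by (simp add: kernel_diff_square)
qed

end

text \<open>A difference of values is an inner product with \<open>k y - k x\<close>, whose norm
  tends to zero by continuity of the kernel.\<close>

lemma psd_kernel_continuous_function:
  fixes k :: "'a::t2_space \<Rightarrow> 'a \<Rightarrow> real"
  assumes k: "psd_kernel k" and cont: "continuous_on UNIV (\<lambda>z. k (fst z) (snd z))" and f: "f \<in> rkhs k"
  shows "continuous_on UNIV f"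
  unfolding continuous_on_eq_continuous_at[OF open_UNIV]
proof
  interpret psd_kernel k by fact
  fix x
  have c: "isCont (\<lambda>y. k (g y) (h y)) x" if "isCont g x" "isCont h x" for g h :: "'a \<Rightarrow> 'a"
    using continuous_within_compose2[of x UNIV "\<lambda>y. (g y, h y)" "\<lambda>z. k (fst z) (snd z)"] that cont
    by (auto intro!: continuous_Pair simp: continuous_on_eq_continuous_at
        intro: continuous_within_subset)
  have "((\<lambda>y. k y y - 2 * k y x + k x x) \<longlongrightarrow> k x x - 2 * k x x + k x x) (at x)"
    using c[of "\<lambda>y. y" "\<lambda>y. y"] c[of "\<lambda>y. y" "\<lambda>y. x"] by (intro tendsto_intros) (auto simp: isCont_def)
  then have lim0: "((\<lambda>y. k y y - 2 * k y x + k x x) \<longlongrightarrow> 0) (at x)" by simp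
  have lim: "((\<lambda>y. sqrt (rkhs_inner k f f * (k y y - 2 * k y x + k x x))) \<longlongrightarrow> 0) (at x)"
    using tendsto_real_sqrt[OF tendsto_mult_left[OF lim0, of "rkhs_inner k f f"]] by simp
  have "((\<lambda>y. f y - f x) \<longlongrightarrow> 0) (at x)"
  proof (rule Lim_null_comparison[OF _ lim])
    show "\<forall>\<^sub>F y in at x. norm (f y - f x) \<le> sqrt (rkhs_inner k f f * (k y y - 2 * k y x + k x x))"
      using rkhs_diff_le[OF f] by (intro always_eventually allI) (simp add: real_le_rsqrt)
  qed
  then show "isCont f x" by (simp add: isCont_def LIM_zero_iff)
qed

section \<open>Kernel ridge regression: setting, regularized inner product and its kernel\<close>

locale krr =
  fixes \<rho> :: "('a::metric_space \<times> real) measure" and \<rho>X :: "'a measure"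
    and K :: "'a \<Rightarrow> 'a \<Rightarrow> real" and lam :: real
  assumes X_compact: "compact (UNIV :: 'a set)"
    and rho_prob: "prob_space \<rho>"
    and rho_borel: "sets \<rho> = sets (borel :: ('a \<times> real) measure)"
    and rhoX_marginal: "\<rho>X = distr \<rho> borel fst"
    and K_mercer: "mercer_kernel K"
    and y_sq: "integrable \<rho> (\<lambda>z. (snd z)\<^sup>2)"
    and lam_pos: "0 < lam"
begin

sublocale K: psd_kernel K using K_mercer by (rule psd_kernel_mercer)
sublocale P: prob_space \<rho> by (rule rho_prob)

lemma borel_XX: "sets (borel \<Otimes>\<^sub>M borel) = sets (borel :: ('a \<times> 'a) measure)"
  using compact_metric_countable_basis[OF X_compact] borel_prod_countable_basis by blast

lemma borel_XR: "sets (borel \<Otimes>\<^sub>M borel) = sets (borel :: ('a \<times> real) measure)"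
proof -
  obtain B :: "real set set" where "countable B" "topological_basis B"
    using ex_countable_basis by auto
  then show ?thesis using compact_metric_countable_basis[OF X_compact] borel_prod_countable_basis by blast
qed

lemma measurable_fst' [measurable]: "fst \<in> \<rho> \<rightarrow>\<^sub>M borel"
  and measurable_snd' [measurable]: "snd \<in> \<rho> \<rightarrow>\<^sub>M borel"
  by (auto simp: measurable_cong_sets[OF rho_borel refl] intro!: borel_measurable_continuous_onI continuous_intros)

sublocale PX: prob_space \<rho>X unfolding rhoX_marginal by (rule P.prob_space_distr) measurable

lemma sets_rhoX [measurable_cong]: "sets \<rho>X = sets borel" by (simp add: rhoX_marginal)
lemma space_rhoX [simp]: "space \<rho>X = UNIV" by (simp add: rhoX_marginal)
lemma space_rho [simp]: "space \<rho> = UNIV" using sets_eq_imp_space_eq[OF rho_borel] by simp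

lemma K_cont: "continuous_on UNIV (\<lambda>z. K (fst z) (snd z))"
  using K_mercer by (simp add: mercer_kernel_def)

lemma K_diag_cont: "continuous_on UNIV (\<lambda>x. K x x)"
  using continuous_on_compose2[OF K_cont, OF continuous_on_Pair[OF continuous_on_id continuous_on_id]] by simp

definition \<kappa> where "\<kappa> = (SUP x. sqrt (K x x))"

lemma kappa: "sqrt (K x x) \<le> \<kappa>"
proof -
  have "compact (range (\<lambda>x. sqrt (K x x)))"
    by (intro compact_continuous_image continuous_intros K_diag_cont X_compact)
  then have "bdd_above (range (\<lambda>x. sqrt (K x x)))" by (intro bounded_imp_bdd_above compact_imp_bounded)
  then show ?thesis unfolding \<kappa>_def by (intro cSUP_upper) auto
qed

lemma kappa_nonneg: "0 \<le> \<kappa>"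
  using kappa[of undefined] K.k_diag_nonneg[of undefined] real_sqrt_ge_zero order_trans by blast

lemma K_le: "K x x \<le> \<kappa>\<^sup>2"
  using kappa[of x] by (simp add: sqrt_le_D)

lemma f_cont: "f \<in> rkhs K \<Longrightarrow> continuous_on UNIV f"
  by (rule psd_kernel_continuous_function[OF K.psd_kernel_axioms K_cont])

lemma f_meas: "f \<in> rkhs K \<Longrightarrow> f \<in> borel_measurable borel"
  by (intro borel_measurable_continuous_onI f_cont)

lemma f_meas_X: "f \<in> rkhs K \<Longrightarrow> f \<in> borel_measurable \<rho>X"
  using f_meas by (simp add: measurable_cong_sets[OF sets_rhoX refl])

lemma f_sq_le: "f \<in> rkhs K \<Longrightarrow> (f x)\<^sup>2 \<le> \<kappa>\<^sup>2 * rkhs_inner K f f"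
  using K.rkhs_eval_le[of f x] K_le[of x] K.H.ip_nonneg[of f]
  by (smt (verit) mult.commute mult_left_mono)

lemma f_abs_le: "f \<in> rkhs K \<Longrightarrow> \<bar>f x\<bar> \<le> \<kappa> * sqrt (rkhs_inner K f f)"
  using real_sqrt_le_mono[OF f_sq_le[of f x]] kappa_nonneg by (simp add: real_sqrt_mult)

lemma integrable_bounded_X:
  assumes "g \<in> borel_measurable \<rho>X" "\<And>x. \<bar>g x\<bar> \<le> C"
  shows "integrable \<rho>X (g :: 'a \<Rightarrow> real)"
  using assms by (intro PX.integrable_const_bound[of _ C]) auto

lemma integrable_prod: "f \<in> rkhs K \<Longrightarrow> g \<in> rkhs K \<Longrightarrow> integrable \<rho>X (\<lambda>x. f x * g x)"
  by (intro integrable_bounded_X[of _ "(\<kappa> * sqrt (rkhs_inner K f f)) * (\<kappa> * sqrt (rkhs_inner K g g))"])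
     (auto intro!: borel_measurable_times[OF f_meas_X f_meas_X] mult_mono f_abs_le simp: abs_mult kappa_nonneg K.H.ip_nonneg)

definition L2 :: "('a \<Rightarrow> real) \<Rightarrow> ('a \<Rightarrow> real) \<Rightarrow> real" where "L2 f g = (\<integral>x. f x * g x \<partial>\<rho>X)"

definition ipl :: "('a \<Rightarrow> real) \<Rightarrow> ('a \<Rightarrow> real) \<Rightarrow> real" where
  "ipl f g = L2 f g + lam * rkhs_inner K f g"

lemma L2_nonneg: "0 \<le> L2 f f" unfolding L2_def by (intro integral_nonneg_AE) auto

lemma L2_le: "f \<in> rkhs K \<Longrightarrow> L2 f f \<le> \<kappa>\<^sup>2 * rkhs_inner K f f"
  unfolding L2_def using f_sq_le[of f] integrable_prod[of f f]
  by (intro PX.integral_le_const) (auto simp: power2_eq_square)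

sublocale L: hilb "rkhs K" ipl
  unfolding ipl_def [abs_def]
proof (rule K.H.hilb_perturb[where M = "\<kappa>\<^sup>2"])
  show "L2 (x + y) z = L2 x z + L2 y z" if "x \<in> rkhs K" "y \<in> rkhs K" "z \<in> rkhs K" for x y z
    using that by (simp add: L2_def algebra_simps integrable_prod)
  show "L2 (c *\<^sub>R x) y = c * L2 x y" if "x \<in> rkhs K" "y \<in> rkhs K" for x y c
    using that by (simp add: L2_def mult.assoc)
qed (auto simp: L2_nonneg L2_le lam_pos, simp add: L2_def mult.commute)

lemma lam_le_ipl: "f \<in> rkhs K \<Longrightarrow> lam * rkhs_inner K f f \<le> ipl f f"
  using L2_nonneg by (simp add: ipl_def)

lemma ex_r: "\<exists>u\<in>rkhs K. \<forall>v\<in>rkhs K. ipl u v = v x"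
proof (rule L.Riesz[where M = "\<kappa>\<^sup>2 / lam"])
  fix v assume v: "v \<in> rkhs K"
  have "(v x)\<^sup>2 \<le> \<kappa>\<^sup>2 * rkhs_inner K v v" by (rule f_sq_le[OF v])
  also have "\<dots> \<le> \<kappa>\<^sup>2 / lam * ipl v v"
    using mult_right_mono[OF lam_le_ipl[OF v], of "\<kappa>\<^sup>2"] lam_pos by (simp add: field_simps)
  finally show "(v x)\<^sup>2 \<le> \<kappa>\<^sup>2 / lam * ipl v v" .
qed (use lam_pos in auto)

text \<open>This is \<open>(L_K + lam I)^{-1} K_x\<close>, equivalently the reproducing kernel of
  the same function space under \<open>ipl\<close>.\<close>

definition r :: "'a \<Rightarrow> 'a \<Rightarrow> real" where
  "r x = (SOME u. u \<in> rkhs K \<and> (\<forall>v\<in>rkhs K. ipl u v = v x))"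

lemma r_in: "r x \<in> rkhs K" and ipl_r: "v \<in> rkhs K \<Longrightarrow> ipl (r x) v = v x"
proof -
  have "r x \<in> rkhs K \<and> (\<forall>v\<in>rkhs K. ipl (r x) v = v x)"
    unfolding r_def by (rule someI_ex[of "\<lambda>u. u \<in> rkhs K \<and> (\<forall>v\<in>rkhs K. ipl u v = v x)"]) (use ex_r in blast)
  then show "r x \<in> rkhs K" "v \<in> rkhs K \<Longrightarrow> ipl (r x) v = v x" by auto
qed

lemma ipl_r': "v \<in> rkhs K \<Longrightarrow> ipl v (r x) = v x"
  using ipl_r r_in by (simp add: L.ip_sym)

lemma r_sym: "r x y = r y x"
  using ipl_r[OF r_in[of x], of y] ipl_r'[OF r_in[of y], of x] by simp

text \<open>Realizes a list of evaluations as an element under \<open>ipl\<close>. Its value at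
  \<open>y\<close> is the pairing with \<open>r y\<close>, whence \<open>gram r l l\<close> is a
  squared norm.\<close>

lemma ex_combination: "\<exists>u\<in>rkhs K. (\<forall>v\<in>rkhs K. ipl u v = pair_list v l) \<and> (\<forall>y. u y = pair_list (r y) l)"
proof (induction l)
  case Nil
  have "\<forall>v\<in>rkhs K. ipl 0 v = pair_list v []"
    unfolding pair_list_simps using L.ip_zero(1) by blast
  moreover have "\<forall>y. (0 :: 'a \<Rightarrow> real) y = pair_list (r y) []" by simp
  ultimately show ?case using L.V_mem(1) by blast
next
  case (Cons p l)
  obtain a x where p: "p = (a, x)" by (cases p)
  obtain u where u: "u \<in> rkhs K" "\<And>v. v \<in> rkhs K \<Longrightarrow> ipl u v = pair_list v l" "\<And>y. u y = pair_list (r y) l"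
    using Cons by blast
  have "\<forall>v\<in>rkhs K. ipl (a *\<^sub>R r x + u) v = pair_list v (p # l)"
    using u(1,2) r_in[of x] ipl_r by (simp add: p L.ip_add L.ip_scale)
  moreover have "\<forall>y. (a *\<^sub>R r x + u) y = pair_list (r y) (p # l)"
    using u(3) r_sym[of x] by (simp add: p)
  ultimately show ?case using u(1) r_in L.V_mem by blast
qed

lemma gram_r: "\<exists>u\<in>rkhs K. gram r l l = ipl u u \<and> (\<forall>v\<in>rkhs K. ipl u v = pair_list v l)"
proof -
  obtain u where u: "u \<in> rkhs K" "\<And>v. v \<in> rkhs K \<Longrightarrow> ipl u v = pair_list v l" "\<And>y. u y = pair_list (r y) l"
    using ex_combination by blast
  have "gram r l l = pair_list u l" unfolding gram_def u(3)[symmetric] ..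
  then show ?thesis using u by (intro bexI[of _ u]) auto
qed

sublocale r: psd_kernel r
proof
  show "r x y = r y x" for x y by (rule r_sym)
  show "0 \<le> gram r l l" for l using gram_r[of l] L.ip_nonneg by auto
qed

lemma rkhs_bound_r: "v \<in> rkhs K \<Longrightarrow> rkhs_bound r v (ipl v v)"
  unfolding rkhs_bound_list
proof
  fix l assume v: "v \<in> rkhs K"
  obtain u where u: "u \<in> rkhs K" "gram r l l = ipl u u" "\<And>v. v \<in> rkhs K \<Longrightarrow> ipl u v = pair_list v l"
    using gram_r[of l] by blast
  then show "(pair_list v l)\<^sup>2 \<le> ipl v v * gram r l l"
    using L.Cauchy_Schwarz[OF u(1) v] v by (simp add: mult.commute)
qed

text \<open>The squared norm of \<open>(L_K + lam I)^{-1/2} K_x\<close>, known as the leverage of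
  the point \<open>x\<close>.\<close>

definition phi :: "'a \<Rightarrow> real" where "phi x = r x x"

lemma phi_nonneg: "0 \<le> phi x" unfolding phi_def by (rule r.k_diag_nonneg)

lemma lam_r_le: "lam * K.H.nsq (r x) \<le> phi x"
  using lam_le_ipl[OF r_in[of x]] ipl_r[OF r_in] by (simp add: phi_def)

text \<open>\<open>phi x\<close> is a value of \<open>r x\<close>, hence at most
  \<open>\<kappa>\<close> times its RKHS norm, whose square is at most \<open>phi x / lam\<close>.
  One factor \<open>phi x\<close> cancels.\<close>

lemma phi_le: "phi x \<le> \<kappa>\<^sup>2 / lam"
proof (cases "phi x = 0")
  case True
  then show ?thesis using lam_pos by simp
next
  case False
  then have pos: "phi x > 0" using phi_nonneg[of x] by simp
  have "lam * (phi x)\<^sup>2 \<le> \<kappa>\<^sup>2 * (lam * K.H.nsq (r x))"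
    using f_sq_le[OF r_in, of x x] lam_pos by (simp add: phi_def)
  also have "\<dots> \<le> \<kappa>\<^sup>2 * phi x" using lam_r_le by (intro mult_left_mono) auto
  finally have "lam * phi x \<le> \<kappa>\<^sup>2" using pos by (simp add: power2_eq_square)
  then show ?thesis using lam_pos by (simp add: field_simps)
qed

text \<open>The squared RKHS distance between \<open>K x\<close> and \<open>K y\<close>.\<close>

definition Kd :: "'a \<Rightarrow> 'a \<Rightarrow> real" where "Kd x y = K x x - 2 * K x y + K y y"

text \<open>For the difference \<open>d\<close> of the two sections, \<open>ipl d d\<close> equals
  \<open>d x - d y\<close>. Bounding the square of this through the norm of \<open>K\<close> brings
  back a multiple of \<open>ipl d d\<close>, which cancels as in \<open>phi_le\<close>.\<close>

lemma r_diff: "r x x - 2 * r x y + r y y \<le> Kd x y / lam"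
proof -
  let ?d = "r x - r y"
  have d: "?d \<in> rkhs K" by (intro K.rkhs_diff r_in)
  have e: "ipl ?d ?d = r x x - 2 * r x y + r y y"
    using r_in ipl_r[OF r_in] by (simp add: L.ip_square_diff r_sym[of y x])
  also have "\<dots> = ?d x - ?d y" by (simp add: r_sym[of y x])
  finally have e2: "ipl ?d ?d = ?d x - ?d y" .
  have "(?d x - ?d y)\<^sup>2 \<le> rkhs_inner K ?d ?d * Kd x y"
    using K.rkhs_diff_le[OF d, of x y] by (simp only: Kd_def)
  then have "lam * (ipl ?d ?d)\<^sup>2 \<le> (lam * rkhs_inner K ?d ?d) * Kd x y"
    unfolding e2[symmetric] using lam_pos by (simp add: mult.assoc)
  also have "\<dots> \<le> ipl ?d ?d * Kd x y"
    using lam_le_ipl[OF d] K.kernel_diff_square[of x y] K.H.ip_nonneg[of "K x - K y"] K.kernel_in_rkhs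
    by (intro mult_right_mono) (auto simp: Kd_def)
  finally have *: "lam * (ipl ?d ?d)\<^sup>2 \<le> ipl ?d ?d * Kd x y" .
  have Kd: "0 \<le> Kd x y"
    using K.kernel_diff_square[of x y] K.H.ip_nonneg[of "K x - K y"] K.kernel_in_rkhs by (auto simp: Kd_def)
  show ?thesis
  proof (cases "ipl ?d ?d = 0")
    case True
    then show ?thesis using e Kd lam_pos by simp
  next
    case False
    then have "ipl ?d ?d > 0" using L.ip_nonneg[OF d] by simp
    then have "lam * ipl ?d ?d \<le> Kd x y" using * by (simp add: power2_eq_square)
    then show ?thesis using lam_pos by (simp add: e field_simps)
  qed
qed

text \<open>One argument is moved at a time: sections of \<open>r\<close> are uniformly bounded in
  \<open>rkhs r\<close>, and \<open>r_diff\<close> compares their differences with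
  \<open>Kd\<close>, which is continuous.\<close>

lemma r_cont: "continuous_on UNIV (\<lambda>z. r (fst z) (snd z))"
  unfolding continuous_on_eq_continuous_at[OF open_UNIV]
proof
  fix z :: "'a \<times> 'a"
  obtain x y where z: "z = (x, y)" by (cases z)
  have c: "isCont (\<lambda>w. K (g w) (h w)) z" if "isCont g z" "isCont h z" for g h :: "'a \<times> 'a \<Rightarrow> 'a"
    using continuous_within_compose2[of z UNIV "\<lambda>y. (g y, h y)" "\<lambda>z. K (fst z) (snd z)"] that K_cont
    by (auto intro!: continuous_Pair simp: continuous_on_eq_continuous_at intro: continuous_within_subset)
  have "isCont (\<lambda>w. Kd (fst w) x) z" "isCont (\<lambda>w. Kd (snd w) y) z"
    unfolding Kd_def by (intro continuous_intros c)+
  then have "isCont (\<lambda>w. sqrt (\<kappa>\<^sup>2 / lam * (Kd (fst w) x / lam)) + sqrt (\<kappa>\<^sup>2 / lam * (Kd (snd w) y / lam))) z"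
    using lam_pos by (intro continuous_intros) auto
  then have lim: "((\<lambda>w. sqrt (\<kappa>\<^sup>2 / lam * (Kd (fst w) x / lam)) + sqrt (\<kappa>\<^sup>2 / lam * (Kd (snd w) y / lam))) \<longlongrightarrow> 0) (at z)"
    by (simp add: isCont_def z Kd_def)
  have *: "\<bar>r a b - r c b\<bar> \<le> sqrt (\<kappa>\<^sup>2 / lam * (Kd a c / lam))" for a b c
  proof -
    have "(r b a - r b c)\<^sup>2 \<le> rkhs_inner r (r b) (r b) * (r a a - 2 * r a c + r c c)"
      by (rule r.rkhs_diff_le[OF r.kernel_in_rkhs])
    also have "\<dots> \<le> \<kappa>\<^sup>2 / lam * (Kd a c / lam)"
    proof (rule mult_mono)
      show "rkhs_inner r (r b) (r b) \<le> \<kappa>\<^sup>2 / lam"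
        using phi_le[of b] by (simp add: r.reproducing r.kernel_in_rkhs phi_def)
      show "0 \<le> r a a - 2 * r a c + r c c"
        using r.kernel_diff_square[of a c] r.H.ip_nonneg[of "r a - r c"] r.kernel_in_rkhs by auto
    qed (use r_diff lam_pos in auto)
    finally show ?thesis using r_sym by (metis real_sqrt_le_mono real_sqrt_abs)
  qed
  have "((\<lambda>w. r (fst w) (snd w) - r x y) \<longlongrightarrow> 0) (at z)"
  proof (rule Lim_null_comparison[OF _ lim], intro always_eventually allI)
    fix w :: "'a \<times> 'a"
    have "\<bar>r (fst w) (snd w) - r x (snd w)\<bar> \<le> sqrt (\<kappa>\<^sup>2 / lam * (Kd (fst w) x / lam))"
      "\<bar>r (snd w) x - r y x\<bar> \<le> sqrt (\<kappa>\<^sup>2 / lam * (Kd (snd w) y / lam))" by (rule *)+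
    then show "norm (r (fst w) (snd w) - r x y) \<le>
        sqrt (\<kappa>\<^sup>2 / lam * (Kd (fst w) x / lam)) + sqrt (\<kappa>\<^sup>2 / lam * (Kd (snd w) y / lam))"
      using r_sym[of x y] r_sym[of x "snd w"] by simp
  qed
  then show "isCont (\<lambda>z. r (fst z) (snd z)) z" by (simp add: isCont_def LIM_zero_iff z)
qed

end

section \<open>Normal equations and the deterministic error bound\<close>

lemma nn_integral_Cauchy_Schwarz_bound:
  assumes [measurable]: "f \<in> borel_measurable M" "g \<in> borel_measurable M"
    and f0: "\<And>x. 0 \<le> f x" and g0: "\<And>x. 0 \<le> g x"
    and A: "(\<integral>\<^sup>+x. ennreal ((f x)\<^sup>2) \<partial>M) \<le> ennreal A"
    and B: "(\<integral>\<^sup>+x. ennreal ((g x)\<^sup>2) \<partial>M) \<le> ennreal B" and A0: "0 \<le> A" and B0: "0 \<le> B"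
  shows "(\<integral>\<^sup>+x. ennreal (f x * g x) \<partial>M) \<le> ennreal (sqrt A * sqrt B)"
proof -
  have "(\<integral>\<^sup>+x. ennreal (f x * g x) \<partial>M)\<^sup>2 = (\<integral>\<^sup>+x. ennreal (f x) * ennreal (g x) \<partial>M)\<^sup>2"
    using f0 g0 by (simp add: ennreal_mult)
  also have "\<dots> \<le> (\<integral>\<^sup>+x. (ennreal (f x))\<^sup>2 \<partial>M) * (\<integral>\<^sup>+x. (ennreal (g x))\<^sup>2 \<partial>M)"
    by (rule Cauchy_Schwarz_nn_integral) measurable
  also have "\<dots> \<le> ennreal A * ennreal B"
    using A B f0 g0 by (intro mult_mono) (simp_all add: ennreal_power)
  also have "\<dots> = (ennreal (sqrt A * sqrt B))\<^sup>2"
    using A0 B0 by (simp add: ennreal_power power_mult_distrib flip: ennreal_mult)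
  finally have le: "(\<integral>\<^sup>+x. ennreal (f x * g x) \<partial>M)\<^sup>2 \<le> (ennreal (sqrt A * sqrt B))\<^sup>2" .
  show ?thesis
  proof (cases "\<integral>\<^sup>+x. ennreal (f x * g x) \<partial>M")
    case (real t)
    then have "t\<^sup>2 \<le> (sqrt A * sqrt B)\<^sup>2" using le A0 B0 by (simp add: ennreal_power)
    then have "t \<le> sqrt A * sqrt B" by (rule power2_le_imp_le) (use A0 B0 in simp)
    then show ?thesis unfolding real(2) by (rule ennreal_leI)
  next
    case top
    then show ?thesis using le A0 B0 by (simp add: ennreal_power top_unique)
  qed
qed

text \<open>In terms of the roots \<open>s\<close> of \<open>a\<close> and \<open>e\<close> of
  \<open>d\<close> the hypothesis reads \<open>s^2 \<le> e^2 + q e s\<close>. It gives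
  \<open>s \<le> e (1 + q)\<close> first, and inserting this once more produces
  \<open>1 + q + q^2\<close>.\<close>

lemma self_bounding:
  fixes a d q :: real
  assumes "0 \<le> a" "0 \<le> d" "0 \<le> q" and le: "a\<^sup>2 \<le> d * a + a * q * sqrt (d * a)"
  shows "a \<le> (1 + q + q\<^sup>2) * d"
proof (cases "a = 0")
  case True
  then show ?thesis using assms by simp
next
  case False
  define s e where "s = sqrt a" and "e = sqrt d"
  have s: "s > 0" "a = s\<^sup>2" and e: "0 \<le> e" "d = e\<^sup>2" using False assms by (auto simp: s_def e_def)
  have "a * a \<le> a * (d + q * sqrt (d * a))" using le by (simp add: power2_eq_square algebra_simps)
  then have "a \<le> d + q * sqrt (d * a)" using False assms by simp
  moreover have "sqrt (d * a) = e * s" by (simp add: s_def e_def real_sqrt_mult)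
  ultimately have 1: "s\<^sup>2 \<le> e\<^sup>2 + q * (e * s)" using s e by simp
  have 2: "s \<le> e * (1 + q)"
  proof (rule ccontr)
    assume "\<not> s \<le> e * (1 + q)"
    then have lt: "e * (1 + q) < s" by simp
    have "e \<le> e * (1 + q)" using e assms by (simp add: algebra_simps)
    then have "e * e \<le> e * s" using lt e by (intro mult_left_mono) auto
    moreover have "e * (1 + q) * s < s * s" using lt s by simp
    ultimately show False using 1 by (simp add: power2_eq_square algebra_simps)
  qed
  have "q * e * s \<le> q * e * (e * (1 + q))" using 2 assms e by (intro mult_left_mono) auto
  then show ?thesis using 1 s e by (simp add: power2_eq_square algebra_simps)
qed

context krr
begin

lemma prob_UNIV [simp]: "P.prob UNIV = 1" "PX.prob UNIV = 1"
  using P.prob_space PX.prob_space by auto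

lemma y_int: "integrable \<rho> snd"
  by (rule P.square_integrable_imp_integrable[OF _ y_sq]) measurable

lemma f_fst_meas [measurable]: "f \<in> rkhs K \<Longrightarrow> (\<lambda>z. f (fst z)) \<in> borel_measurable \<rho>"
  using f_meas measurable_fst' by (rule measurable_compose[rotated])

lemma integrable_bounded_mult:
  assumes "integrable \<rho> g" "h \<in> borel_measurable \<rho>" "\<And>z. \<bar>h z\<bar> \<le> C"
  shows "integrable \<rho> (\<lambda>z. g z * h z :: real)"
proof (rule Bochner_Integration.integrable_bound[of _ "\<lambda>z. C * g z"])
  have "0 \<le> C" using assms(3) abs_ge_zero order_trans by blast
  then have "norm (g z * h z) \<le> norm (C * g z)" for z
    using mult_left_mono[OF assms(3)[of z], of "\<bar>g z\<bar>"] by (simp add: abs_mult mult.commute)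
  then show "AE z in \<rho>. norm (g z * h z) \<le> norm (C * g z)" by simp
qed (use assms in \<open>auto intro!: borel_measurable_times\<close>)

lemma integral_fst: "g \<in> borel_measurable borel \<Longrightarrow> (\<integral>z. g (fst z) \<partial>\<rho>) = (\<integral>x. g x \<partial>\<rho>X :: real)"
  unfolding rhoX_marginal by (rule integral_distr[symmetric]) measurable

lemma integrable_fst: "g \<in> borel_measurable borel \<Longrightarrow> integrable \<rho>X g \<Longrightarrow> integrable \<rho> (\<lambda>z. g (fst z) :: real)"
  unfolding rhoX_marginal by (subst (asm) integrable_distr_eq) measurable

lemma integrable_y_f: "f \<in> rkhs K \<Longrightarrow> integrable \<rho> (\<lambda>z. snd z * f (fst z))"
  by (rule integrable_bounded_mult[OF y_int f_fst_meas], assumption, erule f_abs_le)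

lemma integrable_f_f: "f \<in> rkhs K \<Longrightarrow> g \<in> rkhs K \<Longrightarrow> integrable \<rho> (\<lambda>z. f (fst z) * g (fst z))"
  using integrable_fst[of "\<lambda>x. f x * g x"] integrable_prod f_meas by auto

lemma integral_f_f: "f \<in> rkhs K \<Longrightarrow> g \<in> rkhs K \<Longrightarrow> (\<integral>z. f (fst z) * g (fst z) \<partial>\<rho>) = L2 f g"
  unfolding L2_def using integral_fst[of "\<lambda>x. f x * g x"] f_meas by auto

definition fl :: "'a \<Rightarrow> real" where "fl = f_lambda \<rho> K lam"

lemma fl_in: "fl \<in> rkhs K"
  and fl_eq: "v \<in> rkhs K \<Longrightarrow> ipl fl v = (\<integral>z. snd z * v (fst z) \<partial>\<rho>)"
proof -
  define l where "l g = (\<integral>z. snd z * g (fst z) \<partial>\<rho>)" for g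
  define J where "J g = (\<integral>z. (g (fst z) - snd z)\<^sup>2 \<partial>\<rho>) + lam * (rkhs_norm K g)\<^sup>2" for g
  have add: "l (x + y) = l x + l y" if "x \<in> rkhs K" "y \<in> rkhs K" for x y
    using that by (simp add: l_def algebra_simps integrable_y_f)
  have scale: "l (c *\<^sub>R x) = c * l x" if "x \<in> rkhs K" for c x
  proof -
    have "(\<lambda>z. snd z * (c *\<^sub>R x) (fst z)) = (\<lambda>z. c * (snd z * x (fst z)))" by auto
    then show ?thesis by (simp add: l_def)
  qed
  define E where "E = (\<integral>z. \<bar>snd z\<bar> \<partial>\<rho>)"
  have bdd: "(l x)\<^sup>2 \<le> E\<^sup>2 * \<kappa>\<^sup>2 / lam * ipl x x" if x: "x \<in> rkhs K" for x
  proof -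
    let ?c = "\<kappa> * sqrt (rkhs_inner K x x)"
    have "\<bar>l x\<bar> \<le> (\<integral>z. \<bar>snd z * x (fst z)\<bar> \<partial>\<rho>)" unfolding l_def by (rule integral_abs_bound)
    also have "\<dots> \<le> (\<integral>z. \<bar>snd z\<bar> * ?c \<partial>\<rho>)"
      using x y_int by (intro integral_mono integrable_abs integrable_y_f integrable_mult_left)
        (auto simp: abs_mult intro!: mult_left_mono f_abs_le)
    also have "\<dots> = E * ?c" by (simp add: E_def)
    finally have "\<bar>l x\<bar> \<le> E * ?c" .
    then have "\<bar>l x\<bar>\<^sup>2 \<le> (E * ?c)\<^sup>2" by (intro power_mono) auto
    then have "(l x)\<^sup>2 \<le> E\<^sup>2 * \<kappa>\<^sup>2 * rkhs_inner K x x"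
      using K.H.ip_nonneg[OF x] by (simp add: power_mult_distrib)
    also have "\<dots> \<le> E\<^sup>2 * \<kappa>\<^sup>2 * (ipl x x / lam)"
      using lam_le_ipl[OF x] lam_pos by (intro mult_left_mono) (auto simp: field_simps)
    finally show ?thesis by simp
  qed
  have J: "J g = ipl g g - 2 * l g + (\<integral>z. (snd z)\<^sup>2 \<partial>\<rho>)" if g: "g \<in> rkhs K" for g
  proof -
    have "(\<integral>z. (g (fst z) - snd z)\<^sup>2 \<partial>\<rho>) =
      (\<integral>z. g (fst z) * g (fst z) - 2 * (snd z * g (fst z)) + (snd z)\<^sup>2 \<partial>\<rho>)"
      by (intro Bochner_Integration.integral_cong) (auto simp: power2_eq_square algebra_simps)
    also have "\<dots> = L2 g g - 2 * l g + (\<integral>z. (snd z)\<^sup>2 \<partial>\<rho>)"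
      using g integrable_f_f[OF g g] integrable_y_f[OF g] y_sq by (simp add: integral_f_f l_def)
    finally show ?thesis using g by (simp add: J_def K.rkhs_norm_eq ipl_def)
  qed
  have fl: "fl = (SOME f. f \<in> rkhs K \<and> (\<forall>g\<in>rkhs K. J f \<le> J g))"
    unfolding fl_def f_lambda_def J_def ..
  have M: "0 \<le> E\<^sup>2 * \<kappa>\<^sup>2 / lam" using lam_pos by simp
  show "fl \<in> rkhs K"
    unfolding fl by (rule L.minimizer_eq(1)[where l = l, OF add scale M bdd J])
  show "ipl fl v = (\<integral>z. snd z * v (fst z) \<partial>\<rho>)" if "v \<in> rkhs K"
    unfolding fl l_def[symmetric]
    by (rule L.minimizer_eq(2)[where l = l, OF add scale M bdd J that])
qed

text \<open>Valid for every sample \<open>D\<close> without an exceptional set; the Hilbert space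
  structure in the proof is the empirical one and depends on \<open>D\<close>.\<close>

lemma f_sample_eq:
  fixes D :: "nat \<Rightarrow> 'a \<times> real"
  assumes N: "0 < N"
  shows "f_sample K lam N D \<in> rkhs K" (is "?f \<in> _")
    and "v \<in> rkhs K \<Longrightarrow> (\<Sum>i<N. f_sample K lam N D (fst (D i)) * v (fst (D i))) / real N
        + lam * rkhs_inner K (f_sample K lam N D) v = (\<Sum>i<N. snd (D i) * v (fst (D i))) / real N"
proof -
  define b where "b f g = (\<Sum>i<N. f (fst (D i)) * g (fst (D i))) / real N" for f g
  define l where "l g = (\<Sum>i<N. snd (D i) * g (fst (D i))) / real N" for g
  define J where "J g = (\<Sum>i<N. (g (fst (D i)) - snd (D i))\<^sup>2) / real N + lam * (rkhs_norm K g)\<^sup>2" for g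
  have b_le: "b f f \<le> \<kappa>\<^sup>2 * rkhs_inner K f f" if "f \<in> rkhs K" for f
  proof -
    have "(\<Sum>i<N. f (fst (D i)) * f (fst (D i))) \<le> (\<Sum>i<N. \<kappa>\<^sup>2 * rkhs_inner K f f)"
      using f_sq_le[OF that] by (intro sum_mono) (simp add: power2_eq_square)
    then show ?thesis using N by (simp add: b_def divide_le_eq mult.commute)
  qed
  interpret E: hilb "rkhs K" "\<lambda>x y. b x y + lam * rkhs_inner K x y"
  proof (rule K.H.hilb_perturb[where b = b and M = "\<kappa>\<^sup>2"])
    show "b x x \<le> \<kappa>\<^sup>2 * rkhs_inner K x x" if "x \<in> rkhs K" for x using that by (rule b_le)
    show "0 < lam" by (rule lam_pos)
    show "b (x + y) z = b x z + b y z" for x y z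
      by (simp add: b_def algebra_simps sum.distrib add_divide_distrib)
    show "b (c *\<^sub>R x) y = c * b x y" for c x y
      by (simp add: b_def sum_distrib_left mult.assoc)
    show "b x y = b y x" for x y by (simp add: b_def mult.commute)
    show "0 \<le> b x x" for x by (simp add: b_def sum_nonneg)
  qed
  have add: "l (x + y) = l x + l y" for x y
    by (simp add: l_def algebra_simps sum.distrib add_divide_distrib)
  have scale: "l (c *\<^sub>R x) = c * l x" for c x
    by (simp add: l_def sum_distrib_left mult_ac)
  define E where "E = (\<Sum>i<N. (snd (D i))\<^sup>2) / real N"
  have bdd: "(l x)\<^sup>2 \<le> E * (b x x + lam * rkhs_inner K x x)" if x: "x \<in> rkhs K" for x
  proof -
    have "(l x)\<^sup>2 \<le> (\<Sum>i<N. (snd (D i))\<^sup>2) * (\<Sum>i<N. (x (fst (D i)))\<^sup>2) / (real N)\<^sup>2"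
      unfolding l_def power_divide by (intro divide_right_mono Cauchy_Schwarz_ineq_sum) simp
    also have "\<dots> = E * b x x" by (simp add: E_def b_def power2_eq_square)
    also have "\<dots> \<le> E * (b x x + lam * rkhs_inner K x x)"
      using lam_pos K.H.ip_nonneg[OF x] by (intro mult_left_mono) (auto simp: E_def sum_nonneg)
    finally show ?thesis .
  qed
  have J: "J g = (b g g + lam * rkhs_inner K g g) - 2 * l g + E" if g: "g \<in> rkhs K" for g
  proof -
    have "(\<Sum>i<N. (g (fst (D i)) - snd (D i))\<^sup>2) / real N = b g g - 2 * l g + E"
      unfolding b_def l_def E_def
      by (simp add: sum.distrib sum_subtractf sum_distrib_left add_divide_distrib diff_divide_distrib
          power2_eq_square algebra_simps)
    then show ?thesis using g by (simp add: J_def K.rkhs_norm_eq)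
  qed
  have fs: "f_sample K lam N D = (SOME f. f \<in> rkhs K \<and> (\<forall>g\<in>rkhs K. J f \<le> J g))"
    unfolding f_sample_def J_def ..
  have E0: "0 \<le> E" by (simp add: E_def sum_nonneg)
  show "?f \<in> rkhs K"
    unfolding fs by (rule E.minimizer_eq(1)[where l = l, OF add scale E0 bdd J])
  show "(\<Sum>i<N. ?f (fst (D i)) * v (fst (D i))) / real N
        + lam * rkhs_inner K ?f v = (\<Sum>i<N. snd (D i) * v (fst (D i))) / real N" if "v \<in> rkhs K"
    unfolding fs l_def[symmetric] b_def[symmetric]
    by (rule E.minimizer_eq(2)[where l = l, OF add scale E0 bdd J that])
qed

section \<open>The product kernel and the two families of centred features\<close>

definition h :: "'a \<Rightarrow> 'a \<Rightarrow> real" where "h x y = K x y * r x y"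

sublocale h: psd_kernel h
  unfolding h_def [abs_def] by (rule psd_kernel_product) unfold_locales

lemma h_cont: "continuous_on UNIV (\<lambda>z. h (fst z) (snd z))"
  unfolding h_def by (intro continuous_intros K_cont r_cont)

text \<open>Keeps \<open>phi\<close> on the diagonal, so that second moments see its integral and
  not just its supremum \<open>\<kappa>\<^sup>2 / lam\<close>.\<close>

lemma h_diag: "h x x \<le> \<kappa>\<^sup>2 * phi x"
  unfolding h_def phi_def[symmetric] using K_le phi_nonneg by (intro mult_right_mono)

lemma h_diag_le: "h x x \<le> \<kappa>\<^sup>2 * (\<kappa>\<^sup>2 / lam)"
  using h_diag[of x] mult_left_mono[OF phi_le[of x], of "\<kappa>\<^sup>2"] by simp

lemma h_meas_X: "u \<in> rkhs h \<Longrightarrow> u \<in> borel_measurable \<rho>X"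
  unfolding measurable_cong_sets[OF sets_rhoX refl]
  by (intro borel_measurable_continuous_onI psd_kernel_continuous_function[OF h.psd_kernel_axioms h_cont])

lemma h_sq_le: "u \<in> rkhs h \<Longrightarrow> (u x)\<^sup>2 \<le> \<kappa>\<^sup>2 * (\<kappa>\<^sup>2 / lam) * rkhs_inner h u u"
  using h.rkhs_eval_le[of u x] mult_left_mono[OF h_diag_le[of x] h.H.ip_nonneg[of u]]
  by (simp add: mult.commute)

lemma h_abs_le: "u \<in> rkhs h \<Longrightarrow> \<bar>u x\<bar> \<le> sqrt (\<kappa>\<^sup>2 * (\<kappa>\<^sup>2 / lam) * rkhs_inner h u u)"
  using real_sqrt_le_mono[OF h_sq_le[of u x]] by simp

lemma h_int: "u \<in> rkhs h \<Longrightarrow> integrable \<rho>X u"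
  by (rule integrable_bounded_X[OF h_meas_X h_abs_le])

lemma ex_m2: "\<exists>m\<in>rkhs h. \<forall>u\<in>rkhs h. rkhs_inner h m u = (\<integral>x. u x \<partial>\<rho>X)"
proof (rule h.H.Riesz[where M = "\<kappa>\<^sup>2 * (\<kappa>\<^sup>2 / lam)"])
  show "(\<integral>t. (x + y) t \<partial>\<rho>X) = (\<integral>t. x t \<partial>\<rho>X) + (\<integral>t. y t \<partial>\<rho>X)" if "x \<in> rkhs h" "y \<in> rkhs h" for x y
    using that by (simp add: h_int)
  show "(\<integral>t. (c *\<^sub>R x) t \<partial>\<rho>X) = c * (\<integral>t. x t \<partial>\<rho>X)" for c x by simp
  show "0 \<le> \<kappa>\<^sup>2 * (\<kappa>\<^sup>2 / lam)" using lam_pos by simp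
  fix u assume u: "u \<in> rkhs h"
  let ?c = "sqrt (\<kappa>\<^sup>2 * (\<kappa>\<^sup>2 / lam) * rkhs_inner h u u)"
  have "\<bar>\<integral>t. u t \<partial>\<rho>X\<bar> \<le> (\<integral>t. \<bar>u t\<bar> \<partial>\<rho>X)" by (rule integral_abs_bound)
  also have "\<dots> \<le> ?c"
    using h_int[OF u] h_abs_le[OF u] by (intro PX.integral_le_const) auto
  finally have "\<bar>\<integral>t. u t \<partial>\<rho>X\<bar>\<^sup>2 \<le> ?c\<^sup>2" by (intro power_mono) auto
  then show "(\<integral>t. u t \<partial>\<rho>X)\<^sup>2 \<le> \<kappa>\<^sup>2 * (\<kappa>\<^sup>2 / lam) * rkhs_inner h u u"
    using h.H.ip_nonneg[OF u] lam_pos by simp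
qed

text \<open>The kernel mean embedding of \<open>\<rho>X\<close> for \<open>h\<close>, obtained from
  Riesz in place of a vector-valued integral.\<close>

definition m2 :: "'a \<Rightarrow> real" where
  "m2 = (SOME m. m \<in> rkhs h \<and> (\<forall>u\<in>rkhs h. rkhs_inner h m u = (\<integral>x. u x \<partial>\<rho>X)))"

lemma m2: "m2 \<in> rkhs h" "u \<in> rkhs h \<Longrightarrow> rkhs_inner h m2 u = (\<integral>x. u x \<partial>\<rho>X)"
proof -
  have "m2 \<in> rkhs h \<and> (\<forall>u\<in>rkhs h. rkhs_inner h m2 u = (\<integral>x. u x \<partial>\<rho>X))"
    unfolding m2_def
    by (rule someI_ex[of "\<lambda>m. m \<in> rkhs h \<and> (\<forall>u\<in>rkhs h. rkhs_inner h m u = (\<integral>x. u x \<partial>\<rho>X))"]) (use ex_m2 in blast)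
  then show "m2 \<in> rkhs h" "u \<in> rkhs h \<Longrightarrow> rkhs_inner h m2 u = (\<integral>x. u x \<partial>\<rho>X)" by auto
qed

definition X2 :: "'a \<times> real \<Rightarrow> 'a \<Rightarrow> real" where "X2 z = h (fst z) - m2"

text \<open>The residual of \<open>fl\<close> and not of the regression function: its correlation
  with functions in the RKHS is known from the normal equation.\<close>

definition eta :: "'a \<times> real \<Rightarrow> real" where "eta z = snd z - fl (fst z)"

lemma ex_m1: "\<exists>m\<in>rkhs K. \<forall>v\<in>rkhs K. ipl m v = lam * rkhs_inner K fl v"
proof (rule L.Riesz[where M = "lam * rkhs_inner K fl fl"])
  fix v assume v: "v \<in> rkhs K"
  have "(lam * rkhs_inner K fl v)\<^sup>2 \<le> lam\<^sup>2 * (rkhs_inner K fl fl * rkhs_inner K v v)"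
    unfolding power_mult_distrib using K.H.Cauchy_Schwarz[OF fl_in v] by (intro mult_left_mono) auto
  also have "\<dots> = lam * rkhs_inner K fl fl * (lam * rkhs_inner K v v)" by (simp add: power2_eq_square)
  also have "\<dots> \<le> lam * rkhs_inner K fl fl * ipl v v"
    using lam_le_ipl[OF v] lam_pos K.H.ip_nonneg[OF fl_in] by (intro mult_left_mono) auto
  finally show "(lam * rkhs_inner K fl v)\<^sup>2 \<le> lam * rkhs_inner K fl fl * ipl v v" .
qed (use fl_in lam_pos K.H.ip_nonneg in \<open>auto simp: K.H.ip_add_right K.H.ip_scale_right algebra_simps\<close>)

text \<open>The mean of \<open>eta z\<close> times \<open>r (fst z)\<close>. The normal equation of
  \<open>fl\<close> allows it to be specified without an integral; \<open>eta_f_integral\<close>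
  confirms that it is the mean.\<close>

definition m1 :: "'a \<Rightarrow> real" where
  "m1 = (SOME m. m \<in> rkhs K \<and> (\<forall>v\<in>rkhs K. ipl m v = lam * rkhs_inner K fl v))"

lemma m1: "m1 \<in> rkhs K" "v \<in> rkhs K \<Longrightarrow> ipl m1 v = lam * rkhs_inner K fl v"
proof -
  have "m1 \<in> rkhs K \<and> (\<forall>v\<in>rkhs K. ipl m1 v = lam * rkhs_inner K fl v)"
    unfolding m1_def
    by (rule someI_ex[of "\<lambda>m. m \<in> rkhs K \<and> (\<forall>v\<in>rkhs K. ipl m v = lam * rkhs_inner K fl v)"]) (use ex_m1 in blast)
  then show "m1 \<in> rkhs K" "v \<in> rkhs K \<Longrightarrow> ipl m1 v = lam * rkhs_inner K fl v" by auto
qed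

text \<open>The representer under \<open>ipl\<close> of the functional sending \<open>v\<close> to
  \<open>eta z * v (fst z)\<close>, centred. Its \<open>ipl\<close> norm is thus a dual
  norm.\<close>

definition X1 :: "'a \<times> real \<Rightarrow> 'a \<Rightarrow> real" where "X1 z = eta z *\<^sub>R r (fst z) - m1"

lemma eta_meas [measurable]: "eta \<in> borel_measurable \<rho>"
  unfolding eta_def using f_fst_meas[OF fl_in] by measurable

lemma eta_sq_int: "integrable \<rho> (\<lambda>z. (eta z)\<^sup>2)"
proof -
  have "integrable \<rho> (\<lambda>z. (snd z)\<^sup>2 - 2 * (snd z * fl (fst z)) + fl (fst z) * fl (fst z))"
    using y_sq integrable_y_f[OF fl_in] integrable_f_f[OF fl_in fl_in] by auto
  then show ?thesis by (simp add: eta_def power2_eq_square algebra_simps)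
qed

lemma eta_int: "integrable \<rho> eta"
  by (rule P.square_integrable_imp_integrable[OF eta_meas eta_sq_int])

lemma eta_f_int: "v \<in> rkhs K \<Longrightarrow> integrable \<rho> (\<lambda>z. eta z * v (fst z))"
  by (rule integrable_bounded_mult[OF eta_int f_fst_meas], assumption, erule f_abs_le)

lemma eta_f_integral: "v \<in> rkhs K \<Longrightarrow> (\<integral>z. eta z * v (fst z) \<partial>\<rho>) = ipl m1 v"
proof -
  assume v: "v \<in> rkhs K"
  have "(\<integral>z. eta z * v (fst z) \<partial>\<rho>) = (\<integral>z. snd z * v (fst z) - fl (fst z) * v (fst z) \<partial>\<rho>)"
    by (simp add: eta_def algebra_simps)
  also have "\<dots> = ipl fl v - L2 fl v"
    using v integrable_y_f[OF v] integrable_f_f[OF fl_in v] by (simp add: fl_eq integral_f_f[OF fl_in v])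
  also have "\<dots> = lam * rkhs_inner K fl v" by (simp add: ipl_def)
  finally show ?thesis using v by (simp add: m1)
qed

lemma K_meas_pair:
  assumes "continuous_on UNIV (\<lambda>z. k (fst z) (snd z) :: real)"
  shows "(\<lambda>(z, z'). k (fst z) (fst z')) \<in> borel_measurable (\<rho> \<Otimes>\<^sub>M \<rho>)"
proof -
  have "(\<lambda>z. k (fst z) (snd z)) \<in> borel_measurable (borel \<Otimes>\<^sub>M borel)"
    unfolding measurable_cong_sets[OF borel_XX refl] by (rule borel_measurable_continuous_onI[OF assms])
  moreover have "(\<lambda>(z, z'). (fst z, fst z')) \<in> \<rho> \<Otimes>\<^sub>M \<rho> \<rightarrow>\<^sub>M borel \<Otimes>\<^sub>M borel" by measurable
  ultimately have "(\<lambda>p. k (fst (case p of (z, z') \<Rightarrow> (fst z, fst z'))) (snd (case p of (z, z') \<Rightarrow> (fst z, fst z')))) \<in> borel_measurable (\<rho> \<Otimes>\<^sub>M \<rho>)"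
    by (rule measurable_compose[rotated])
  then show ?thesis by (simp add: case_prod_beta)
qed

lemma X1_ip: "ipl v (X1 z) = eta z * v (fst z) - ipl m1 v" if "v \<in> rkhs K"
  using that r_in m1 by (simp add: X1_def L.ip_diff_right L.ip_scale_right ipl_r' L.ip_sym[of v m1])

lemma X1_in: "X1 z \<in> rkhs K"
  unfolding X1_def using r_in m1 by simp

text \<open>Expressed by point values, so that measurability on pairs follows from continuity of
  \<open>r\<close>.\<close>

lemma X1_gram: "ipl (X1 z) (X1 z') = eta z * eta z' * r (fst z) (fst z') - eta z * m1 (fst z) - eta z' * m1 (fst z') + ipl m1 m1"
proof -
  have "ipl (X1 z) (X1 z') = eta z' * X1 z (fst z') - ipl m1 (X1 z)" by (rule X1_ip[OF X1_in])
  also have "ipl m1 (X1 z) = eta z * m1 (fst z) - ipl m1 m1" by (rule X1_ip[OF m1(1)])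
  also have "X1 z (fst z') = eta z * r (fst z) (fst z') - m1 (fst z')" by (simp add: X1_def)
  finally show ?thesis by (simp add: algebra_simps)
qed

lemma phi_cont: "continuous_on UNIV phi"
  unfolding phi_def [abs_def]
  using continuous_on_compose2[OF r_cont, OF continuous_on_Pair[OF continuous_on_id continuous_on_id]] by simp

lemma phi_meas: "phi \<in> borel_measurable borel"
  by (rule borel_measurable_continuous_onI[OF phi_cont])

lemma phi_meas_X: "phi \<in> borel_measurable \<rho>X"
  using phi_meas by (simp add: measurable_cong_sets[OF sets_rhoX refl])

lemma phi_int: "integrable \<rho>X phi"
  using phi_le phi_nonneg by (intro integrable_bounded_X[OF phi_meas_X]) simp

lemma eta_sq_phi_int: "integrable \<rho> (\<lambda>z. (eta z)\<^sup>2 * phi (fst z))"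
proof (rule integrable_bounded_mult[OF eta_sq_int])
  show "\<bar>phi (fst z)\<bar> \<le> \<kappa>\<^sup>2 / lam" for z using phi_le phi_nonneg by simp
  show "(\<lambda>z. phi (fst z)) \<in> borel_measurable \<rho>" by (rule measurable_compose[OF measurable_fst' phi_meas])
qed

lemma X1_sq: "L.nsq (X1 z) = (eta z)\<^sup>2 * phi (fst z) - 2 * (eta z * m1 (fst z)) + ipl m1 m1"
  by (simp add: X1_gram phi_def power2_eq_square)

sublocale X1: centered_features "rkhs K" ipl \<rho> X1
proof
  show "X1 z \<in> rkhs K" for z by (rule X1_in)
  show "(\<lambda>(z, z'). ipl (X1 z) (X1 z')) \<in> borel_measurable (\<rho> \<Otimes>\<^sub>M \<rho>)"
    unfolding X1_gram using K_meas_pair[OF r_cont] f_fst_meas[OF m1(1)] by measurable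
  show "integrable \<rho> (\<lambda>z. ipl v (X1 z))" if "v \<in> rkhs K" for v
    using that eta_f_int[OF that] by (simp add: X1_ip)
  show "(\<integral>z. ipl v (X1 z) \<partial>\<rho>) = 0" if "v \<in> rkhs K" for v
    using that eta_f_int[OF that] by (simp add: X1_ip eta_f_integral P.prob_space)
  show "integrable \<rho> (\<lambda>z. L.nsq (X1 z))"
    unfolding X1_sq using eta_sq_phi_int eta_f_int[OF m1(1)] by auto
qed

lemma X1_second: "(\<integral>z. L.nsq (X1 z) \<partial>\<rho>) \<le> (\<integral>z. (eta z)\<^sup>2 * phi (fst z) \<partial>\<rho>)"
  unfolding X1_sq using eta_sq_phi_int eta_f_int[OF m1(1)] L.ip_nonneg[OF m1(1)]
  by (simp add: eta_f_integral[OF m1(1)] P.prob_space)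


lemma X2_in: "X2 z \<in> rkhs h"
  unfolding X2_def using h.kernel_in_rkhs m2 by (intro h.rkhs_diff)

lemma X2_ip: "u \<in> rkhs h \<Longrightarrow> rkhs_inner h u (X2 z) = u (fst z) - (\<integral>x. u x \<partial>\<rho>X)"
  using h.kernel_in_rkhs m2 by (simp add: X2_def h.H.ip_diff_right h.reproducing h.H.ip_sym[of u m2])

lemma m2_integral: "(\<integral>x. m2 x \<partial>\<rho>X) = rkhs_inner h m2 m2"
  using m2 by simp

lemma X2_gram: "rkhs_inner h (X2 z) (X2 z') = h (fst z) (fst z') - m2 (fst z) - m2 (fst z') + rkhs_inner h m2 m2"
proof -
  have "rkhs_inner h (X2 z) (X2 z') = rkhs_inner h (h (fst z)) (X2 z') - rkhs_inner h m2 (X2 z')"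
    using h.kernel_in_rkhs m2 X2_in by (simp add: X2_def[of z] h.H.ip_diff)
  also have "rkhs_inner h (h (fst z)) (X2 z') = h (fst z) (fst z') - (\<integral>x. h (fst z) x \<partial>\<rho>X)"
    by (rule X2_ip[OF h.kernel_in_rkhs])
  also have "(\<integral>x. h (fst z) x \<partial>\<rho>X) = m2 (fst z)"
    using m2(2)[OF h.kernel_in_rkhs] h.reproducing[OF m2(1)] by simp
  also have "rkhs_inner h m2 (X2 z') = m2 (fst z') - rkhs_inner h m2 m2"
    using X2_ip[OF m2(1)] m2_integral by simp
  finally show ?thesis by simp
qed

lemma h_diag_meas: "(\<lambda>x. h x x) \<in> borel_measurable borel"
  using continuous_on_compose2[OF h_cont, OF continuous_on_Pair[OF continuous_on_id continuous_on_id]]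
  by (intro borel_measurable_continuous_onI) simp

lemma h_diag_int: "integrable \<rho>X (\<lambda>x. h x x)"
  using h_diag_le h.k_diag_nonneg h_diag_meas
  by (intro integrable_bounded_X) (auto simp: measurable_cong_sets[OF sets_rhoX refl])

lemma h_meas: "u \<in> rkhs h \<Longrightarrow> u \<in> borel_measurable borel"
  using h_meas_X by (simp add: measurable_cong_sets[OF sets_rhoX refl])

lemma h_int_fst: "u \<in> rkhs h \<Longrightarrow> integrable \<rho> (\<lambda>z. u (fst z))"
  by (intro integrable_fst h_meas h_int)

lemma h_fst_meas: "u \<in> rkhs h \<Longrightarrow> (\<lambda>z. u (fst z)) \<in> borel_measurable \<rho>"
  by (rule measurable_compose[OF measurable_fst' h_meas])

sublocale X2: centered_features "rkhs h" "rkhs_inner h" \<rho> X2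
proof
  show "X2 z \<in> rkhs h" for z by (rule X2_in)
  show "(\<lambda>(z, z'). rkhs_inner h (X2 z) (X2 z')) \<in> borel_measurable (\<rho> \<Otimes>\<^sub>M \<rho>)"
    unfolding X2_gram using K_meas_pair[OF h_cont] h_fst_meas[OF m2(1)] by measurable
  show "integrable \<rho> (\<lambda>z. rkhs_inner h v (X2 z))" if "v \<in> rkhs h" for v
    using that h_int_fst[OF that] by (simp add: X2_ip)
  show "(\<integral>z. rkhs_inner h v (X2 z) \<partial>\<rho>) = 0" if "v \<in> rkhs h" for v
    using that h_int_fst[OF that] by (simp add: X2_ip integral_fst[OF h_meas[OF that]])
  show "integrable \<rho> (\<lambda>z. h.H.nsq (X2 z))"
    unfolding X2_gram using integrable_fst[OF h_diag_meas h_diag_int] h_int_fst[OF m2(1)] by auto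
qed

text \<open>The trace of \<open>(L_K + lam I)^{-1} L_K\<close> as an integral; it stands in for the
  effective dimension until \<open>trace_phi_le_eff_dim\<close>.\<close>

definition trace_phi :: real where "trace_phi = (\<integral>x. phi x \<partial>\<rho>X)"

lemma trace_phi_nonneg: "0 \<le> trace_phi"
  unfolding trace_phi_def using phi_nonneg by (intro integral_nonneg_AE) auto

lemma X2_second: "(\<integral>z. h.H.nsq (X2 z) \<partial>\<rho>) \<le> \<kappa>\<^sup>2 * trace_phi"
proof -
  have "(\<integral>z. h.H.nsq (X2 z) \<partial>\<rho>) = (\<integral>x. h x x \<partial>\<rho>X) - rkhs_inner h m2 m2"
    unfolding X2_gram using integrable_fst[OF h_diag_meas h_diag_int] h_int_fst[OF m2(1)]
    by (simp add: integral_fst[OF h_diag_meas] integral_fst[OF h_meas[OF m2(1)]] m2_integral)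
  also have "\<dots> \<le> (\<integral>x. h x x \<partial>\<rho>X)" using h.H.ip_nonneg[OF m2(1)] by simp
  also have "\<dots> \<le> (\<integral>x. \<kappa>\<^sup>2 * phi x \<partial>\<rho>X)"
    using h_diag_int phi_int h_diag by (intro integral_mono) auto
  finally show ?thesis by (simp add: trace_phi_def)
qed

text \<open>The mean of \<open>m2\<close> is its own squared norm, so the pointwise bound of
  \<open>m2\<close> by its norm closes on itself.\<close>

lemma m2_norm_le: "rkhs_inner h m2 m2 \<le> \<kappa>\<^sup>2 * (\<kappa>\<^sup>2 / lam)"
proof (cases "rkhs_inner h m2 m2 = 0")
  case True
  then show ?thesis using lam_pos by simp
next
  case False
  let ?n = "rkhs_inner h m2 m2" and ?c = "\<kappa>\<^sup>2 * (\<kappa>\<^sup>2 / lam)"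
  have pos: "?n > 0" using False h.H.ip_nonneg[OF m2(1)] by simp
  have "m2 x \<le> sqrt (?c * ?n)" for x using h_abs_le[OF m2(1), of x] by simp
  then have "?n \<le> sqrt (?c * ?n)"
    unfolding m2_integral[symmetric] using h_int[OF m2(1)] by (intro PX.integral_le_const) auto
  then have "?n\<^sup>2 \<le> ?c * ?n" using pos lam_pos by (metis less_imp_le real_le_rsqrt real_sqrt_le_iff real_sqrt_unique sqrt_le_D)
  then have "?n * ?n \<le> ?c * ?n" by (simp only: power2_eq_square[of ?n])
  then show ?thesis by (rule mult_right_le_imp_le) (rule pos)
qed

lemma X2_sq_le: "h.H.nsq (X2 z) \<le> 4 * \<kappa> ^ 4 / lam"
proof -
  have "h.H.nsq (X2 z) \<le> 2 * h.H.nsq (h (fst z)) + 2 * rkhs_inner h m2 m2"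
    unfolding X2_def by (rule h.H.ip_square_diff_le[OF h.kernel_in_rkhs m2(1)])
  also have "h.H.nsq (h (fst z)) = h (fst z) (fst z)"
    by (rule h.reproducing[OF h.kernel_in_rkhs])
  finally have "h.H.nsq (X2 z) \<le> 4 * (\<kappa>\<^sup>2 * (\<kappa>\<^sup>2 / lam))"
    using m2_norm_le h_diag_le[of "fst z"] by simp
  then show ?thesis by (simp add: power2_eq_square power4_eq_xxxx mult.assoc)
qed

lemma X2_fourth_int: "integrable \<rho> (\<lambda>z. (h.H.nsq (X2 z))\<^sup>2)"
  unfolding power2_eq_square
  by (rule integrable_bounded_mult[OF X2.X_square_integrable borel_measurable_integrable[OF X2.X_square_integrable], of "4 * \<kappa> ^ 4 / lam"])
     (use X2_sq_le h.H.ip_nonneg[OF X2_in] in simp)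

lemma X2_fourth: "(\<integral>z. (h.H.nsq (X2 z))\<^sup>2 \<partial>\<rho>) \<le> 4 * \<kappa> ^ 4 / lam * (\<kappa>\<^sup>2 * trace_phi)"
proof -
  have "(\<integral>z. (h.H.nsq (X2 z))\<^sup>2 \<partial>\<rho>) \<le> (\<integral>z. 4 * \<kappa> ^ 4 / lam * h.H.nsq (X2 z) \<partial>\<rho>)"
  proof (intro integral_mono X2_fourth_int integrable_mult_right X2.X_square_integrable)
    show "(h.H.nsq (X2 z))\<^sup>2 \<le> 4 * \<kappa> ^ 4 / lam * h.H.nsq (X2 z)" for z
      unfolding power2_eq_square[of "h.H.nsq (X2 z)"]
      by (rule mult_right_mono[OF X2_sq_le h.H.ip_nonneg[OF X2_in]])
  qed
  also have "\<dots> = 4 * \<kappa> ^ 4 / lam * (\<integral>z. h.H.nsq (X2 z) \<partial>\<rho>)" by simp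
  also have "\<dots> \<le> 4 * \<kappa> ^ 4 / lam * (\<kappa>\<^sup>2 * trace_phi)"
    using X2_second lam_pos by (intro mult_left_mono) auto
  finally show ?thesis .
qed

section \<open>The error bound on a fixed sample\<close>

context
  fixes N :: nat
  assumes N_pos: "0 < N"
begin

definition err :: "(nat \<Rightarrow> 'a \<times> real) \<Rightarrow> 'a \<Rightarrow> real" where
  "err D = f_sample K lam N D - fl"

text \<open>\<open>dev1\<close> and \<open>dev2\<close> are the quantities \<open>d\<close> and
  \<open>q\<close> of the overview.\<close>

definition dev1 :: "(nat \<Rightarrow> 'a \<times> real) \<Rightarrow> real" where
  "dev1 D = sqrt (L.nsq (X1.partial_sum N D)) / real N"

definition dev2 :: "(nat \<Rightarrow> 'a \<times> real) \<Rightarrow> real" where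
  "dev2 D = sqrt (h.H.nsq (X2.partial_sum N D) / lam) / real N"

lemma err_in: "err D \<in> rkhs K"
  unfolding err_def using f_sample_eq(1)[OF N_pos] fl_in by (intro K.rkhs_diff)

lemma err_le: "sqrt (L.nsq (err D)) \<le> (1 + dev2 D + (dev2 D)\<^sup>2) * dev1 D"
proof (rule self_bounding)
  let ?g = "err D"
  let ?S1 = "X1.partial_sum N D" and ?S2 = "X2.partial_sum N D"
  let ?n = "rkhs_inner K ?g ?g"
  let ?f = "f_sample K lam N D"
  note g = err_in[of D]
  note S1 = X1.partial_sum_in[of N D] and S2 = X2.partial_sum_in[of N D]
  define a where "a = sqrt (ipl ?g ?g)"
  show "0 \<le> sqrt (ipl ?g ?g)" using L.ip_nonneg[OF g] by simp
  show d1: "0 \<le> dev1 D" using L.ip_nonneg[OF S1] by (simp add: dev1_def)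
  show d2: "0 \<le> dev2 D" using h.H.ip_nonneg[OF S2] lam_pos by (simp add: dev2_def)
  have a2: "a\<^sup>2 = ipl ?g ?g" and a0: "0 \<le> a" using L.ip_nonneg[OF g] by (auto simp: a_def)
  define E where "E = (\<Sum>i<N. (?g (fst (D i)))\<^sup>2) / real N"
  have n0: "0 \<le> ?n" by (rule K.H.ip_nonneg[OF g])
  \<comment> \<open>The two normal equations, tested with the error itself.\<close>
  have T: "E + lam * ?n = ipl ?S1 ?g / real N"
  proof -
    have fs: "?f = ?g + fl" by (simp add: err_def)
    have "(\<Sum>i<N. ?f (fst (D i)) * ?g (fst (D i))) / real N + lam * rkhs_inner K ?f ?g
        = (\<Sum>i<N. snd (D i) * ?g (fst (D i))) / real N"
      by (rule f_sample_eq(2)[OF N_pos g])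
    moreover have "(\<Sum>i<N. ?f (fst (D i)) * ?g (fst (D i))) / real N
        = E + (\<Sum>i<N. fl (fst (D i)) * ?g (fst (D i))) / real N"
    proof -
      have "?f (fst (D i)) * ?g (fst (D i)) = (?g (fst (D i)))\<^sup>2 + fl (fst (D i)) * ?g (fst (D i))" for i
        using fun_cong[OF fs, of "fst (D i)"] by (simp add: power2_eq_square algebra_simps)
      then show ?thesis by (simp add: E_def sum.distrib add_divide_distrib)
    qed
    moreover have "rkhs_inner K ?f ?g = ?n + rkhs_inner K fl ?g"
      by (subst fs) (rule K.H.ip_add[OF g fl_in g])
    moreover have "(\<Sum>i<N. snd (D i) * ?g (fst (D i))) / real N - (\<Sum>i<N. fl (fst (D i)) * ?g (fst (D i))) / real N
        = (\<Sum>i<N. eta (D i) * ?g (fst (D i))) / real N"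
      by (simp add: eta_def left_diff_distrib sum_subtractf diff_divide_distrib)
    moreover have "ipl ?S1 ?g / real N = (\<Sum>i<N. eta (D i) * ?g (fst (D i))) / real N - lam * rkhs_inner K fl ?g"
    proof -
      have "ipl ?S1 ?g = (\<Sum>i<N. ipl (X1 (D i)) ?g)"
        unfolding X1.partial_sum_def by (rule L.ip_sum[OF X1_in g])
      also have "\<dots> = (\<Sum>i<N. eta (D i) * ?g (fst (D i)) - lam * rkhs_inner K fl ?g)"
        using X1_ip[OF g] m1(2)[OF g] L.ip_sym[OF X1_in g] by simp
      finally show ?thesis using N_pos by (simp add: sum_subtractf diff_divide_distrib)
    qed
    ultimately show ?thesis by (simp add: algebra_simps)
  qed
  have Tle: "ipl ?S1 ?g / real N \<le> dev1 D * a"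
    using L.ip_le[OF S1 g] N_pos by (simp add: dev1_def a_def divide_right_mono)
  have lam_n: "lam * ?n \<le> dev1 D * a"
  proof -
    have "0 \<le> E" unfolding E_def by (simp add: sum_nonneg)
    then show ?thesis using T Tle by simp
  qed
  \<comment> \<open>The square is split asymmetrically: one factor is measured in \<open>K\<close>,
    the other in \<open>ipl\<close>.\<close>
  define u where "u x = ?g x * ?g x" for x
  have ub: "rkhs_bound h u (?n * ipl ?g ?g)"
    unfolding h_def [abs_def] u_def [abs_def]
    by (rule rkhs_bound_product[OF K.psd_kernel_axioms r.psd_kernel_axioms K.rkhs_bound_inner[OF g] rkhs_bound_r[OF g] n0])
  then have u: "u \<in> rkhs h" by (rule h.rkhsI)
  have un: "rkhs_inner h u u \<le> ?n * a\<^sup>2"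
    unfolding a2 using ub n0 L.ip_nonneg[OF g] by (intro h.inner_le_of_bound) auto
  \<comment> \<open>Pairing with the centred features evaluates \<open>u\<close> at the sample minus
    its mean, that is, the empirical minus the population form of the error.\<close>
  have "rkhs_inner h u ?S2 = (\<Sum>i<N. u (fst (D i)) - (\<integral>x. u x \<partial>\<rho>X))"
    unfolding X2.partial_sum_def using X2_in u by (subst h.H.ip_sum_right) (auto simp: X2_ip)
  also have "\<dots> = real N * (E - L2 ?g ?g)"
    using N_pos by (simp add: E_def L2_def u_def sum_subtractf power2_eq_square algebra_simps)
  finally have eq: "rkhs_inner h u ?S2 = real N * (E - L2 ?g ?g)" .
  have "real N * (L2 ?g ?g - E) \<le> \<bar>rkhs_inner h u ?S2\<bar>" unfolding eq by (simp add: algebra_simps)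
  also have "\<dots> \<le> sqrt (rkhs_inner h u u) * sqrt (rkhs_inner h ?S2 ?S2)"
    by (rule h.H.abs_ip_le[OF u S2])
  also have "\<dots> \<le> sqrt (?n * a\<^sup>2) * sqrt (rkhs_inner h ?S2 ?S2)"
    using un h.H.ip_nonneg[OF S2] by (intro mult_right_mono real_sqrt_le_mono) auto
  \<comment> \<open>The division by \<open>lam\<close> inside \<open>dev2\<close> is compensated by
    the factor \<open>lam\<close> at \<open>?n\<close>, which is the product that
    \<open>lam_n\<close> controls.\<close>
  also have "\<dots> = real N * (a * dev2 D * sqrt (lam * ?n))"
    using a0 lam_pos N_pos by (simp add: dev2_def real_sqrt_mult real_sqrt_divide)
  also have "\<dots> \<le> real N * (a * dev2 D * sqrt (dev1 D * a))"
    using lam_n a0 d2 by (intro mult_left_mono real_sqrt_le_mono) auto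
  finally have "L2 ?g ?g - E \<le> a * dev2 D * sqrt (dev1 D * a)" using N_pos by simp
  moreover have "a\<^sup>2 = ipl ?S1 ?g / real N + (L2 ?g ?g - E)"
    unfolding a2 T[symmetric] by (simp add: ipl_def)
  ultimately have "a\<^sup>2 \<le> dev1 D * a + a * dev2 D * sqrt (dev1 D * a)" using Tle by simp
  then show "(sqrt (ipl ?g ?g))\<^sup>2 \<le> dev1 D * sqrt (ipl ?g ?g) + sqrt (ipl ?g ?g) * dev2 D * sqrt (dev1 D * sqrt (ipl ?g ?g))"
    unfolding a_def .
qed

end

end

section \<open>Expected deviations\<close>

lemma nn_integral_ennreal_cmult:
  "0 \<le> c \<Longrightarrow> f \<in> borel_measurable M \<Longrightarrow> (\<integral>\<^sup>+x. ennreal (c * f x) \<partial>M) = ennreal c * (\<integral>\<^sup>+x. ennreal (f x) \<partial>M)"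
  by (simp add: ennreal_mult' nn_integral_cmult)

context krr
begin

context
  fixes N :: nat
  assumes N_pos: "0 < N"
begin

text \<open>\<open>1 + M1 + M2\<close> is the final factor in sample size and regularization, with
  \<open>trace_phi\<close> still in place of the effective dimension.\<close>

definition M1 :: real where "M1 = 1 / (real N * lam)\<^sup>2"
definition M2 :: real where "M2 = trace_phi / (real N * lam)"
definition noise :: real where "noise = (\<integral>z. (eta z)\<^sup>2 * phi (fst z) \<partial>\<rho>) / real N"

lemma M_nonneg: "0 \<le> M1" "0 \<le> M2" "0 \<le> noise"
  using trace_phi_nonneg lam_pos phi_nonneg
  by (auto simp: M1_def M2_def noise_def intro!: divide_nonneg_nonneg integral_nonneg_AE)

lemma dev_nonneg: "0 \<le> dev1 N D" "0 \<le> dev2 N D"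
  using L.ip_nonneg[OF X1.partial_sum_in] h.H.ip_nonneg[OF X2.partial_sum_in] lam_pos
  by (auto simp: dev1_def[OF N_pos] dev2_def[OF N_pos])

lemma dev1_sq: "(dev1 N D)\<^sup>2 = 1 / (real N)\<^sup>2 * L.nsq (X1.partial_sum N D)"
  using L.ip_nonneg[OF X1.partial_sum_in] by (simp add: dev1_def[OF N_pos] power_divide)

lemma dev2_sq: "(dev2 N D)\<^sup>2 = 1 / (lam * (real N)\<^sup>2) * h.H.nsq (X2.partial_sum N D)"
  using h.H.ip_nonneg[OF X2.partial_sum_in] lam_pos
  by (simp add: dev2_def[OF N_pos] power_divide mult.commute)

lemma dev_meas [measurable]:
  "dev1 N \<in> borel_measurable (PiM {..<N} (\<lambda>_. \<rho>))" "dev2 N \<in> borel_measurable (PiM {..<N} (\<lambda>_. \<rho>))"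
  using X1.partial_sum_measurable[of N "{..<N}"] X2.partial_sum_measurable[of N "{..<N}"]
  unfolding dev1_def[OF N_pos, abs_def] dev2_def[OF N_pos, abs_def] by measurable

lemma dev1_second: "(\<integral>\<^sup>+D. ennreal ((dev1 N D)\<^sup>2) \<partial>PiM {..<N} (\<lambda>_. \<rho>)) \<le> ennreal noise"
proof -
  have [measurable]: "(\<lambda>D. L.nsq (X1.partial_sum N D)) \<in> borel_measurable (PiM {..<N} (\<lambda>_. \<rho>))"
    by (rule X1.partial_sum_measurable) simp
  have "(\<integral>\<^sup>+D. ennreal ((dev1 N D)\<^sup>2) \<partial>PiM {..<N} (\<lambda>_. \<rho>))
      = ennreal (1 / (real N)\<^sup>2) * (\<integral>\<^sup>+D. ennreal (L.nsq (X1.partial_sum N D)) \<partial>PiM {..<N} (\<lambda>_. \<rho>))"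
    unfolding dev1_sq by (rule nn_integral_ennreal_cmult) (simp, measurable)
  also have "\<dots> = ennreal (1 / (real N)\<^sup>2) * ennreal (real N * (\<integral>z. L.nsq (X1 z) \<partial>\<rho>))"
    by (simp only: X1.second_moment)
  also have "\<dots> \<le> ennreal (1 / (real N)\<^sup>2) * ennreal (real N * (\<integral>z. (eta z)\<^sup>2 * phi (fst z) \<partial>\<rho>))"
    using X1_second by (intro mult_left_mono ennreal_leI) auto
  also have "\<dots> = ennreal (1 / (real N)\<^sup>2 * (real N * (\<integral>z. (eta z)\<^sup>2 * phi (fst z) \<partial>\<rho>)))"
    by (rule ennreal_mult[symmetric]) (auto intro!: mult_nonneg_nonneg integral_nonneg_AE phi_nonneg)
  also have "1 / (real N)\<^sup>2 * (real N * (\<integral>z. (eta z)\<^sup>2 * phi (fst z) \<partial>\<rho>)) = noise"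
    using N_pos by (simp add: noise_def power2_eq_square)
  finally show ?thesis .
qed

lemma dev2_second: "(\<integral>\<^sup>+D. ennreal ((dev2 N D)\<^sup>2) \<partial>PiM {..<N} (\<lambda>_. \<rho>)) \<le> ennreal (\<kappa>\<^sup>2 * M2)"
proof -
  let ?V = "\<lambda>D. h.H.nsq (X2.partial_sum N D)"
  let ?c = "1 / (lam * (real N)\<^sup>2)"
  have [measurable]: "?V \<in> borel_measurable (PiM {..<N} (\<lambda>_. \<rho>))"
    by (rule X2.partial_sum_measurable) simp
  have "(\<integral>\<^sup>+D. ennreal ((dev2 N D)\<^sup>2) \<partial>PiM {..<N} (\<lambda>_. \<rho>))
      = ennreal ?c * (\<integral>\<^sup>+D. ennreal (?V D) \<partial>PiM {..<N} (\<lambda>_. \<rho>))"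
    unfolding dev2_sq by (rule nn_integral_ennreal_cmult) (use lam_pos in simp, measurable)
  also have "\<dots> = ennreal ?c * ennreal (real N * (\<integral>z. h.H.nsq (X2 z) \<partial>\<rho>))"
    by (simp only: X2.second_moment)
  also have "\<dots> \<le> ennreal ?c * ennreal (real N * (\<kappa>\<^sup>2 * trace_phi))"
    using X2_second by (intro mult_left_mono ennreal_leI) auto
  also have "\<dots> = ennreal (?c * (real N * (\<kappa>\<^sup>2 * trace_phi)))"
    using lam_pos trace_phi_nonneg by (intro ennreal_mult[symmetric]) auto
  also have "?c * (real N * (\<kappa>\<^sup>2 * trace_phi)) = \<kappa>\<^sup>2 * M2"
    using N_pos lam_pos by (simp add: M2_def power2_eq_square mult_ac)
  finally show ?thesis .
qed

text \<open>The second summand comes from the fourth moments of single features and is the place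
  where \<open>1 / (N lam)^2\<close> enters the theorem.\<close>

lemma dev2_fourth: "(\<integral>\<^sup>+D. ennreal (((dev2 N D)\<^sup>2)\<^sup>2) \<partial>PiM {..<N} (\<lambda>_. \<rho>))
    \<le> ennreal (4 * \<kappa> ^ 4 * M2\<^sup>2 + 12 * \<kappa> ^ 6 * M1 * M2)"
proof -
  let ?V = "\<lambda>D. h.H.nsq (X2.partial_sum N D)"
  let ?c = "1 / (lam * (real N)\<^sup>2)"
  let ?tau = "\<integral>z. h.H.nsq (X2 z) \<partial>\<rho>" and ?w = "\<integral>z. (h.H.nsq (X2 z))\<^sup>2 \<partial>\<rho>"
  have [measurable]: "?V \<in> borel_measurable (PiM {..<N} (\<lambda>_. \<rho>))"
    by (rule X2.partial_sum_measurable) simp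
  have "(\<integral>\<^sup>+D. ennreal (((dev2 N D)\<^sup>2)\<^sup>2) \<partial>PiM {..<N} (\<lambda>_. \<rho>))
      = ennreal (?c\<^sup>2) * (\<integral>\<^sup>+D. ennreal ((?V D)\<^sup>2) \<partial>PiM {..<N} (\<lambda>_. \<rho>))"
    unfolding dev2_sq power_mult_distrib[of ?c] by (rule nn_integral_ennreal_cmult) (simp, measurable)
  also have "\<dots> \<le> ennreal (?c\<^sup>2) * ennreal (4 * (real N)\<^sup>2 * ?tau\<^sup>2 + 3 * real N * ?w)"
    using X2.fourth_moment[OF X2_fourth_int, of N] by (intro mult_left_mono) auto
  also have "\<dots> \<le> ennreal (?c\<^sup>2) * ennreal (4 * (real N)\<^sup>2 * (\<kappa>\<^sup>2 * trace_phi)\<^sup>2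
      + 3 * real N * (4 * \<kappa> ^ 4 / lam * (\<kappa>\<^sup>2 * trace_phi)))"
    using X2_second X2_fourth h.H.ip_nonneg[OF X2_in]
    by (intro mult_left_mono ennreal_leI add_mono power_mono integral_nonneg_AE) auto
  also have "\<dots> = ennreal (?c\<^sup>2 * (4 * (real N)\<^sup>2 * (\<kappa>\<^sup>2 * trace_phi)\<^sup>2
      + 3 * real N * (4 * \<kappa> ^ 4 / lam * (\<kappa>\<^sup>2 * trace_phi))))"
    using lam_pos trace_phi_nonneg by (intro ennreal_mult[symmetric]) auto
  also have "?c\<^sup>2 * (4 * (real N)\<^sup>2 * (\<kappa>\<^sup>2 * trace_phi)\<^sup>2 + 3 * real N * (4 * \<kappa> ^ 4 / lam * (\<kappa>\<^sup>2 * trace_phi)))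
      = 4 * \<kappa> ^ 4 * M2\<^sup>2 + 12 * \<kappa> ^ 6 * M1 * M2"
    using N_pos lam_pos by (simp add: M1_def M2_def field_simps eval_nat_numeral)
  finally show ?thesis .
qed

text \<open>Both deviations are functions of the same sample; Cauchy-Schwarz separates them in each
  of the three products, and the product with the square of \<open>dev2\<close> is what calls for
  its fourth moment.\<close>

lemma expected_deviation:
  "(\<integral>\<^sup>+D. ennreal ((1 + dev2 N D + (dev2 N D)\<^sup>2) * dev1 N D) \<partial>PiM {..<N} (\<lambda>_. \<rho>))
    \<le> ennreal ((1 + sqrt (\<kappa>\<^sup>2 * M2) + sqrt (4 * \<kappa> ^ 4 * M2\<^sup>2 + 12 * \<kappa> ^ 6 * M1 * M2)) * sqrt noise)"
proof -
  let ?P = "PiM {..<N} (\<lambda>_. \<rho>)"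
  interpret PP: prob_space ?P by (intro prob_space_PiM P.prob_space_axioms)
  let ?B = "4 * \<kappa> ^ 4 * M2\<^sup>2 + 12 * \<kappa> ^ 6 * M1 * M2"
  have "(\<integral>\<^sup>+D. ennreal ((1 + dev2 N D + (dev2 N D)\<^sup>2) * dev1 N D) \<partial>?P)
      \<le> (\<integral>\<^sup>+D. ennreal (1 * dev1 N D) + ennreal (dev2 N D * dev1 N D) + ennreal ((dev2 N D)\<^sup>2 * dev1 N D) \<partial>?P)"
  proof (rule nn_integral_mono)
    fix D
    have "ennreal ((1 + dev2 N D + (dev2 N D)\<^sup>2) * dev1 N D) \<le> ennreal (1 * dev1 N D + dev2 N D * dev1 N D + (dev2 N D)\<^sup>2 * dev1 N D)"
      by (simp add: algebra_simps)
    then show "ennreal ((1 + dev2 N D + (dev2 N D)\<^sup>2) * dev1 N D)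
        \<le> ennreal (1 * dev1 N D) + ennreal (dev2 N D * dev1 N D) + ennreal ((dev2 N D)\<^sup>2 * dev1 N D)"
      using dev_nonneg by (simp add: ennreal_plus)
  qed
  also have "\<dots> = (\<integral>\<^sup>+D. ennreal (1 * dev1 N D) \<partial>?P) + (\<integral>\<^sup>+D. ennreal (dev2 N D * dev1 N D) \<partial>?P)
      + (\<integral>\<^sup>+D. ennreal ((dev2 N D)\<^sup>2 * dev1 N D) \<partial>?P)"
    by (subst nn_integral_add, measurable)+
  also have "\<dots> \<le> ennreal (sqrt 1 * sqrt noise) + ennreal (sqrt (\<kappa>\<^sup>2 * M2) * sqrt noise) + ennreal (sqrt ?B * sqrt noise)"
    using M_nonneg dev_nonneg dev1_second dev2_second dev2_fourth kappa_nonneg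
    by (intro add_mono nn_integral_Cauchy_Schwarz_bound) (auto simp: PP.emeasure_space_1)
  also have "\<dots> = ennreal (sqrt 1 * sqrt noise + sqrt (\<kappa>\<^sup>2 * M2) * sqrt noise + sqrt ?B * sqrt noise)"
    using M_nonneg kappa_nonneg by (simp add: ennreal_plus)
  finally show ?thesis by (simp add: algebra_simps)
qed

end

end

section \<open>Square-integrable functions and a weighted Hoelder inequality\<close>

lemma ip_space_square_integrable:
  "ip_space {f :: 'a \<Rightarrow> real. f \<in> borel_measurable M \<and> integrable M (\<lambda>x. (f x)\<^sup>2)} (\<lambda>f g. \<integral>x. f x * g x \<partial>M)"
proof -
  let ?V = "{f :: 'a \<Rightarrow> real. f \<in> borel_measurable M \<and> integrable M (\<lambda>x. (f x)\<^sup>2)}"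
  have prod: "integrable M (\<lambda>x. f x * g x)" if f: "f \<in> ?V" and g: "g \<in> ?V" for f g
  proof (rule Bochner_Integration.integrable_bound[of _ "\<lambda>x. (f x)\<^sup>2 + (g x)\<^sup>2"])
    have "norm (f x * g x) \<le> norm ((f x)\<^sup>2 + (g x)\<^sup>2)" for x
    proof -
      have "2 * (\<bar>f x\<bar> * \<bar>g x\<bar>) \<le> (f x)\<^sup>2 + (g x)\<^sup>2"
        using zero_le_power2[of "\<bar>f x\<bar> - \<bar>g x\<bar>"] by (simp add: power2_diff)
      moreover have "0 \<le> \<bar>f x\<bar> * \<bar>g x\<bar>" by simp
      ultimately have "\<bar>f x\<bar> * \<bar>g x\<bar> \<le> (f x)\<^sup>2 + (g x)\<^sup>2" by linarith
      then show ?thesis by (simp add: abs_mult)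
    qed
    then show "AE x in M. norm (f x * g x) \<le> norm ((f x)\<^sup>2 + (g x)\<^sup>2)" by simp
  qed (use f g in auto)
  show ?thesis
  proof
    show "subspace ?V" unfolding subspace_def
    proof (intro conjI ballI allI)
      show "(0 :: 'a \<Rightarrow> real) \<in> ?V" by (simp add: zero_fun_def)
    next
      fix f g assume f: "f \<in> ?V" and g: "g \<in> ?V"
      have "integrable M (\<lambda>x. (f x)\<^sup>2 + 2 * (f x * g x) + (g x)\<^sup>2)" using f g prod[OF f g] by auto
      moreover have "(\<lambda>x. f x + g x) \<in> borel_measurable M" using f g by auto
      ultimately show "f + g \<in> ?V" by (simp add: plus_fun_def power2_sum algebra_simps)
    next
      fix c :: real and f assume f: "f \<in> ?V"
      then have "(\<lambda>x. c * f x) \<in> borel_measurable M" "integrable M (\<lambda>x. c\<^sup>2 * (f x)\<^sup>2)" by auto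
      then show "c *\<^sub>R f \<in> ?V" by (simp add: scaleR_fun_def power_mult_distrib)
    qed
  qed (auto simp: algebra_simps prod intro!: integral_nonneg_AE)
qed

lemma Lp_norm_2:
  assumes "integrable M (\<lambda>x. (g x)\<^sup>2)"
  shows "Lp_norm M 2 g = sqrt (\<integral>x. g x * g x \<partial>M)"
proof -
  have "(\<integral>\<^sup>+x. ennreal (\<bar>g x\<bar> powr 2) \<partial>M) = (\<integral>\<^sup>+x. ennreal ((g x)\<^sup>2) \<partial>M)"
    by (simp add: powr_numeral)
  also have "\<dots> = ennreal (\<integral>x. (g x)\<^sup>2 \<partial>M)" using assms by (intro nn_integral_eq_integral) auto
  finally show ?thesis
    by (simp add: Lp_norm_def enn2real_ennreal powr_half_sqrt integral_nonneg_AE power2_eq_square)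
qed

lemma (in ip_space) norm_triangle: "x \<in> V \<Longrightarrow> y \<in> V \<Longrightarrow> sqrt (ip (x + y) (x + y)) \<le> sqrt (ip x x) + sqrt (ip y y)"
proof (rule real_le_lsqrt)
  assume "x \<in> V" "y \<in> V"
  then show "ip (x + y) (x + y) \<le> (sqrt (ip x x) + sqrt (ip y y))\<^sup>2"
    using ip_le[of x y] by (simp add: ip_square_add power2_sum ip_nonneg)
qed (simp_all add: ip_nonneg)

text \<open>Split \<open>v\<close> into its powers \<open>q\<close> and \<open>1 - q\<close> and
  bound only the first by \<open>c\<close>; Hoelder's inequality puts the second into the integral
  \<open>W\<close>. The conditional is there because \<open>0 powr 0\<close> is 0, while the value 1
  is meant.\<close>

lemma Hoelder_bounded_weight:
  assumes "prob_space M" and u: "in_Lp M p u" "\<And>x. 0 \<le> u x" and p: "1 \<le> p"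
    and v: "v \<in> borel_measurable M" "\<And>x. 0 \<le> v x" "\<And>x. v x \<le> c" and vi: "integrable M v"
  defines "q \<equiv> real_of_ereal (inverse p)" and "W \<equiv> \<integral>x. v x \<partial>M"
  shows "(\<integral>\<^sup>+x. ennreal (u x * v x) \<partial>M)
    \<le> ennreal (Lp_norm M p u * c powr q * (if q = 1 then 1 else W powr (1 - q)))"
proof -
  interpret prob_space M by fact
  have um [measurable]: "u \<in> borel_measurable M" using u by (simp add: in_Lp_def)
  note v(1) [measurable]
  have W: "0 \<le> W" unfolding W_def using v by (intro integral_nonneg_AE) auto
  have c: "0 \<le> c" using v order_trans by blast
  consider "p = \<infinity>" | "p = 1" | s where "p = ereal s" "1 < s"
    using p by (cases p) (auto simp: one_ereal_def less_le)
  then show ?thesis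
  proof cases
    case 1
    define E where "E = esssup M (\<lambda>x. ereal \<bar>u x\<bar>)"
    have E: "AE x in M. ereal \<bar>u x\<bar> \<le> E" unfolding E_def by (rule esssup_AE)
    have "E < \<infinity>" using u 1 by (simp add: in_Lp_def E_def)
    moreover have "0 \<le> E"
    proof -
      have "AE x in M. 0 \<le> E" using E by eventually_elim (metis abs_ge_zero ereal_less_eq(5) order_trans)
      then show ?thesis by simp
    qed
    ultimately obtain e where e: "E = ereal e" "0 \<le> e" by (cases E) auto
    have L: "Lp_norm M p u = e" using 1 e by (simp add: Lp_norm_def E_def[symmetric])
    have q: "q = 0" using 1 by (simp add: q_def)
    have "(\<integral>\<^sup>+x. ennreal (u x * v x) \<partial>M) \<le> (\<integral>\<^sup>+x. ennreal (e * v x) \<partial>M)"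
      using E by (intro nn_integral_mono_AE) (auto simp: e intro!: ennreal_leI mult_right_mono v elim!: eventually_mono)
    also have "\<dots> = ennreal (e * W)"
      using v vi e W_def by (subst nn_integral_eq_integral) (auto simp: W_def)
    also have "e * W = Lp_norm M p u * c powr q * (if q = 1 then 1 else W powr (1 - q))"
    \<comment> \<open>Here \<open>c powr 0\<close> would be 0 instead of 1, but then the weight
      vanishes as well.\<close>
    proof (cases "c = 0")
      case True
      then have "v x = 0" for x using v(2)[of x] v(3)[of x] by simp
      then show ?thesis using True by (simp add: W_def)
    next
      case False
      then show ?thesis using L q W c by simp
    qed
    finally show ?thesis by simp
  next
    case 2
    define I where "I = (\<integral>x. u x \<partial>M)"
    have fin: "(\<integral>\<^sup>+x. ennreal (u x) \<partial>M) < \<infinity>" using u 2 by (simp add: in_Lp_def)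
    then have ui: "integrable M u" using u(2) by (intro integrableI_nonneg) auto
    have nn: "(\<integral>\<^sup>+x. ennreal (u x) \<partial>M) = ennreal I" unfolding I_def using ui u(2) by (intro nn_integral_eq_integral) auto
    have I0: "0 \<le> I" unfolding I_def using u(2) by (intro integral_nonneg_AE) auto
    have L: "Lp_norm M p u = I" using 2 nn u(2) I0 by (simp add: Lp_norm_def)
    have q: "q = 1" using 2 by (simp add: q_def one_ereal_def)
    have "(\<integral>\<^sup>+x. ennreal (u x * v x) \<partial>M) \<le> (\<integral>\<^sup>+x. ennreal (c * u x) \<partial>M)"
    proof (intro nn_integral_mono ennreal_leI)
      show "u x * v x \<le> c * u x" for x
        using mult_left_mono[OF v(3)[of x] u(2)[of x]] by (simp add: mult.commute)
    qed
    also have "\<dots> = ennreal (c * I)"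
      using u(2) c ui by (subst nn_integral_eq_integral) (auto simp: I_def)
    finally show ?thesis using L q c by (simp add: mult.commute)
  next
    case (3 s)
    define s' where "s' = s / (s - 1)"
    have s': "1 < s'" "1 / s + 1 / s' = 1" using 3 by (auto simp: s'_def field_simps)
    have q: "q = 1 / s" using 3 by (simp add: q_def inverse_eq_divide)
    have q': "1 - q = 1 / s'" "q \<noteq> 1" using s' 3 q by auto
    define I where "I = (\<integral>x. u x powr s \<partial>M)"
    have fin: "(\<integral>\<^sup>+x. ennreal (u x powr s) \<partial>M) < \<infinity>" using u 3 by (simp add: in_Lp_def)
    then have ui: "integrable M (\<lambda>x. u x powr s)" by (intro integrableI_nonneg) auto
    have nn: "(\<integral>\<^sup>+x. ennreal (u x powr s) \<partial>M) = ennreal I" unfolding I_def using ui by (intro nn_integral_eq_integral) auto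
    have I0: "0 \<le> I" unfolding I_def by (intro integral_nonneg_AE) auto
    define L where "L = I powr (1 / s)"
    have LL: "Lp_norm M p u = L" using 3 nn u(2) I0 by (simp add: Lp_norm_def L_def)
    have split: "v x \<le> c powr q * v x powr (1 - q)" for x
    proof (cases "v x = 0")
      case False
      then have "v x = v x powr q * v x powr (1 - q)" using v(2)[of x] by (simp flip: powr_add)
      also have "\<dots> \<le> c powr q * v x powr (1 - q)"
        using v(2,3)[of x] 3 q by (intro mult_right_mono powr_mono2) auto
      finally show ?thesis .
    qed simp
    \<comment> \<open>Young's inequality is applied to normalized factors, so vanishing norms are
      treated apart.\<close>
    consider "I = 0" | "W = 0" | "0 < I" "0 < W" using I0 W by linarith
    then show ?thesis
    proof cases
      case 1
      then have "AE x in M. u x powr s = 0"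
        using integral_nonneg_eq_0_iff_AE[OF ui] by (simp add: I_def)
      then have "AE x in M. ennreal (u x * v x) = 0" by eventually_elim (auto)
      then have "(\<integral>\<^sup>+x. ennreal (u x * v x) \<partial>M) = 0" by (subst nn_integral_0_iff_AE) auto
      then show ?thesis by simp
    next
      case 2
      then have "AE x in M. v x = 0"
        using integral_nonneg_eq_0_iff_AE[OF vi] v by (simp add: W_def)
      then have "AE x in M. ennreal (u x * v x) = 0" by eventually_elim auto
      then have "(\<integral>\<^sup>+x. ennreal (u x * v x) \<partial>M) = 0" by (subst nn_integral_0_iff_AE) auto
      then show ?thesis by simp
    next
      case 3
      have Lpos: "0 < L" using 3 by (simp add: L_def)
      have Ls: "L powr s = I" using 3 \<open>1 < s\<close> by (simp add: L_def powr_powr)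
      define B where "B = W powr (1 / s')"
      have B: "0 < B" "B powr s' = W" using 3 s' by (auto simp: B_def powr_powr)
      \<comment> \<open>The majorant from Young's inequality; its integral collapses because the
        reciprocals of the conjugate exponents sum to 1.\<close>
      define g where "g x = c powr q * (L * B) * (u x powr s / I / s + v x / W / s')" for x
      have le: "u x * v x \<le> g x" for x
      proof -
        have "(u x / L) * (v x powr (1 / s') / B) \<le> (u x / L) powr s / s + (v x powr (1 / s') / B) powr s' / s'"
          using 3 s' Lpos B u(2) \<open>1 < s\<close> by (intro Youngs_inequality) auto
        also have "(u x / L) powr s = u x powr s / I" using u(2) Lpos Ls by (simp add: powr_divide)
        also have "(v x powr (1 / s') / B) powr s' = v x / W"
          using v(2) B s' by (simp add: powr_divide powr_powr)
        finally have y: "u x * v x powr (1 / s') \<le> L * B * (u x powr s / I / s + v x / W / s')"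
          using Lpos B by (simp add: field_simps)
        have "u x * v x \<le> u x * (c powr q * v x powr (1 - q))" using split u(2) by (intro mult_left_mono)
        also have "\<dots> = c powr q * (u x * v x powr (1 / s'))" by (simp add: q')
        also have "\<dots> \<le> g x" unfolding g_def mult.assoc[of "c powr q"] using y by (intro mult_left_mono) auto
        finally show ?thesis .
      qed
      have gi: "integrable M g" unfolding g_def using ui vi by auto
      have "(\<integral>\<^sup>+x. ennreal (u x * v x) \<partial>M) \<le> (\<integral>\<^sup>+x. ennreal (g x) \<partial>M)"
        using le by (intro nn_integral_mono ennreal_leI)
      also have "\<dots> = ennreal (\<integral>x. g x \<partial>M)"
        using gi le u(2) v(2) by (intro nn_integral_eq_integral) (auto intro!: always_eventually order_trans[OF _ le])
      also have "(\<integral>x. g x \<partial>M) = c powr q * (L * B) * (1 / s + 1 / s')"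
        unfolding g_def using ui vi 3 by (simp add: I_def[symmetric] W_def[symmetric])
      also have "\<dots> = Lp_norm M p u * c powr q * (if q = 1 then 1 else W powr (1 - q))"
        using s' q' by (simp add: LL B_def)
      finally show ?thesis .
    qed
  qed
qed

section \<open>The effective dimension\<close>

context krr
begin

lemma rkhs_onb_iff:
  "rkhs_onb K B \<longleftrightarrow> K.H.orthonormal B \<and>
    (\<forall>f\<in>rkhs K. \<forall>\<epsilon>>0. \<exists>F c. finite F \<and> F \<subseteq> B \<and>
      sqrt (K.H.nsq (f - (\<Sum>e\<in>F. c e *\<^sub>R e))) < \<epsilon>)"
proof -
  have eq: "rkhs_norm K (\<lambda>x. f x - (\<Sum>e\<in>F. c e * e x))
      = sqrt (K.H.nsq (f - (\<Sum>e\<in>F. c e *\<^sub>R e)))"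
    if "B \<subseteq> rkhs K" "f \<in> rkhs K" "F \<subseteq> B" for f F c
  proof -
    have "(\<lambda>x. f x - (\<Sum>e\<in>F. c e * e x)) = f - (\<Sum>e\<in>F. c e *\<^sub>R e)"
      by (rule ext) (simp add: sum_fun_apply)
    moreover have "f - (\<Sum>e\<in>F. c e *\<^sub>R e) \<in> rkhs K"
      using that by (intro K.rkhs_diff K.H.V_sum K.rkhs_scale) auto
    ultimately show ?thesis
      using K.H.ip_nonneg by (simp add: rkhs_norm_def K.rkhs_inner_self K.sqn_def K.dominated_iff)
  qed
  have "(\<forall>f\<in>rkhs K. \<forall>\<epsilon>>0. \<exists>F c. finite F \<and> F \<subseteq> B \<and> rkhs_norm K (\<lambda>x. f x - (\<Sum>e\<in>F. c e * e x)) < \<epsilon>) \<longleftrightarrow>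
    (\<forall>f\<in>rkhs K. \<forall>\<epsilon>>0. \<exists>F c. finite F \<and> F \<subseteq> B \<and>
      sqrt (K.H.nsq (f - (\<Sum>e\<in>F. c e *\<^sub>R e))) < \<epsilon>)"
    if "B \<subseteq> rkhs K"
    by (intro ball_cong refl all_cong iff_exI conj_cong) (simp only: eq[OF that])
  then show ?thesis unfolding rkhs_onb_def K.H.orthonormal_def by blast
qed

lemma ex_rkhs_onb: "\<exists>B. rkhs_onb K B"
proof -
  obtain B where B: "K.H.orthonormal B"
    "\<And>f \<epsilon>. f \<in> rkhs K \<Longrightarrow> 0 < \<epsilon> \<Longrightarrow> \<exists>F. finite F \<and> F \<subseteq> B \<and> K.H.nsq (f - K.H.proj F f) < \<epsilon>"
    using K.H.ex_orthonormal_basis by blast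
  have "\<exists>F c. finite F \<and> F \<subseteq> B \<and>
      sqrt (K.H.nsq (f - (\<Sum>e\<in>F. c e *\<^sub>R e))) < \<epsilon>"
    if f: "f \<in> rkhs K" and e: "0 < \<epsilon>" for f \<epsilon>
  proof -
    obtain F where "finite F" "F \<subseteq> B" "K.H.nsq (f - K.H.proj F f) < \<epsilon>\<^sup>2"
      using B(2)[OF f zero_less_power[OF e, of 2]] by blast
    then show ?thesis using e unfolding K.H.proj_def
      by (intro exI[of _ F] exI[of _ "rkhs_inner K f"]) (auto intro: real_less_lsqrt)
  qed
  then show ?thesis using B(1) by (auto simp: rkhs_onb_iff)
qed

text \<open>\<open>s\<close> is \<open>(L_K + lam I)^{-1} w\<close> in weak form.\<close>

lemma ex_resolvent: "w \<in> rkhs K \<Longrightarrow> \<exists>s\<in>rkhs K. \<forall>v\<in>rkhs K. ipl s v = rkhs_inner K w v"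
proof (rule L.Riesz[where M = "rkhs_inner K w w / lam"])
  assume w: "w \<in> rkhs K"
  show "0 \<le> rkhs_inner K w w / lam" using K.H.ip_nonneg[OF w] lam_pos by simp
  fix v assume v: "v \<in> rkhs K"
  have "(rkhs_inner K w v)\<^sup>2 \<le> rkhs_inner K w w * rkhs_inner K v v" by (rule K.H.Cauchy_Schwarz[OF w v])
  also have "\<dots> \<le> rkhs_inner K w w * (ipl v v / lam)"
    using lam_le_ipl[OF v] lam_pos K.H.ip_nonneg[OF w] by (intro mult_left_mono) (auto simp: field_simps)
  finally show "(rkhs_inner K w v)\<^sup>2 \<le> rkhs_inner K w w / lam * ipl v v" by simp
qed (auto simp: K.H.ip_add_right K.H.ip_scale_right)

lemma ipl_le: "v \<in> rkhs K \<Longrightarrow> ipl v v \<le> (\<kappa>\<^sup>2 + lam) * rkhs_inner K v v"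
  using L2_le[of v] by (simp add: ipl_def algebra_simps)

text \<open>The pointwise equation in \<open>reg_op\<close> amounts to testing with kernel sections.
  Represented in the RKHS, the functional \<open>ipl d\<close> is a function that vanishes at every
  point, hence it is zero on \<open>d\<close> itself.\<close>

lemma ipl_kernel_zero_imp:
  assumes d: "d \<in> rkhs K" and zero: "\<And>t. ipl d (K t) = 0"
  shows "d = 0"
proof -
  have "\<exists>w\<in>rkhs K. \<forall>v\<in>rkhs K. rkhs_inner K w v = ipl d v"
  proof (rule K.H.Riesz[where M = "ipl d d * (\<kappa>\<^sup>2 + lam)"])
    fix v assume v: "v \<in> rkhs K"
    have "(ipl d v)\<^sup>2 \<le> ipl d d * ipl v v" by (rule L.Cauchy_Schwarz[OF d v])
    also have "\<dots> \<le> ipl d d * ((\<kappa>\<^sup>2 + lam) * rkhs_inner K v v)"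
      using ipl_le[OF v] L.ip_nonneg[OF d] by (intro mult_left_mono)
    finally show "(ipl d v)\<^sup>2 \<le> ipl d d * (\<kappa>\<^sup>2 + lam) * rkhs_inner K v v" by (simp add: mult.assoc)
  qed (use d L.ip_nonneg[OF d] lam_pos in \<open>auto simp: L.ip_add_right L.ip_scale_right\<close>)
  then obtain w where w: "w \<in> rkhs K" "\<And>v. v \<in> rkhs K \<Longrightarrow> rkhs_inner K w v = ipl d v" by blast
  have "w = 0"
  proof
    show "w t = 0 t" for t
      using w(2)[OF K.kernel_in_rkhs, of t] zero[of t] K.reproducing[OF w(1), of t] by simp
  qed
  then have "ipl d d = 0" using w(2)[OF d] d by (simp del: zero_fun_apply)
  then have "rkhs_inner K d d = 0"
    using lam_le_ipl[OF d] K.H.ip_nonneg[OF d] lam_pos by (simp add: mult_le_0_iff)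
  then show ?thesis by (rule K.rkhs_inner_zero_imp[OF d])
qed

lemma int_op_eq: "int_op \<rho>X K g t = L2 g (K t)"
  unfolding int_op_def L2_def by (simp add: mult.commute)

text \<open>The identity \<open>(L + lam)^{-1} L = I - lam (L + lam)^{-1}\<close>;
  \<open>ipl_kernel_zero_imp\<close> supplies the uniqueness demanded by \<open>THE\<close>.\<close>

lemma reg_op_eq:
  assumes g: "g \<in> rkhs K" and s: "s \<in> rkhs K" "\<And>v. v \<in> rkhs K \<Longrightarrow> ipl s v = rkhs_inner K g v"
  shows "reg_op \<rho>X K lam g = g - lam *\<^sub>R s"
  unfolding reg_op_def
proof (rule the_equality)
  let ?u = "g - lam *\<^sub>R s"
  have u: "?u \<in> rkhs K" using g s by simp
  have ul: "ipl ?u v = L2 g v" if v: "v \<in> rkhs K" for v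
    using g s v by (simp add: L.ip_diff L.ip_scale) (simp add: ipl_def)
  have expand: "int_op \<rho>X K f t + lam * f t = ipl f (K t)" if "f \<in> rkhs K" for f t
    using that by (simp add: ipl_def int_op_eq K.reproducing)
  show "?u \<in> rkhs K \<and> (\<forall>t. int_op \<rho>X K ?u t + lam * ?u t = int_op \<rho>X K g t)"
    using u expand[OF u] ul[OF K.kernel_in_rkhs] int_op_eq by metis
  fix f assume "f \<in> rkhs K \<and> (\<forall>t. int_op \<rho>X K f t + lam * f t = int_op \<rho>X K g t)"
  then have f: "f \<in> rkhs K" and "\<And>t. ipl f (K t) = ipl ?u (K t)"
    using expand ul[OF K.kernel_in_rkhs] int_op_eq by metis+
  then have "ipl (f - ?u) (K t) = 0" for t
    using L.ip_diff[OF f u K.kernel_in_rkhs] by simp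
  then have "f - ?u = 0" by (rule ipl_kernel_zero_imp[OF K.rkhs_diff[OF f u]])
  then show "f = ?u" by (simp only: right_minus_eq)
qed

text \<open>With \<open>s = (L + lam)^{-1} e\<close> the operator sends \<open>e\<close> to
  \<open>L s\<close>, so the diagonal entry is the integral of \<open>e\<close> times
  \<open>s\<close>. Writing both as inner products with \<open>K x\<close> and \<open>r x\<close>
  lets a sum over basis elements reassemble a projection of \<open>K x\<close>.\<close>

lemma reg_op_inner:
  assumes e: "e \<in> rkhs K"
  shows "0 \<le> rkhs_inner K (reg_op \<rho>X K lam e) e"
    and "rkhs_inner K (reg_op \<rho>X K lam e) e = (\<integral>x. rkhs_inner K (K x) e * rkhs_inner K e (r x) \<partial>\<rho>X)"
    and "integrable \<rho>X (\<lambda>x. rkhs_inner K (K x) e * rkhs_inner K e (r x))"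
proof -
  obtain s where s: "s \<in> rkhs K" "\<And>v. v \<in> rkhs K \<Longrightarrow> ipl s v = rkhs_inner K e v"
    using ex_resolvent[OF e] by blast
  define u where "u = e - lam *\<^sub>R s"
  have u: "u \<in> rkhs K" and eu: "e = u + lam *\<^sub>R s" using e s by (auto simp: u_def)
  have op: "reg_op \<rho>X K lam e = u" unfolding u_def by (rule reg_op_eq[OF e s])
  have ls: "L2 s v = rkhs_inner K u v" if v: "v \<in> rkhs K" for v
    using s(2)[OF v] e s(1) v by (simp add: u_def ipl_def K.H.ip_diff K.H.ip_scale)
  have "rkhs_inner K u e = rkhs_inner K u u + lam * L2 s s"
    using u s ls[OF s(1)] by (subst eu) (simp add: K.H.ip_add_right K.H.ip_scale_right)
  then show "0 \<le> rkhs_inner K (reg_op \<rho>X K lam e) e"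
    unfolding op using L2_nonneg[of s] K.H.ip_nonneg[OF u] lam_pos by simp
  have sx: "s x = rkhs_inner K e (r x)" for x
    using s(2)[OF r_in, of x] ipl_r'[OF s(1), of x] by simp
  have ex: "e x = rkhs_inner K (K x) e" for x using K.reproducing'[OF e] by simp
  have "rkhs_inner K u e = L2 s e" using ls[OF e] by simp
  also have "\<dots> = (\<integral>x. e x * s x \<partial>\<rho>X)" by (simp add: L2_def mult.commute)
  also have "\<dots> = (\<integral>x. rkhs_inner K (K x) e * rkhs_inner K e (r x) \<partial>\<rho>X)"
    by (intro Bochner_Integration.integral_cong refl) (simp only: sx ex)
  finally show "rkhs_inner K (reg_op \<rho>X K lam e) e = (\<integral>x. rkhs_inner K (K x) e * rkhs_inner K e (r x) \<partial>\<rho>X)"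
    unfolding op .
  have "(\<lambda>x. rkhs_inner K (K x) e * rkhs_inner K e (r x)) = (\<lambda>x. e x * s x)"
    by (rule ext) (simp only: sx ex)
  then show "integrable \<rho>X (\<lambda>x. rkhs_inner K (K x) e * rkhs_inner K e (r x))"
    using integrable_prod[OF e s(1)] by simp
qed

lemma finite_trace:
  assumes F: "F \<subseteq> rkhs K" "finite F"
  shows "(\<Sum>e\<in>F. rkhs_inner K (reg_op \<rho>X K lam e) e) = (\<integral>x. rkhs_inner K (K.H.proj F (K x)) (r x) \<partial>\<rho>X)"
    and "integrable \<rho>X (\<lambda>x. rkhs_inner K (K.H.proj F (K x)) (r x))"
proof -
  have eq: "rkhs_inner K (K.H.proj F (K x)) (r x) = (\<Sum>e\<in>F. rkhs_inner K (K x) e * rkhs_inner K e (r x))" for x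
    by (rule K.H.ip_proj[OF F(1) r_in])
  show "(\<Sum>e\<in>F. rkhs_inner K (reg_op \<rho>X K lam e) e) = (\<integral>x. rkhs_inner K (K.H.proj F (K x)) (r x) \<partial>\<rho>X)"
    unfolding eq using F reg_op_inner by (subst Bochner_Integration.integral_sum) (auto intro!: sum.cong)
  show "integrable \<rho>X (\<lambda>x. rkhs_inner K (K.H.proj F (K x)) (r x))"
    unfolding eq using F reg_op_inner(3) by (intro Bochner_Integration.integrable_sum) auto
qed

lemma r_norm_le: "sqrt (K.H.nsq (r x)) \<le> \<kappa> / lam"
proof (rule real_le_lsqrt)
  have "lam * K.H.nsq (r x) \<le> \<kappa>\<^sup>2 / lam" using lam_r_le[of x] phi_le[of x] by simp
  then show "K.H.nsq (r x) \<le> (\<kappa> / lam)\<^sup>2"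
    using lam_pos by (simp add: power_divide power2_eq_square field_simps)
qed (use kappa_nonneg lam_pos in simp)

abbreviation residual where "residual F x \<equiv> K.H.nsq (K x - K.H.proj F (K x))"

text \<open>\<open>phi x\<close> is the inner product of \<open>K x\<close> with \<open>r x\<close>,
  so the error is that of replacing \<open>K x\<close> by \<open>K.H.proj F (K x)\<close>, tested
  against \<open>r x\<close>.\<close>

lemma phi_minus_proj:
  assumes F: "F \<subseteq> rkhs K"
  shows "\<bar>phi x - rkhs_inner K (K.H.proj F (K x)) (r x)\<bar>
    \<le> sqrt (residual F x) * (\<kappa> / lam)"
proof -
  have p: "K.H.proj F (K x) \<in> rkhs K" by (rule K.H.proj_in[OF F])
  have "phi x = rkhs_inner K (K x) (r x)" by (simp add: phi_def K.reproducing' r_in)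
  then have "phi x - rkhs_inner K (K.H.proj F (K x)) (r x) = rkhs_inner K (K x - K.H.proj F (K x)) (r x)"
    using K.H.ip_diff[OF K.kernel_in_rkhs p r_in] by simp
  then have "\<bar>phi x - rkhs_inner K (K.H.proj F (K x)) (r x)\<bar>
      \<le> sqrt (residual F x) * sqrt (K.H.nsq (r x))"
    using K.H.abs_ip_le[OF K.rkhs_diff[OF K.kernel_in_rkhs p] r_in] by simp
  also have "\<dots> \<le> sqrt (residual F x) * (\<kappa> / lam)"
    using r_norm_le K.H.ip_nonneg[OF K.rkhs_diff[OF K.kernel_in_rkhs p]] by (intro mult_left_mono) auto
  finally show ?thesis .
qed

text \<open>Compactness makes a single finite part of the basis good for all \<open>K x\<close> at once, which replaces
  Mercer's theorem in the computation of the trace.\<close>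
lemma uniform_projection:
  assumes onb: "rkhs_onb K B" and \<epsilon>: "0 < \<epsilon>"
  shows "\<exists>F. finite F \<and> F \<subseteq> B \<and> (\<forall>x. residual F x < \<epsilon>)"
proof -
  have B: "K.H.orthonormal B" using onb by (simp add: rkhs_onb_iff)
  have "\<exists>F. finite F \<and> F \<subseteq> B \<and> residual F x < \<epsilon> / 4" for x
  proof -
    have pos: "0 < sqrt (\<epsilon> / 4)" using \<epsilon> by simp
    obtain F c where F: "finite F" "F \<subseteq> B"
      and lt: "sqrt (K.H.nsq (K x - (\<Sum>e\<in>F. c e *\<^sub>R e))) < sqrt (\<epsilon> / 4)"
      using onb[unfolded rkhs_onb_iff, THEN conjunct2, rule_format, OF K.kernel_in_rkhs pos] by blast
    have "residual F x < \<epsilon> / 4"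
      using lt K.H.proj_best[OF B F K.kernel_in_rkhs subset_refl, of x c] by simp
    then show ?thesis using F by blast
  qed
  then obtain F where F: "\<And>x. finite (F x)" "\<And>x. F x \<subseteq> B"
    "\<And>x. residual (F x) x < \<epsilon> / 4"
    by metis
  \<comment> \<open>A finite part that serves \<open>x\<close> serves all of \<open>U x\<close>: the
    doubling in \<open>ip_square_diff_le\<close> turns two errors below
    \<open>\<epsilon> / 4\<close> into less than \<open>\<epsilon>\<close>.\<close>
  define U where "U x = {y. Kd y x < \<epsilon> / 4}" for x
  have openU: "open (U x)" for x
  proof -
    have "continuous_on UNIV (\<lambda>y. K y x)"
      using continuous_on_compose2[OF K_cont, OF continuous_on_Pair[OF continuous_on_id continuous_on_const]] by simp
    then have "continuous_on UNIV (\<lambda>y. Kd y x)"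
      unfolding Kd_def by (intro continuous_intros K_diag_cont)
    then show ?thesis unfolding U_def by (intro open_Collect_less continuous_on_const)
  qed
  have cover: "UNIV \<subseteq> (\<Union>x\<in>UNIV. U x)" using \<epsilon> by (auto simp: U_def Kd_def)
  obtain T where T: "finite T" "UNIV \<subseteq> (\<Union>x\<in>T. U x)"
    by (rule compactE_image[OF X_compact openU cover])
  define G where "G = (\<Union>x\<in>T. F x)"
  have G: "finite G" "G \<subseteq> B" using T F by (auto simp: G_def)
  have "residual G y < \<epsilon>" for y
  proof -
    obtain x where x: "x \<in> T" "y \<in> U x" using T by blast
    define w where "w = K.H.proj (F x) (K x)"
    have w: "w \<in> rkhs K" unfolding w_def
      using F(2)[of x] B by (intro K.H.proj_in) (auto simp: K.H.orthonormal_def)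
    have FG: "F x \<subseteq> G" using x by (auto simp: G_def)
    have 1: "residual G y \<le> K.H.nsq (K y - w)"
      unfolding w_def K.H.proj_def[of "F x"] by (rule K.H.proj_best[OF B G K.kernel_in_rkhs FG])
    have 2: "K y - w = (K y - K x) - (w - K x)" by simp
    have 3: "K.H.nsq ((K y - K x) - (w - K x))
        \<le> 2 * K.H.nsq (K y - K x) + 2 * K.H.nsq (w - K x)"
      using w K.kernel_in_rkhs by (intro K.H.ip_square_diff_le K.rkhs_diff)
    have 4: "K.H.nsq (w - K x) = K.H.nsq (K x - w)"
      using K.H.ip_sym[OF w K.kernel_in_rkhs, of x]
      by (simp add: K.H.ip_square_diff[OF w K.kernel_in_rkhs] K.H.ip_square_diff[OF K.kernel_in_rkhs w])
    have 5: "K.H.nsq (K y - K x) = Kd y x" by (simp only: K.kernel_diff_square Kd_def)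
    have "Kd y x < \<epsilon> / 4" using x by (simp add: U_def)
    moreover have "K.H.nsq (K x - w) < \<epsilon> / 4" unfolding w_def by (rule F(3))
    ultimately show ?thesis using 1 3 unfolding 2[symmetric] 4 5 by linarith
  qed
  then show ?thesis using G by blast
qed

text \<open>Finite parts of the trace approximate the integral of \<open>phi\<close>, uniformly in
  \<open>x\<close> under the integral; since the diagonal entries are nonnegative, each finite part
  is a lower bound for the whole sum.\<close>

lemma trace_phi_le_eff_dim: "trace_phi \<le> eff_dim \<rho>X K lam"
proof -
  define B where "B = (SOME B. rkhs_onb K B)"
  have onb: "rkhs_onb K B" unfolding B_def using ex_rkhs_onb by (rule someI_ex)
  have B: "K.H.orthonormal B" and BV: "B \<subseteq> rkhs K" using onb by (auto simp: rkhs_onb_iff K.H.orthonormal_def)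
  define a where "a e = rkhs_inner K (reg_op \<rho>X K lam e) e" for e
  have a0: "0 \<le> a e" if "e \<in> B" for e unfolding a_def using that BV by (intro reg_op_inner) auto
  \<comment> \<open>Summability has to be secured, because \<open>infsum\<close> of a non-summable
    family is 0.\<close>
  have bound: "sum a F \<le> \<kappa>\<^sup>2 / lam + \<kappa> * (\<kappa> / lam)" if F: "finite F" "F \<subseteq> B" for F
  proof -
    have FV: "F \<subseteq> rkhs K" using F BV by auto
    have "sum a F = (\<integral>x. rkhs_inner K (K.H.proj F (K x)) (r x) \<partial>\<rho>X)"
      unfolding a_def using finite_trace(1)[OF FV F(1)] .
    also have "\<dots> \<le> \<kappa>\<^sup>2 / lam + \<kappa> * (\<kappa> / lam)"
    proof (intro PX.integral_le_const finite_trace(2)[OF FV F(1)] always_eventually allI)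
      fix x
      have "0 \<le> (\<Sum>e\<in>F. (rkhs_inner K (K x) e)\<^sup>2)" by (intro sum_nonneg) simp
      then have "residual F x \<le> K x x"
        using K.H.residual_square[OF B F K.kernel_in_rkhs, of x] K.reproducing[OF K.kernel_in_rkhs, of x x] by simp
      then have "sqrt (residual F x) \<le> \<kappa>"
        using kappa[of x] real_sqrt_le_mono order_trans by blast
      then have "sqrt (residual F x) * (\<kappa> / lam) \<le> \<kappa> * (\<kappa> / lam)"
        using kappa_nonneg lam_pos by (intro mult_right_mono) auto
      then show "rkhs_inner K (K.H.proj F (K x)) (r x) \<le> \<kappa>\<^sup>2 / lam + \<kappa> * (\<kappa> / lam)"
        using phi_minus_proj[OF FV, of x] phi_le[of x] by linarith
    qed
    finally show ?thesis .
  qed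
  have summable: "a summable_on B"
    using a0 bound
    by (intro nonneg_bdd_above_summable_on bdd_aboveI[of _ "\<kappa>\<^sup>2 / lam + \<kappa> * (\<kappa> / lam)"]) auto
  have "trace_phi \<le> infsum a B + e" if e: "0 < e" for e
  proof -
    \<comment> \<open>Chosen so that the root of the residual times \<open>\<kappa> / lam\<close>
      stays below \<open>e\<close>; adding 1 avoids division by zero when
      \<open>\<kappa> = 0\<close>.\<close>
    define \<epsilon> where "\<epsilon> = (e / (\<kappa> / lam + 1))\<^sup>2"
    have pos: "0 < \<kappa> / lam + 1" using kappa_nonneg lam_pos by (simp add: add_nonneg_pos)
    have "0 < \<epsilon>" unfolding \<epsilon>_def using e pos by simp
    then obtain F where F: "finite F" "F \<subseteq> B"
      "\<And>x. residual F x < \<epsilon>"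
      using uniform_projection[OF onb] by blast
    have FV: "F \<subseteq> rkhs K" using F BV by auto
    have "phi x \<le> rkhs_inner K (K.H.proj F (K x)) (r x) + e" for x
    proof -
      have "sqrt (residual F x) \<le> e / (\<kappa> / lam + 1)"
        using F(3)[of x] e pos unfolding \<epsilon>_def by (intro real_le_lsqrt) auto
      then have "sqrt (residual F x) * (\<kappa> / lam)
          \<le> e / (\<kappa> / lam + 1) * (\<kappa> / lam + 1)"
        using e pos kappa_nonneg lam_pos by (intro mult_mono) auto
      also have "\<dots> = e" using pos by simp
      finally show ?thesis using phi_minus_proj[OF FV, of x] by linarith
    qed
    then have "trace_phi \<le> (\<integral>x. rkhs_inner K (K.H.proj F (K x)) (r x) + e \<partial>\<rho>X)"
      unfolding trace_phi_def using phi_int finite_trace(2)[OF FV F(1)] by (intro integral_mono) auto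
    also have "\<dots> = sum a F + e"
      using finite_trace[OF FV F(1)] by (simp add: a_def)
    also have "sum a F \<le> infsum a B"
      using summable F a0 by (intro finite_sum_le_infsum) auto
    finally show ?thesis by simp
  qed
  then have "trace_phi \<le> infsum a B" by (rule field_le_epsilon)
  then show ?thesis unfolding eff_dim_def rkhs_trace_def B_def[symmetric] a_def[symmetric] .
qed

end

section \<open>Noise and bias\<close>

text \<open>Rectangles generate the product sets and are stable under intersection, so the rectangle
  formula identifies \<open>\<rho>\<close> with the composition of \<open>\<rho>X\<close> and the
  kernel \<open>k\<close>; integrals over a composition are iterated.\<close>

lemma nn_integral_disintegrate:
  fixes \<rho> :: "('a::topological_space \<times> real) measure" and \<rho>X :: "'a measure" and c :: "'a \<Rightarrow> real measure"
  assumes \<rho>: "prob_space \<rho>" "sets \<rho> = sets (borel \<Otimes>\<^sub>M borel)" and \<rho>X: "sets \<rho>X = sets borel"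
    and c: "\<And>x. prob_space (c x)" "\<And>x. sets (c x) = sets borel"
    and c_meas: "\<And>B. B \<in> sets borel \<Longrightarrow> (\<lambda>x. emeasure (c x) B) \<in> borel_measurable borel"
    and disint: "\<And>A B. A \<in> sets borel \<Longrightarrow> B \<in> sets borel \<Longrightarrow>
      emeasure \<rho> (A \<times> B) = (\<integral>\<^sup>+x\<in>A. emeasure (c x) B \<partial>\<rho>X)"
    and F: "case_prod F \<in> borel_measurable (borel \<Otimes>\<^sub>M borel)"
  shows "(\<integral>\<^sup>+z. F (fst z) (snd z) \<partial>\<rho>) = (\<integral>\<^sup>+x. (\<integral>\<^sup>+y. F x y \<partial>c x) \<partial>\<rho>X)"
proof -
  have c_kernel: "c \<in> \<rho>X \<rightarrow>\<^sub>M subprob_algebra borel"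
    unfolding measurable_cong_sets[OF \<rho>X refl]
    by (rule measurable_subprob_algebra) (auto simp: c c_meas prob_space_imp_subprob_space)
  have space: "space \<rho>X = UNIV" using sets_eq_imp_space_eq[OF \<rho>X] by simp
  define k where "k x = distr (c x) (borel \<Otimes>\<^sub>M borel) (Pair x)" for x
  have k: "k \<in> \<rho>X \<rightarrow>\<^sub>M subprob_algebra (borel \<Otimes>\<^sub>M borel)"
    unfolding k_def
  proof (rule measurable_distr2[OF _ c_kernel])
    have "sets (\<rho>X \<Otimes>\<^sub>M (borel :: real measure)) = sets (borel \<Otimes>\<^sub>M borel)"
      by (intro sets_pair_measure_cong \<rho>X refl)
    then have "(\<lambda>z. z) \<in> \<rho>X \<Otimes>\<^sub>M (borel :: real measure) \<rightarrow>\<^sub>M borel \<Otimes>\<^sub>M borel"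
      by (rule measurable_ident_sets)
    then show "case_prod Pair \<in> \<rho>X \<Otimes>\<^sub>M (borel :: real measure) \<rightarrow>\<^sub>M borel \<Otimes>\<^sub>M borel"
      by (simp add: case_prod_beta')
  qed
  have Pair_meas: "Pair x \<in> c x \<rightarrow>\<^sub>M borel \<Otimes>\<^sub>M borel" for x
    unfolding measurable_cong_sets[OF c(2) refl] by measurable
  have "\<rho> = \<rho>X \<bind> k"
  proof (rule measure_eqI_generator_eq[OF Int_stable_pair_measure_generator[of borel borel]])
    show "{a \<times> b |a b. a \<in> sets borel \<and> b \<in> sets borel} \<subseteq> Pow (UNIV :: ('a \<times> real) set)" by simp
    show "sets \<rho> = sigma_sets UNIV {a \<times> b |a b. a \<in> sets borel \<and> b \<in> sets borel}"
      by (simp add: \<rho>(2) sets_pair_measure)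
    show "sets (\<rho>X \<bind> k) = sigma_sets UNIV {a \<times> b |a b. a \<in> sets borel \<and> b \<in> sets borel}"
      using sets_bind_measurable[OF k] by (simp add: space sets_pair_measure)
    show "range (\<lambda>_::nat. UNIV :: ('a \<times> real) set) \<subseteq> {a \<times> b |a b. a \<in> sets borel \<and> b \<in> sets borel}"
      by (auto intro!: exI[of _ UNIV])
    show "emeasure \<rho> UNIV \<noteq> \<infinity>"
      using prob_space.emeasure_le_1[OF \<rho>(1), of UNIV] by (auto simp: top_unique)
    fix X :: "('a \<times> real) set" assume "X \<in> {a \<times> b |a b. a \<in> sets borel \<and> b \<in> sets borel}"
    then obtain a b where X: "X = a \<times> b" and a: "a \<in> sets borel" and b: "b \<in> sets borel" by auto
    have "emeasure (\<rho>X \<bind> k) X = (\<integral>\<^sup>+x. emeasure (k x) X \<partial>\<rho>X)"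
      using a b by (intro emeasure_bind[OF _ k]) (auto simp: space X)
    also have "\<dots> = (\<integral>\<^sup>+x. emeasure (c x) b * indicator a x \<partial>\<rho>X)"
    proof (rule nn_integral_cong)
      fix x
      have "emeasure (k x) X = emeasure (c x) (Pair x -` X \<inter> space (c x))"
        unfolding k_def using a b by (intro emeasure_distr Pair_meas) (auto simp: X)
      also have "Pair x -` X \<inter> space (c x) = (if x \<in> a then b else {})"
        using sets_eq_imp_space_eq[OF c(2)[of x]] by (auto simp: X)
      finally show "emeasure (k x) X = emeasure (c x) b * indicator a x" by simp
    qed
    also have "\<dots> = emeasure \<rho> X" unfolding X disint[OF a b] ..
    finally show "emeasure \<rho> X = emeasure (\<rho>X \<bind> k) X" by simp
  qed simp
  then have "(\<integral>\<^sup>+z. F (fst z) (snd z) \<partial>\<rho>) = (\<integral>\<^sup>+z. case_prod F z \<partial>(\<rho>X \<bind> k))"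
    by (simp add: case_prod_beta)
  also have "\<dots> = (\<integral>\<^sup>+x. (\<integral>\<^sup>+z. case_prod F z \<partial>k x) \<partial>\<rho>X)" by (rule nn_integral_bind[OF F k])
  also have "\<dots> = (\<integral>\<^sup>+x. (\<integral>\<^sup>+y. F x y \<partial>c x) \<partial>\<rho>X)"
    unfolding k_def using F by (subst nn_integral_distr[OF Pair_meas]) auto
  finally show ?thesis .
qed

lemma Lp_norm_nonneg:
  assumes "prob_space M" "in_Lp M p u"
  shows "0 \<le> Lp_norm M p u"
proof (cases "p = \<infinity>")
  case True
  interpret prob_space M by fact
  have "AE x in M. ereal \<bar>u x\<bar> \<le> esssup M (\<lambda>x. ereal \<bar>u x\<bar>)" by (rule esssup_AE)
  then have "AE x in M. 0 \<le> esssup M (\<lambda>x. ereal \<bar>u x\<bar>)"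
    by eventually_elim (metis abs_ge_zero ereal_less_eq(5) order_trans)
  then show ?thesis using True by (simp add: Lp_norm_def real_of_ereal_pos)
qed (simp add: Lp_norm_def)

section \<open>Numerical estimates for the constants\<close>

lemma powr_le_add_one: "(0::real) \<le> k \<Longrightarrow> 0 \<le> q \<Longrightarrow> q \<le> 1 \<Longrightarrow> k powr q \<le> 1 + k"
proof (cases "k \<le> 1")
  case True
  assume "0 \<le> k" "0 \<le> q" "q \<le> 1"
  then show ?thesis using True powr_le1[of q k] by simp
next
  case False
  assume "0 \<le> k" "0 \<le> q" "q \<le> 1"
  then have "k powr q \<le> k powr 1" using False by (intro powr_mono) auto
  then show ?thesis using False by simp
qed

text \<open>The factor \<open>1 / n\<close> is shared between the powers \<open>q\<close> and
  \<open>1 - q\<close>. Bounding \<open>k powr q\<close> by \<open>1 + k\<close> is one origin of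
  the factor \<open>1 + \<kappa>\<close> in the theorem, and \<open>t \<le> T\<close> is where the
  effective dimension replaces \<open>trace_phi\<close>.\<close>

lemma noise_factor_le:
  fixes k lam q t T n :: real
  assumes k: "0 \<le> k" and lam: "0 < lam" and q: "0 \<le> q" "q \<le> 1" and t: "0 \<le> t" "t \<le> T" and n: "0 < n"
  shows "sqrt ((k\<^sup>2 / lam) powr q * (if q = 1 then 1 else t powr (1 - q)) / n)
    \<le> (1 + k) * ((if q = 1 then 1 else (T / n) powr ((1 - q) / 2)) * (1 / (n * lam)) powr (q / 2))"
proof -
  have k2: "(k\<^sup>2 / lam) powr q = (k powr q)\<^sup>2 * (1 / lam) powr q"
  proof -
    have "(k\<^sup>2 / lam) powr q = (k * k * (1 / lam)) powr q" by (simp add: power2_eq_square)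
    also have "\<dots> = (k powr q)\<^sup>2 * (1 / lam) powr q"
      using k lam by (simp only: powr_mult power2_eq_square mult_nonneg_nonneg divide_nonneg_pos zero_le_one)
    finally show ?thesis .
  qed
  have half: "(a powr (s / 2))\<^sup>2 = a powr s" for a s :: real
    by (simp add: power2_eq_square flip: powr_add)
  have nq: "1 / n = (1 / n) powr q * (1 / n) powr (1 - q)" using n by (simp flip: powr_add)
  let ?B = "(if q = 1 then 1 else (t / n) powr ((1 - q) / 2)) * (1 / (n * lam)) powr (q / 2)"
  have "(k\<^sup>2 / lam) powr q * (if q = 1 then 1 else t powr (1 - q)) / n = (k powr q * ?B)\<^sup>2"
  proof (cases "q = 1")
    case True
    then show ?thesis using k n lam k2 half[of "1 / (n * lam)" 1] by (simp add: power_mult_distrib field_simps)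
  next
    case False
    have "(k\<^sup>2 / lam) powr q * t powr (1 - q) / n
        = (k powr q)\<^sup>2 * ((1 / lam) powr q * (1 / n) powr q) * (t powr (1 - q) * (1 / n) powr (1 - q))"
      unfolding k2 using nq by (simp add: mult_ac divide_inverse)
    also have "(1 / lam) powr q * (1 / n) powr q = (1 / (n * lam)) powr q"
      using n lam by (simp add: powr_mult[symmetric] mult.commute)
    also have "t powr (1 - q) * (1 / n) powr (1 - q) = (t / n) powr (1 - q)"
      using n t by (simp add: powr_mult[symmetric])
    finally show ?thesis using False t n lam half[of "t / n" "1 - q"] half[of "1 / (n * lam)" q]
      by (simp add: power_mult_distrib mult_ac)
  qed
  then have "sqrt ((k\<^sup>2 / lam) powr q * (if q = 1 then 1 else t powr (1 - q)) / n) = k powr q * ?B"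
    by simp
  also have "\<dots> \<le> (1 + k) * ((if q = 1 then 1 else (T / n) powr ((1 - q) / 2)) * (1 / (n * lam)) powr (q / 2))"
  proof (intro mult_mono powr_le_add_one k q)
    show "(if q = 1 then 1 else (t / n) powr ((1 - q) / 2)) \<le> (if q = 1 then 1 else (T / n) powr ((1 - q) / 2))"
      using q t n by (auto intro!: powr_mono2 divide_right_mono)
  qed (use k in auto)
  finally show ?thesis .
qed

text \<open>Arithmetic-geometric means give coefficients of at most 3, so 59 leaves ample
  room.\<close>

lemma constant_le:
  fixes k a b b' :: real
  assumes k: "0 \<le> k" and a: "0 \<le> a" and b: "0 \<le> b" "b \<le> b'"
  shows "1 + sqrt (k\<^sup>2 * b) + sqrt (4 * k ^ 4 * b\<^sup>2 + 12 * k ^ 6 * a * b)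
    \<le> (1 + 59 * k ^ 4 + 59 * k\<^sup>2) * (1 + a + b')"
proof -
  have 1: "sqrt (k\<^sup>2 * b) \<le> (k\<^sup>2 + b) / 2"
    using arith_geo_mean_sqrt[of "k\<^sup>2" b] b by simp
  \<comment> \<open>The mixed term is covered by the square of \<open>(k^2 + k^4) (a + b)\<close>:
    \<open>4 k^6\<close> and \<open>4 a b\<close> are below the squares of the two factors, and 16
    exceeds 12.\<close>
  have 2: "sqrt (4 * k ^ 4 * b\<^sup>2 + 12 * k ^ 6 * a * b) \<le> 2 * k\<^sup>2 * b + (k\<^sup>2 + k ^ 4) * (a + b)"
  proof (rule real_le_lsqrt)
    show "0 \<le> 2 * k\<^sup>2 * b + (k\<^sup>2 + k ^ 4) * (a + b)" using a b by simp
    have "4 * k ^ 6 \<le> (k\<^sup>2 + k ^ 4)\<^sup>2"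
      using zero_le_power2[of "k\<^sup>2 - k ^ 4"] by (simp add: power2_eq_square algebra_simps eval_nat_numeral)
    moreover have "4 * (a * b) \<le> (a + b)\<^sup>2"
      using zero_le_power2[of "a - b"] by (simp add: power2_eq_square algebra_simps)
    ultimately have "(4 * k ^ 6) * (4 * (a * b)) \<le> (k\<^sup>2 + k ^ 4)\<^sup>2 * (a + b)\<^sup>2"
      using a b by (intro mult_mono) auto
    moreover have "0 \<le> k ^ 6 * (a * b)" using a b k by simp
    moreover have "0 \<le> 4 * k\<^sup>2 * b * ((k\<^sup>2 + k ^ 4) * (a + b))" using a b by simp
    moreover have "(2 * k\<^sup>2 * b + (k\<^sup>2 + k ^ 4) * (a + b))\<^sup>2
        = 4 * k ^ 4 * b\<^sup>2 + 4 * k\<^sup>2 * b * ((k\<^sup>2 + k ^ 4) * (a + b)) + (k\<^sup>2 + k ^ 4)\<^sup>2 * (a + b)\<^sup>2"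
      by (simp add: power2_eq_square algebra_simps eval_nat_numeral)
    moreover have "12 * k ^ 6 * a * b = 12 * (k ^ 6 * (a * b))" "(4 * k ^ 6) * (4 * (a * b)) = 16 * (k ^ 6 * (a * b))"
      by simp_all
    ultimately show "4 * k ^ 4 * b\<^sup>2 + 12 * k ^ 6 * a * b \<le> (2 * k\<^sup>2 * b + (k\<^sup>2 + k ^ 4) * (a + b))\<^sup>2"
      by linarith
  qed
  have "1 + (k\<^sup>2 + b) / 2 + (2 * k\<^sup>2 * b + (k\<^sup>2 + k ^ 4) * (a + b)) \<le> (1 + 59 * k ^ 4 + 59 * k\<^sup>2) * (1 + a + b)"
  proof -
    have "0 \<le> k\<^sup>2 * a" "0 \<le> k\<^sup>2 * b" "0 \<le> k ^ 4 * a" "0 \<le> k ^ 4 * b" "0 \<le> k\<^sup>2" "0 \<le> k ^ 4" using a b by auto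
    then show ?thesis using a b by (simp add: algebra_simps)
  qed
  also have "\<dots> \<le> (1 + 59 * k ^ 4 + 59 * k\<^sup>2) * (1 + a + b')"
    using b by (intro mult_left_mono) auto
  finally show ?thesis using 1 2 by linarith
qed

section \<open>Conditional distributions and the final estimate\<close>

locale krr_cond = krr +
  fixes cond :: "'a \<Rightarrow> real measure"
  assumes cond_prob: "\<forall>x. prob_space (cond x) \<and> sets (cond x) = sets (borel :: real measure)"
    and cond_meas: "\<forall>B\<in>sets (borel :: real measure). (\<lambda>x. emeasure (cond x) B) \<in> borel_measurable borel"
    and cond_disint: "\<forall>A\<in>sets (borel :: 'a measure). \<forall>B\<in>sets (borel :: real measure).
                        emeasure \<rho> (A \<times> B) = (\<integral>\<^sup>+x\<in>A. emeasure (cond x) B \<partial>\<rho>X)"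
begin

lemma disintegrate:
  assumes "case_prod F \<in> borel_measurable (borel \<Otimes>\<^sub>M borel)"
  shows "(\<integral>\<^sup>+z. F (fst z) (snd z) \<partial>\<rho>) = (\<integral>\<^sup>+x. (\<integral>\<^sup>+y. F x y \<partial>cond x) \<partial>\<rho>X)"
  by (rule nn_integral_disintegrate)
     (use assms cond_prob cond_meas cond_disint P.prob_space_axioms sets_rhoX rho_borel borel_XR in auto)

abbreviation "fr \<equiv> regr_fun cond"
abbreviation "cv \<equiv> cond_var cond"

lemma fr_meas: "fr \<in> borel_measurable borel"
proof -
  have "cond \<in> borel \<rightarrow>\<^sub>M subprob_algebra borel"
    by (rule measurable_subprob_algebra) (use cond_prob cond_meas in \<open>auto simp: prob_space_imp_subprob_space\<close>)
  then show ?thesis unfolding regr_fun_def by (rule measurable_compose) measurable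
qed

lemma fr_meas_X: "fr \<in> borel_measurable \<rho>X"
  using fr_meas by (simp add: measurable_cong_sets[OF sets_rhoX refl])

lemma cv_nonneg: "0 \<le> cv x"
  unfolding cond_var_def by (intro integral_nonneg_AE) auto

text \<open>Conditional second moments are finite only almost everywhere, so bias and variance are
  separated off a null set.\<close>

lemma second_moment_finite: "AE x in \<rho>X. integrable (cond x) (\<lambda>y. y\<^sup>2)"
proof -
  have [measurable]: "cond \<in> \<rho>X \<rightarrow>\<^sub>M subprob_algebra borel"
    unfolding measurable_cong_sets[OF sets_rhoX refl]
    by (rule measurable_subprob_algebra) (use cond_prob cond_meas in \<open>auto simp: prob_space_imp_subprob_space\<close>)
  have "(\<integral>\<^sup>+x. (\<integral>\<^sup>+y. ennreal (y\<^sup>2) \<partial>cond x) \<partial>\<rho>X) = (\<integral>\<^sup>+z. ennreal ((snd z)\<^sup>2) \<partial>\<rho>)"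
    using disintegrate[of "\<lambda>x y. ennreal (y\<^sup>2)"] by simp
  also have "\<dots> < \<infinity>" using y_sq by (simp add: nn_integral_eq_integral)
  finally have "AE x in \<rho>X. (\<integral>\<^sup>+y. ennreal (y\<^sup>2) \<partial>cond x) \<noteq> \<infinity>"
    by (intro nn_integral_PInf_AE) auto
  then show ?thesis
  proof eventually_elim
    case (elim x)
    have "(\<lambda>y. y\<^sup>2) \<in> borel_measurable (cond x)"
      using cond_prob by (subst measurable_cong_sets[of _ borel]) auto
    then show ?case using elim by (intro integrableI_nonneg) (auto simp: less_top)
  qed
qed

lemma bias_variance:
  assumes "integrable (cond x) (\<lambda>y. y\<^sup>2)"
  shows "(\<integral>\<^sup>+y. ennreal ((y - c)\<^sup>2) \<partial>cond x) = ennreal (cv x + (fr x - c)\<^sup>2)"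
proof -
  interpret C: prob_space "cond x" using cond_prob by simp
  have m: "(\<lambda>y. y) \<in> borel_measurable (cond x)"
    using cond_prob by (subst measurable_cong_sets[of _ borel]) auto
  have i: "integrable (cond x) (\<lambda>y. y)" by (rule C.square_integrable_imp_integrable[OF m assms])
  have p: "C.prob UNIV = 1" using C.prob_space cond_prob sets_eq_imp_space_eq[of "cond x" borel] by simp
  have eq: "(y - c)\<^sup>2 = y\<^sup>2 - 2 * c * y + c\<^sup>2" for y c :: real by (simp add: power2_eq_square algebra_simps)
  have int: "integrable (cond x) (\<lambda>y. (y - c)\<^sup>2)" for c unfolding eq using assms i by auto
  have val: "(\<integral>y. (y - c)\<^sup>2 \<partial>cond x) = (\<integral>y. y\<^sup>2 \<partial>cond x) - 2 * c * fr x + c\<^sup>2" for c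
    unfolding eq regr_fun_def using assms i by (simp add: C.prob_space)
  have "(\<integral>\<^sup>+y. ennreal ((y - c)\<^sup>2) \<partial>cond x) = ennreal (\<integral>y. (y - c)\<^sup>2 \<partial>cond x)"
    using int by (intro nn_integral_eq_integral) auto
  also have "(\<integral>y. (y - c)\<^sup>2 \<partial>cond x) = cv x + (fr x - c)\<^sup>2"
    unfolding cond_var_def val by (simp add: power2_eq_square algebra_simps)
  finally show ?thesis .
qed

lemma fr_sq_int: "integrable \<rho>X (\<lambda>x. (fr x)\<^sup>2)"
proof (rule integrableI_nonneg)
  have "(\<integral>\<^sup>+x. ennreal ((fr x)\<^sup>2) \<partial>\<rho>X) \<le> (\<integral>\<^sup>+x. (\<integral>\<^sup>+y. ennreal (y\<^sup>2) \<partial>cond x) \<partial>\<rho>X)"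
    using second_moment_finite
  proof (intro nn_integral_mono_AE, eventually_elim)
    case (elim x)
    then show ?case using bias_variance[of x 0] cv_nonneg[of x] by (simp add: ennreal_leI)
  qed
  also have "\<dots> = (\<integral>\<^sup>+z. ennreal ((snd z)\<^sup>2) \<partial>\<rho>)"
    using disintegrate[of "\<lambda>x y. ennreal (y\<^sup>2)"] by simp
  also have "\<dots> < \<infinity>" using y_sq by (simp add: nn_integral_eq_integral)
  finally show "(\<integral>\<^sup>+x. ennreal ((fr x)\<^sup>2) \<partial>\<rho>X) < \<infinity>" .
qed (use fr_meas_X in auto)

interpretation S: ip_space "{f :: 'a \<Rightarrow> real. f \<in> borel_measurable \<rho>X \<and> integrable \<rho>X (\<lambda>x. (f x)\<^sup>2)}" L2
  unfolding L2_def [abs_def] by (rule ip_space_square_integrable)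

lemma rkhs_square_integrable: "f \<in> rkhs K \<Longrightarrow> f \<in> {f. f \<in> borel_measurable \<rho>X \<and> integrable \<rho>X (\<lambda>x. (f x)\<^sup>2)}"
  using f_meas_X integrable_prod[of f f] by (simp add: power2_eq_square)

lemma fr_in: "fr \<in> {f. f \<in> borel_measurable \<rho>X \<and> integrable \<rho>X (\<lambda>x. (f x)\<^sup>2)}"
  using fr_meas_X fr_sq_int by simp

definition bias :: real where "bias = Lp_norm \<rho>X 2 (\<lambda>x. fl x - fr x)"

lemma Lp_norm_2_L2:
  assumes "g \<in> {f. f \<in> borel_measurable \<rho>X \<and> integrable \<rho>X (\<lambda>x. (f x)\<^sup>2)}"
  shows "Lp_norm \<rho>X 2 g = sqrt (L2 g g)"
  unfolding L2_def using assms by (intro Lp_norm_2) simp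

lemma fl_minus_fr: "(\<lambda>x. fl x - fr x) = fl - fr" by auto

lemma bias_sq: "bias\<^sup>2 = (\<integral>x. (fl x - fr x)\<^sup>2 \<partial>\<rho>X)" and bias_nonneg: "0 \<le> bias"
  and bias_int: "integrable \<rho>X (\<lambda>x. (fl x - fr x)\<^sup>2)"
proof -
  have mem: "(\<lambda>x. fl x - fr x) \<in> {f. f \<in> borel_measurable \<rho>X \<and> integrable \<rho>X (\<lambda>x. (f x)\<^sup>2)}"
    unfolding fl_minus_fr by (rule S.V_mem(3)[OF rkhs_square_integrable[OF fl_in] fr_in])
  then show "integrable \<rho>X (\<lambda>x. (fl x - fr x)\<^sup>2)" by simp
  have "bias = sqrt (L2 (\<lambda>x. fl x - fr x) (\<lambda>x. fl x - fr x))"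
    unfolding bias_def by (rule Lp_norm_2_L2[OF mem])
  then show "bias\<^sup>2 = (\<integral>x. (fl x - fr x)\<^sup>2 \<partial>\<rho>X)" "0 \<le> bias"
    using L2_nonneg by (simp_all add: L2_def power2_eq_square)
qed

lemma total_error_le:
  assumes N: "0 < N"
  shows "Lp_norm \<rho>X 2 (\<lambda>x. f_sample K lam N D x - fr x) \<le> bias + sqrt (L.nsq (err N D))"
proof -
  have e: "err N D \<in> rkhs K" by (rule err_in[OF N])
  have eq: "(\<lambda>x. f_sample K lam N D x - fr x) = (fl - fr) + err N D"
    by (rule ext) (simp add: err_def[OF N])
  note m1 = S.V_mem(3)[OF rkhs_square_integrable[OF fl_in] fr_in]
  note m2 = rkhs_square_integrable[OF e]
  have "Lp_norm \<rho>X 2 (\<lambda>x. f_sample K lam N D x - fr x) = sqrt (L2 ((fl - fr) + err N D) ((fl - fr) + err N D))"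
    unfolding eq by (rule Lp_norm_2_L2[OF S.V_mem(2)[OF m1 m2]])
  also have "\<dots> \<le> sqrt (L2 (fl - fr) (fl - fr)) + sqrt (L2 (err N D) (err N D))"
    by (rule S.norm_triangle[OF m1 m2])
  also have "sqrt (L2 (fl - fr) (fl - fr)) = bias"
    unfolding bias_def fl_minus_fr by (rule Lp_norm_2_L2[OF m1, symmetric])
  also have "sqrt (L2 (err N D) (err N D)) \<le> sqrt (L.nsq (err N D))"
    using K.H.ip_nonneg[OF e] lam_pos by (simp add: ipl_def)
  finally show ?thesis by simp
qed

text \<open>Given \<open>x\<close>, the mean square of \<open>eta\<close> splits into conditional
  variance and squared bias. The variance keeps the weight \<open>phi\<close> for Hoelder's
  inequality; the bias is only known to be square integrable, so there \<open>phi\<close> is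
  replaced by its uniform bound. This is the origin of \<open>1 / sqrt (N lam)\<close> in front of
  the bias.\<close>

lemma noise_le:
  assumes p: "1 \<le> p" and var_Lp: "in_Lp \<rho>X p cv" and N: "0 < N"
  defines "q \<equiv> real_of_ereal (inverse p)"
  shows "noise N \<le> (Lp_norm \<rho>X p cv * (\<kappa>\<^sup>2 / lam) powr q * (if q = 1 then 1 else trace_phi powr (1 - q))
    + \<kappa>\<^sup>2 / lam * bias\<^sup>2) / real N"
proof -
  let ?H = "Lp_norm \<rho>X p cv * (\<kappa>\<^sup>2 / lam) powr q * (if q = 1 then 1 else trace_phi powr (1 - q))"
  have H0: "0 \<le> ?H" using Lp_norm_nonneg[OF PX.prob_space_axioms var_Lp] by simp
  note [measurable] = f_meas[OF fl_in] phi_meas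
  have cvm [measurable]: "cv \<in> borel_measurable \<rho>X" using var_Lp by (simp add: in_Lp_def)
  note [measurable] = phi_meas_X f_meas_X[OF fl_in] fr_meas_X
  have "ennreal (\<integral>z. (eta z)\<^sup>2 * phi (fst z) \<partial>\<rho>) = (\<integral>\<^sup>+z. ennreal ((eta z)\<^sup>2 * phi (fst z)) \<partial>\<rho>)"
    using eta_sq_phi_int phi_nonneg by (intro nn_integral_eq_integral[symmetric]) auto
  also have "\<dots> = (\<integral>\<^sup>+z. ennreal ((snd z - fl (fst z))\<^sup>2 * phi (fst z)) \<partial>\<rho>)" by (simp add: eta_def)
  also have "\<dots> = (\<integral>\<^sup>+x. (\<integral>\<^sup>+y. ennreal ((y - fl x)\<^sup>2 * phi x) \<partial>cond x) \<partial>\<rho>X)"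
    by (rule disintegrate[of "\<lambda>x y. ennreal ((y - fl x)\<^sup>2 * phi x)"]) measurable
  also have "\<dots> \<le> (\<integral>\<^sup>+x. ennreal (cv x * phi x) + ennreal (\<kappa>\<^sup>2 / lam * (fl x - fr x)\<^sup>2) \<partial>\<rho>X)"
    using second_moment_finite
  proof (intro nn_integral_mono_AE, eventually_elim)
    case (elim x)
    have "(\<lambda>y. y - fl x) \<in> borel_measurable (cond x)"
      using cond_prob by (subst measurable_cong_sets[of _ borel]) auto
    then have "(\<integral>\<^sup>+y. ennreal ((y - fl x)\<^sup>2 * phi x) \<partial>cond x) = ennreal (phi x) * (\<integral>\<^sup>+y. ennreal ((y - fl x)\<^sup>2) \<partial>cond x)"
      using nn_integral_ennreal_cmult[OF phi_nonneg, of "\<lambda>y. (y - fl x)\<^sup>2" "cond x" x] by (simp add: mult.commute)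
    also have "\<dots> = ennreal (phi x * (cv x + (fr x - fl x)\<^sup>2))"
      unfolding bias_variance[OF elim(2)] using phi_nonneg cv_nonneg by (simp add: ennreal_mult)
    also have "\<dots> \<le> ennreal (cv x * phi x + \<kappa>\<^sup>2 / lam * (fl x - fr x)\<^sup>2)"
    proof (rule ennreal_leI)
      have "phi x * (fr x - fl x)\<^sup>2 \<le> \<kappa>\<^sup>2 / lam * (fl x - fr x)\<^sup>2"
        unfolding power2_commute[of "fr x"] using phi_le by (intro mult_right_mono) auto
      then show "phi x * (cv x + (fr x - fl x)\<^sup>2) \<le> cv x * phi x + \<kappa>\<^sup>2 / lam * (fl x - fr x)\<^sup>2"
        by (simp add: algebra_simps)
    qed
    also have "\<dots> = ennreal (cv x * phi x) + ennreal (\<kappa>\<^sup>2 / lam * (fl x - fr x)\<^sup>2)"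
      using cv_nonneg phi_nonneg lam_pos by (intro ennreal_plus) auto
    finally show ?case .
  qed
  also have "\<dots> = (\<integral>\<^sup>+x. ennreal (cv x * phi x) \<partial>\<rho>X) + (\<integral>\<^sup>+x. ennreal (\<kappa>\<^sup>2 / lam * (fl x - fr x)\<^sup>2) \<partial>\<rho>X)"
    by (rule nn_integral_add) measurable
  also have "(\<integral>\<^sup>+x. ennreal (\<kappa>\<^sup>2 / lam * (fl x - fr x)\<^sup>2) \<partial>\<rho>X) = ennreal (\<kappa>\<^sup>2 / lam * bias\<^sup>2)"
    unfolding bias_sq using bias_int lam_pos by (subst nn_integral_eq_integral) auto
  also have "(\<integral>\<^sup>+x. ennreal (cv x * phi x) \<partial>\<rho>X) \<le> ennreal ?H"
    unfolding q_def trace_phi_def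
    by (rule Hoelder_bounded_weight[OF PX.prob_space_axioms var_Lp cv_nonneg p phi_meas_X phi_nonneg phi_le phi_int])
  also have "ennreal ?H + ennreal (\<kappa>\<^sup>2 / lam * bias\<^sup>2) = ennreal (?H + \<kappa>\<^sup>2 / lam * bias\<^sup>2)"
    using H0 lam_pos by (intro ennreal_plus[symmetric]) auto
  finally have "ennreal (\<integral>z. (eta z)\<^sup>2 * phi (fst z) \<partial>\<rho>) \<le> ennreal (?H + \<kappa>\<^sup>2 / lam * bias\<^sup>2)"
    by (simp add: add_right_mono)
  moreover have "0 \<le> ?H + \<kappa>\<^sup>2 / lam * bias\<^sup>2"
    using H0 lam_pos by (intro add_nonneg_nonneg) auto
  ultimately have "(\<integral>z. (eta z)\<^sup>2 * phi (fst z) \<partial>\<rho>) \<le> ?H + \<kappa>\<^sup>2 / lam * bias\<^sup>2"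
    by (simp only: ennreal_le_iff)
  then show ?thesis unfolding noise_def[OF N] by (intro divide_right_mono) auto
qed

lemma expected_error:
  assumes p: "1 \<le> p" and var_Lp: "in_Lp \<rho>X p cv" and N: "0 < N"
  defines "q \<equiv> real_of_ereal (inverse p)" and "ND \<equiv> eff_dim \<rho>X K lam"
  shows "(\<integral>\<^sup>+D. ennreal (Lp_norm \<rho>X 2 (\<lambda>x. f_sample K lam N D x - fr x)) \<partial>(PiM {..<N} (\<lambda>_. \<rho>)))
    \<le> ennreal ((1 + 59 * \<kappa> ^ 4 + 59 * \<kappa>\<^sup>2) * (1 + \<kappa>)
        * (1 + 1 / (real N * lam)\<^sup>2 + ND / (real N * lam))
        * ((1 + 1 / sqrt (real N * lam)) * bias
           + sqrt (Lp_norm \<rho>X p cv) * (if q = 1 then 1 else (ND / real N) powr ((1 - q) / 2))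
             * (1 / (real N * lam)) powr (q / 2)))"
proof -
  let ?P = "PiM {..<N} (\<lambda>_. \<rho>)"
  interpret PP: prob_space ?P by (intro prob_space_PiM P.prob_space_axioms)
  have q: "0 \<le> q" "q \<le> 1"
    using p by (cases p; simp add: q_def one_ereal_def inverse_eq_divide)+
  have ND: "trace_phi \<le> ND" unfolding ND_def by (rule trace_phi_le_eff_dim)
  define L where "L = Lp_norm \<rho>X p cv"
  have L0: "0 \<le> L" unfolding L_def by (rule Lp_norm_nonneg[OF PX.prob_space_axioms var_Lp])
  define b where "b = (if q = 1 then 1 else (ND / real N) powr ((1 - q) / 2)) * (1 / (real N * lam)) powr (q / 2)"
  define s where "s = 1 / sqrt (real N * lam)"
  have b0: "0 \<le> b" and s0: "0 \<le> s" using lam_pos by (auto simp: b_def s_def)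
  define C where "C = (1 + 59 * \<kappa> ^ 4 + 59 * \<kappa>\<^sup>2) * (1 + M1 N + ND / (real N * lam))"
  define G where "G = 1 + sqrt (\<kappa>\<^sup>2 * M2 N) + sqrt (4 * \<kappa> ^ 4 * (M2 N)\<^sup>2 + 12 * \<kappa> ^ 6 * M1 N * M2 N)"
  have G0: "1 \<le> G" unfolding G_def using M_nonneg[OF N] kappa_nonneg by simp
  have GC: "G \<le> C"
    unfolding G_def C_def using M_nonneg[OF N] kappa_nonneg ND lam_pos
    by (intro constant_le) (auto simp: M2_def[OF N] divide_right_mono)
  have noise: "sqrt (noise N) \<le> (1 + \<kappa>) * (s * bias + sqrt L * b)"
  proof -
    let ?W = "(\<kappa>\<^sup>2 / lam) powr q * (if q = 1 then 1 else trace_phi powr (1 - q)) / real N"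
    have "noise N \<le> L * ?W + \<kappa>\<^sup>2 / lam * bias\<^sup>2 / real N"
      using noise_le[OF p var_Lp N] unfolding q_def[symmetric] L_def[symmetric]
      by (simp only: add_divide_distrib mult.assoc times_divide_eq_right)
    then have "sqrt (noise N) \<le> sqrt (L * ?W + \<kappa>\<^sup>2 / lam * bias\<^sup>2 / real N)" by simp
    also have "\<dots> \<le> sqrt (L * ?W) + sqrt (\<kappa>\<^sup>2 / lam * bias\<^sup>2 / real N)"
      using L0 lam_pos by (intro sqrt_add_le_add_sqrt) auto
    also have "sqrt (\<kappa>\<^sup>2 / lam * bias\<^sup>2 / real N) = \<kappa> * (s * bias)"
      using kappa_nonneg bias_nonneg by (simp add: s_def real_sqrt_mult real_sqrt_divide)
    also have "sqrt (L * ?W) = sqrt L * sqrt ?W" by (rule real_sqrt_mult)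
    also have "\<dots> \<le> sqrt L * ((1 + \<kappa>) * b)"
      unfolding b_def using noise_factor_le[OF kappa_nonneg lam_pos q trace_phi_nonneg ND, of "real N"] N L0
      by (intro mult_left_mono) auto
    finally have "sqrt (noise N) \<le> sqrt L * ((1 + \<kappa>) * b) + \<kappa> * (s * bias)" by simp
    also have "\<dots> \<le> (1 + \<kappa>) * (s * bias + sqrt L * b)"
      using s0 bias_nonneg by (simp add: algebra_simps)
    finally show ?thesis .
  qed
  \<comment> \<open>Monotonicity of the nonnegative integral asks for no measurability, so the
    minimizer chosen in \<open>f_sample\<close> never has to be shown measurable in
    \<open>D\<close>.\<close>
  have "(\<integral>\<^sup>+D. ennreal (Lp_norm \<rho>X 2 (\<lambda>x. f_sample K lam N D x - fr x)) \<partial>?P)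
      \<le> (\<integral>\<^sup>+D. ennreal bias + ennreal ((1 + dev2 N D + (dev2 N D)\<^sup>2) * dev1 N D) \<partial>?P)"
  proof (rule nn_integral_mono)
    fix D
    have "Lp_norm \<rho>X 2 (\<lambda>x. f_sample K lam N D x - fr x) \<le> bias + (1 + dev2 N D + (dev2 N D)\<^sup>2) * dev1 N D"
      using total_error_le[OF N, of D] err_le[OF N, of D] by linarith
    then have "ennreal (Lp_norm \<rho>X 2 (\<lambda>x. f_sample K lam N D x - fr x))
        \<le> ennreal (bias + (1 + dev2 N D + (dev2 N D)\<^sup>2) * dev1 N D)" by (rule ennreal_leI)
    also have "\<dots> = ennreal bias + ennreal ((1 + dev2 N D + (dev2 N D)\<^sup>2) * dev1 N D)"
      using bias_nonneg dev_nonneg[OF N] by (intro ennreal_plus) auto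
    finally show "ennreal (Lp_norm \<rho>X 2 (\<lambda>x. f_sample K lam N D x - fr x))
        \<le> ennreal bias + ennreal ((1 + dev2 N D + (dev2 N D)\<^sup>2) * dev1 N D)" .
  qed
  also have "\<dots> = ennreal bias + (\<integral>\<^sup>+D. ennreal ((1 + dev2 N D + (dev2 N D)\<^sup>2) * dev1 N D) \<partial>?P)"
    using dev_meas[OF N] by (subst nn_integral_add) (auto simp: PP.emeasure_space_1)
  also have "\<dots> \<le> ennreal bias + ennreal (G * sqrt (noise N))"
    unfolding G_def by (intro add_left_mono expected_deviation[OF N])
  also have "\<dots> = ennreal (bias + G * sqrt (noise N))"
    using bias_nonneg G0 M_nonneg[OF N] by (intro ennreal_plus[symmetric]) auto
  also have "\<dots> \<le> ennreal (C * (1 + \<kappa>) * ((1 + s) * bias + sqrt L * b))"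
  proof (rule ennreal_leI)
    have "G * sqrt (noise N) \<le> C * ((1 + \<kappa>) * (s * bias + sqrt L * b))"
      using GC noise G0 M_nonneg[OF N] by (intro mult_mono) auto
    \<comment> \<open>The deterministic bias is absorbed because \<open>C\<close> and
      \<open>1 + \<kappa>\<close> are at least 1.\<close>
    moreover have "1 * bias \<le> (C * (1 + \<kappa>)) * bias"
      using GC G0 kappa_nonneg bias_nonneg mult_mono[of 1 C 1 "1 + \<kappa>"] by (intro mult_right_mono) auto
    ultimately show "bias + G * sqrt (noise N) \<le> C * (1 + \<kappa>) * ((1 + s) * bias + sqrt L * b)"
      by (simp add: algebra_simps)
  qed
  also have "C * (1 + \<kappa>) * ((1 + s) * bias + sqrt L * b) =
      (1 + 59 * \<kappa> ^ 4 + 59 * \<kappa>\<^sup>2) * (1 + \<kappa>)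
        * (1 + 1 / (real N * lam)\<^sup>2 + ND / (real N * lam))
        * ((1 + 1 / sqrt (real N * lam)) * bias
           + sqrt (Lp_norm \<rho>X p cv) * (if q = 1 then 1 else (ND / real N) powr ((1 - q) / 2))
             * (1 / (real N * lam)) powr (q / 2))"
    unfolding C_def M1_def[OF N] s_def b_def L_def by (simp only: mult_ac)
  finally show ?thesis .
qed

end

theorem theorem2:
  fixes \<rho> :: "('a::metric_space \<times> real) measure"
    and \<rho>X :: "'a measure"
    and cond :: "'a \<Rightarrow> real measure"
    and K :: "'a \<Rightarrow> 'a \<Rightarrow> real"
    and p :: ereal
    and N :: nat
    and lam :: real
  assumes X_compact: "compact (UNIV :: 'a set)"
    and rho_prob: "prob_space \<rho>"
    and rho_borel: "sets \<rho> = sets (borel :: ('a \<times> real) measure)"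
    and rhoX_marginal: "\<rho>X = distr \<rho> borel fst"
    and cond_prob: "\<forall>x. prob_space (cond x) \<and> sets (cond x) = sets (borel :: real measure)"
    and cond_meas: "\<forall>B\<in>sets (borel :: real measure). (\<lambda>x. emeasure (cond x) B) \<in> borel_measurable borel"
    and cond_disint: "\<forall>A\<in>sets (borel :: 'a measure). \<forall>B\<in>sets (borel :: real measure).
                        emeasure \<rho> (A \<times> B) = (\<integral>\<^sup>+x\<in>A. emeasure (cond x) B \<partial>\<rho>X)"
    and K_mercer: "mercer_kernel K"
    and y_sq: "integrable \<rho> (\<lambda>z. (snd z)\<^sup>2)"
    and p_ge: "1 \<le> p"
    and var_Lp: "in_Lp \<rho>X p (cond_var cond)"
    and N_pos: "0 < N"
    and lam_pos: "0 < lam"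
  shows
    "(\<integral>\<^sup>+D. ennreal (Lp_norm \<rho>X 2 (\<lambda>x. f_sample K lam N D x - regr_fun cond x))
         \<partial>(PiM {..<N} (\<lambda>_. \<rho>)))
     \<le> ennreal (
        (let \<kappa> = (SUP x. sqrt (K x x));
             ND = eff_dim \<rho>X K lam;
             q = real_of_ereal (inverse p)
         in (1 + 59 * \<kappa> ^ 4 + 59 * \<kappa>\<^sup>2) * (1 + \<kappa>)
            * (1 + 1 / (real N * lam)\<^sup>2 + ND / (real N * lam))
            * ((1 + 1 / sqrt (real N * lam))
                 * Lp_norm \<rho>X 2 (\<lambda>x. f_lambda \<rho> K lam x - regr_fun cond x)
               + sqrt (Lp_norm \<rho>X p (cond_var cond))
                 * (if q = 1 then 1 else (ND / real N) powr ((1 - q) / 2))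
                 * (1 / (real N * lam)) powr (q / 2))))"
proof -
  interpret krr_cond \<rho> \<rho>X K lam cond
    by (intro krr_cond.intro krr.intro krr_cond_axioms.intro assms)
  show ?thesis
    using expected_error[OF p_ge var_Lp N_pos] unfolding \<kappa>_def bias_def fl_def Let_def .
qed

end
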